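(* Let $w\in\widetilde W_\infty$ be a skew element and let $(\lambda,\mu)$ be a compatible pair of typed $k$-strict partitions (for some $k\ge1$) such that $w_\lambda=w\,w_\mu$. Then the number of reduced words for $w$ is equal to the number of standard typed $k'$-tableaux on $\lambda/\mu$.
   Context: Let $k\ge1$ be an integer, and $n\ge k$. **Partitions.** A partition $\lambda$ is identified with its Young diagram of boxes $[r,c]$ (row $r$, column $c$); $\mu\subset\lambda$ means containment of diagrams, $\lambda/\mu$ is the set-theoretic difference. $\ell(\lambda)$ is the number of nonzero parts. $\lambda$ is *$k$-strict* if all its parts greater than $k$ are distinct; $\ell_k(\lambda)=\#\{i:\lambda_i>k\}$. A *typed $k$-strict partition* is a $k$-strict partition $\lambda$ together with an integer $\mathrm{type}(\lambda)\in\{0,1,2\}$ such that $\mathrm{type}(\lambda)>0$ if and only if $\lambda_j=k$ for some $j$. For typed partitions, $\mu\subset\lambda$ refers to the underlying diagrams. $\widetilde{\mathcal P}(k,n)$ is the set of typed $k$-strict partitions whose diagrams fit inside a rectangle of size $(n+1-k)\times(n+k)$. **Typed $k'$-horizontal strips.** Boxes $[r,c]$, $[r',c']$ are *$k'$-related* if $|c-k-\frac12|+r=|c'-k-\frac12|+r'$. A skew diagram is a horizontal (resp. vertical) strip if it has no two boxes in the same column (resp. row). For $k$-strict $\lambda,\nu$ let $\alpha_i$ (resp. $\beta_i$) be the number of boxes of $\lambda$ (resp. $\nu$) in column $i$, $1\le i\le k$. Write $\lambda\to\nu$ if $\nu$ can be obtained by removing a vertical strip from the first $k$ columns of $\lambda$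 and adding a horizontal strip to the result, so that for each $1\le i\le k$: (1) if $\beta_i=\alpha_i$, then the box $[\alpha_i,i]$ is $k'$-related to at most one box of $\nu\smallsetminus\lambda$; (2) if $\beta_i<\alpha_i$, then the boxes $[\beta_i,i],\ldots,[\alpha_i,i]$ are each $k'$-related to exactly one box of $\nu\smallsetminus\lambda$, and these boxes of $\nu\smallsetminus\lambda$ all lie in the same row. For $k$-strict $\mu\subset\lambda$ with $|\lambda|=|\mu|+r$, $\lambda/\mu$ is a *$k'$-horizontal strip* if $\lambda\to(p+r,\mu_1,\mu_2,\ldots)$ for any $p\ge\max(\lambda_1+1,\ell(\lambda)+2k-1)$ (the choice of $p$ does not matter). For typed $k$-strict $\mu\subset\lambda$, $\lambda/\mu$ is a *typed $k'$-horizontal strip* if the underlying pair is a $k'$-horizontal strip and $\mathrm{type}(\lambda)+\mathrm{type}(\mu)\neq 3$. **Standard typed $k'$-tableaux.** A *typed $k'$-tableau* $T$ of shape $\lambda/\mu$ is a sequence of typed $k$-strict partitions $\mu=\lambda^0\subset\lambda^1\subset\cdots\subset\lambda^r=\lambda$ such that each $\lambda^i/\lambda^{i-1}$ is a typed $k'$-horizontal strip. It is represented by the filling of $\lambda/\mu$ in which the boxes of $\lambda^i/\lambda^{i-1}$ get the entry $i$ if $\mathrm{type}(\lambda^i)\ne2$ and $i^\circ$ if $\mathrm{type}(\lambda^i)=2$. (Sequences differing only by repetitions of $\lambda$ at the end count as the same tableau.) It is *standard* if the entries $1,2,\ldots,|\lambda|-|\mu|$, circled or not, each appear exactly once. **Weyl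 group.** $\widetilde W_{n+1}$ is the Weyl group of type $\mathrm D_{n+1}$: signed permutations of $\{1,\ldots,n+1\}$ with an even number of sign changes (written in one-line notation, a bar denoting a sign), generated by $s_i=(i,i+1)$, $1\le i\le n$, and $s_0$, acting on the right: $s_i$ exchanges the entries in positions $i,i+1$, and $(u_1,u_2,u_3,\ldots)s_0=(\overline u_2,\overline u_1,u_3,\ldots)$. $\widetilde W_\infty=\bigcup_n\widetilde W_{n+1}$ under the natural inclusions. $\ell(w)$ is the Coxeter length; a reduced word for $w$ is a sequence $(a_1,\ldots,a_\ell)$ with $w=s_{a_1}\cdots s_{a_\ell}$ and $\ell=\ell(w)$. A factorization $w=uv$ is reduced if $\ell(w)=\ell(u)+\ell(v)$. **The elements $w_\lambda$.** Let $\lambda\in\widetilde{\mathcal P}(k,n)$, let $\lambda^1$ be the strict partition obtained by removing the first $k$ columns of $\lambda$, $r=\ell_k(\lambda)$ its length, and $\lambda'_i$ the number of boxes in column $i$ of $\lambda$. For $1\le d\le n$, the $d$-th diagonal is the set of boxes $[a,c]$ with $a\ge1$, $c>k$, $a+c=k+d+1$ that are not in $\lambda$, and its length is its cardinality; the $0$-th diagonal is empty, of length $0$. The $d$-th diagonal is *related* if $d=\lambda'_i+k-i$ for some $1\le i\le k$ (equivalently it is $k'$-related to a bottom box $[\lambda'_i,i]$, where $\lambda_i'=0$ is allowed), otherwise non-related. Let $u_1<\cdots<u_k$ be the lengths of the related diagonals and $v_1<v_2<\cdots$ the positive lengths of the non-related diagonals. If $\mathrm{type}(\lambda)=1$, $$w_\lambda=(u_1+1,\ldots,u_k+1,\overline{\lambda^1_1+1},\ldots,\overline{\lambda^1_r+1},\widetilde1,v_1+1,\ldots,v_{n-k-r}+1);$$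 if $\mathrm{type}(\lambda)=2$, $w_\lambda$ is given by the same formula with first entry $\overline{u_1+1}$ in place of $u_1+1$; if $\mathrm{type}(\lambda)=0$ (then $u_1=0$), $$w_\lambda=(\widetilde1,u_2+1,\ldots,u_k+1,\overline{\lambda^1_1+1},\ldots,\overline{\lambda^1_r+1},v_1+1,\ldots,v_{n+1-k-r}+1).$$ Here $\widetilde1\in\{1,\overline1\}$ is chosen so that the number of barred entries is even. (For example $k=3,n=7$, $\lambda=(8,4,3,2)$ of type $1$ gives $w_\lambda=(3,5,7,\overline6,\overline2,1,4,8)$.) As an element of $\widetilde W_\infty$, $w_\lambda$ depends on $\lambda$ and $k$ but not on $n$; one has $\ell(w_\lambda)=|\lambda|$. **Skew elements and compatible pairs.** $w\in\widetilde W_\infty$ is *skew* if there exist a typed $k$-strict partition $\lambda$ (for some $k$) and a reduced factorization $w_\lambda=ww'$ in $\widetilde W_\infty$. For typed $k$-strict $\mu\subset\lambda$ in $\widetilde{\mathcal P}(k,n)$, $(\lambda,\mu)$ is a *compatible pair* if there is a reduced word for $w_\lambda$ whose last $|\mu|$ entries form a reduced word for $w_\mu$; equivalently $\ell(w_\lambda w_\mu^{-1})=|\lambda|-|\mu|$. *)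

theory Defs
  imports Complex_Main "HOL-Combinatorics.Combinatorics"
begin

text \<open>
  A partition is the list of its nonzero parts in weakly decreasing order.  Rows and columns of
  Young diagrams are numbered from 1, so the list entry \<open>lam ! 0\<close> is the first part.
\<close>

definition is_partition :: "nat list \<Rightarrow> bool" where
  "is_partition lam \<longleftrightarrow> sorted_wrt (\<ge>) lam \<and> (\<forall>x\<in>set lam. 0 < x)"

definition diagram :: "nat list \<Rightarrow> (nat \<times> nat) set" where
  "diagram lam = {(r, c). 1 \<le> r \<and> r \<le> length lam \<and> 1 \<le> c \<and> c \<le> lam ! (r - 1)}"

definition col_len :: "nat list \<Rightarrow> nat \<Rightarrow> nat" where
  "col_len lam i = card {r. (r, i) \<in> diagram lam}"

definition first_part :: "nat list \<Rightarrow> nat" where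
  "first_part lam = (case lam of [] \<Rightarrow> 0 | x # _ \<Rightarrow> x)"

definition k_strict :: "nat \<Rightarrow> nat list \<Rightarrow> bool" where
  "k_strict k lam \<longleftrightarrow> is_partition lam \<and> distinct (filter (\<lambda>x. k < x) lam)"

type_synonym typed_partition = "nat list \<times> nat"

abbreviation shape :: "typed_partition \<Rightarrow> nat list" where "shape \<equiv> fst"
abbreviation ptype :: "typed_partition \<Rightarrow> nat" where "ptype \<equiv> snd"

abbreviation psize :: "typed_partition \<Rightarrow> nat" where
  "psize L \<equiv> sum_list (shape L)"

definition typed_k_strict :: "nat \<Rightarrow> typed_partition \<Rightarrow> bool" where
  "typed_k_strict k L \<longleftrightarrow>
     k_strict k (shape L) \<and> ptype L \<in> {0, 1, 2} \<and> (ptype L > 0 \<longleftrightarrow> k \<in> set (shape L))"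

definition typed_partitions :: "nat \<Rightarrow> nat \<Rightarrow> typed_partition set" where
  "typed_partitions k n =
     {L. typed_k_strict k L \<and> length (shape L) \<le> n + 1 - k \<and> (\<forall>x\<in>set (shape L). x \<le> n + k)}"

definition k_related :: "nat \<Rightarrow> nat \<times> nat \<Rightarrow> nat \<times> nat \<Rightarrow> bool" where
  "k_related k b b' \<longleftrightarrow>
     \<bar>real (snd b) - real k - 1/2\<bar> + real (fst b) = \<bar>real (snd b') - real k - 1/2\<bar> + real (fst b')"

definition horizontal_strip :: "(nat \<times> nat) set \<Rightarrow> bool" where
  "horizontal_strip S \<longleftrightarrow> (\<forall>b\<in>S. \<forall>b'\<in>S. snd b = snd b' \<longrightarrow> b = b')"

definition vertical_strip :: "(nat \<times> nat) set \<Rightarrow> bool" where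
  "vertical_strip S \<longleftrightarrow> (\<forall>b\<in>S. \<forall>b'\<in>S. fst b = fst b' \<longrightarrow> b = b')"

text \<open>
  The relation \<open>lam \<rightarrow> nu\<close>; \<open>rho\<close> is the partition left after the removal of the vertical strip.
  If a column of \<open>nu\<close> or \<open>lam\<close> is empty, its bottom box is \<open>(0, i)\<close>, which lies outside the diagram.
\<close>

definition arrow :: "nat \<Rightarrow> nat list \<Rightarrow> nat list \<Rightarrow> bool" where
  "arrow k lam nu \<longleftrightarrow>
     k_strict k lam \<and> k_strict k nu \<and>
     (\<exists>rho. is_partition rho \<and>
        diagram rho \<subseteq> diagram lam \<and> vertical_strip (diagram lam - diagram rho) \<and>
        (\<forall>b \<in> diagram lam - diagram rho. snd b \<le> k) \<and>
        diagram rho \<subseteq> diagram nu \<and> horizontal_strip (diagram nu - diagram rho)) \<and>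
     (\<forall>i\<in>{1..k}.
        (col_len nu i = col_len lam i \<longrightarrow>
           card {b \<in> diagram nu - diagram lam. k_related k (col_len lam i, i) b} \<le> 1) \<and>
        (col_len nu i < col_len lam i \<longrightarrow>
           (\<forall>j\<in>{col_len nu i..col_len lam i}.
              \<exists>!b. b \<in> diagram nu - diagram lam \<and> k_related k (j, i) b) \<and>
           (\<exists>row. \<forall>j\<in>{col_len nu i..col_len lam i}.
              \<forall>b \<in> diagram nu - diagram lam. k_related k (j, i) b \<longrightarrow> fst b = row)))"

definition horiz_strip_k :: "nat \<Rightarrow> nat list \<Rightarrow> nat list \<Rightarrow> bool" where
  "horiz_strip_k k lam mu \<longleftrightarrow>
     k_strict k lam \<and> k_strict k mu \<and> diagram mu \<subseteq> diagram lam \<and>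
     (\<forall>p \<ge> max (first_part lam + 1) (length lam + 2 * k - 1).
        arrow k lam ((p + (sum_list lam - sum_list mu)) # mu))"

definition typed_horiz_strip :: "nat \<Rightarrow> typed_partition \<Rightarrow> typed_partition \<Rightarrow> bool" where
  "typed_horiz_strip k L M \<longleftrightarrow>
     typed_k_strict k L \<and> typed_k_strict k M \<and>
     horiz_strip_k k (shape L) (shape M) \<and> ptype L + ptype M \<noteq> 3"

text \<open>
  A tableau is a list \<open>[L\<^sub>0, \<dots>, L\<^sub>r]\<close>.  Sequences that differ only by repetitions of the final term
  are the same tableau; the last conjunct selects the representative without such repetitions.
\<close>

definition typed_tableau ::
    "nat \<Rightarrow> typed_partition \<Rightarrow> typed_partition \<Rightarrow> typed_partition list \<Rightarrow> bool" where
  "typed_tableau k L M Ts \<longleftrightarrow>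
     Ts \<noteq> [] \<and> hd Ts = M \<and> last Ts = L \<and>
     (\<forall>T\<in>set Ts. typed_k_strict k T) \<and>
     (\<forall>i. Suc i < length Ts \<longrightarrow> typed_horiz_strip k (Ts ! Suc i) (Ts ! i)) \<and>
     (2 \<le> length Ts \<longrightarrow> Ts ! (length Ts - 2) \<noteq> last Ts)"

datatype entry = Plain nat | Circled nat

definition filling :: "typed_partition list \<Rightarrow> ((nat \<times> nat) \<times> entry) set" where
  "filling Ts =
     {(b, e). \<exists>i. 1 \<le> i \<and> i < length Ts \<and>
        b \<in> diagram (shape (Ts ! i)) - diagram (shape (Ts ! (i - 1))) \<and>
        e = (if ptype (Ts ! i) = 2 then Circled i else Plain i)}"

definition standard_typed_tableaux ::
    "nat \<Rightarrow> typed_partition \<Rightarrow> typed_partition \<Rightarrow> typed_partition list set" where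
  "standard_typed_tableaux k L M =
     {Ts. typed_tableau k L M Ts \<and>
        (\<forall>j\<in>{1..psize L - psize M}.
           \<exists>!b. (b, Plain j) \<in> filling Ts \<or> (b, Circled j) \<in> filling Ts)}"

text \<open>
  A signed permutation is an odd bijection of the integers, the barred entry \<open>\<bar>a\<close> being \<open>- a\<close>.
  Permutations are composed as functions, so that multiplication on the right by a generator
  acts on positions of the one-line notation \<open>(w 1, w 2, \<dots>)\<close>.
\<close>

definition weyl_D :: "nat \<Rightarrow> (int \<Rightarrow> int) set" where
  "weyl_D m =
     {w. w permutes ({- int m..int m} - {0}) \<and> (\<forall>i. w (- i) = - w i) \<and>
         even (card {i \<in> {1..int m}. w i < 0})}"

definition weyl_D_inf :: "(int \<Rightarrow> int) set" where
  "weyl_D_inf = (\<Union>n\<in>{1..}. weyl_D (n + 1))"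

definition gen :: "nat \<Rightarrow> int \<Rightarrow> int" where
  "gen i =
     (if i = 0 then transpose 1 (- 2) \<circ> transpose (- 1) 2
      else transpose (int i) (int i + 1) \<circ> transpose (- int i) (- (int i + 1)))"

definition word_prod :: "nat list \<Rightarrow> int \<Rightarrow> int" where
  "word_prod a = foldr (\<lambda>i w. gen i \<circ> w) a id"

definition cox_length :: "(int \<Rightarrow> int) \<Rightarrow> nat" where
  "cox_length w = (LEAST l. \<exists>a. length a = l \<and> word_prod a = w)"

definition reduced_words :: "(int \<Rightarrow> int) \<Rightarrow> nat list set" where
  "reduced_words w = {a. word_prod a = w \<and> length a = cox_length w}"

definition one_line :: "int list \<Rightarrow> int \<Rightarrow> int" where
  "one_line xs i =
     (if 1 \<le> i \<and> i \<le> int (length xs) then xs ! nat (i - 1)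
      else if 1 \<le> - i \<and> - i \<le> int (length xs) then - (xs ! nat (- i - 1))
      else i)"

definition diag_len :: "nat \<Rightarrow> nat list \<Rightarrow> nat \<Rightarrow> nat" where
  "diag_len k lam d = card {(a, c). 1 \<le> a \<and> k < c \<and> a + c = k + d + 1 \<and> (a, c) \<notin> diagram lam}"

definition diag_related :: "nat \<Rightarrow> nat list \<Rightarrow> nat \<Rightarrow> bool" where
  "diag_related k lam d \<longleftrightarrow> (\<exists>i\<in>{1..k}. d = col_len lam i + k - i)"

text \<open>The lengths occurring in each of the following two lists are pairwise distinct.\<close>

definition u_list :: "nat \<Rightarrow> nat \<Rightarrow> nat list \<Rightarrow> nat list" where
  "u_list k n lam = sorted_list_of_set (diag_len k lam ` {d \<in> {0..n}. diag_related k lam d})"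

definition v_list :: "nat \<Rightarrow> nat \<Rightarrow> nat list \<Rightarrow> nat list" where
  "v_list k n lam =
     sorted_list_of_set (diag_len k lam ` {d \<in> {0..n}. \<not> diag_related k lam d} - {0})"

definition w_one_line :: "nat \<Rightarrow> nat \<Rightarrow> typed_partition \<Rightarrow> int list" where
  "w_one_line k n L =
     (let us = map (\<lambda>x. int x + 1) (u_list k n (shape L));
          vs = map (\<lambda>x. int x + 1) (v_list k n (shape L));
          bs = map (\<lambda>x. - (int (x - k) + 1)) (filter (\<lambda>x. k < x) (shape L));
          us' = (if ptype L = 2 then - hd us # tl us else us);
          sgn1 = (\<lambda>xs. if even (length (filter (\<lambda>x. x < 0) xs)) then 1 else - 1)
      in if ptype L = 0 then sgn1 (tl us @ bs @ vs) # tl us @ bs @ vs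
         else us' @ bs @ [sgn1 (us' @ bs @ vs)] @ vs)"

definition w_elt :: "nat \<Rightarrow> nat \<Rightarrow> typed_partition \<Rightarrow> int \<Rightarrow> int" where
  "w_elt k n L = one_line (w_one_line k n L)"

definition skew_elt :: "(int \<Rightarrow> int) \<Rightarrow> bool" where
  "skew_elt w \<longleftrightarrow>
     w \<in> weyl_D_inf \<and>
     (\<exists>k n L w'. 1 \<le> k \<and> k \<le> n \<and> L \<in> typed_partitions k n \<and> w' \<in> weyl_D_inf \<and>
        w_elt k n L = w \<circ> w' \<and> cox_length (w_elt k n L) = cox_length w + cox_length w')"

definition compatible_pair :: "nat \<Rightarrow> nat \<Rightarrow> typed_partition \<Rightarrow> typed_partition \<Rightarrow> bool" where
  "compatible_pair k n L M \<longleftrightarrow>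
     L \<in> typed_partitions k n \<and> M \<in> typed_partitions k n \<and>
     diagram (shape M) \<subseteq> diagram (shape L) \<and>
     (\<exists>b c. b @ c \<in> reduced_words (w_elt k n L) \<and> length c = psize M \<and>
        c \<in> reduced_words (w_elt k n M))"

end

theory Submission
  imports Defs
begin

text \<open>
The parabolic subgroup that belongs to \<open>k\<close> consists of the elements that map the positions
\<open>{k + 1, k + 2, \<dots>}\<close> onto themselves.  So the coset of a signed permutation \<open>f\<close> is recorded by the
set \<open>f ` {k + 1, k + 2, \<dots>}\<close> of its entries beyond position \<open>k\<close> (\<open>tail\<close> below), and multiplication
of \<open>f\<close> by a generator from the left acts on these sets by taking images.  The whole proof is about
this action.

On the side of the group, each set has a number of inversions, in which a pair and its negative are
counted separately.  A generator either fixes the set or changes this number by exactly 2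
(\<open>card_inversions_gen\<close>); in the first case nothing happens to the coset.  An element of even sign that
is increasing beyond position \<open>k\<close> and satisfies \<open>\<bar>f 1\<bar> < f 2 < \<dots> < f k\<close> is determined by its set
(\<open>grassmannian_unique\<close>), and it keeps this shape under every generator that moves its set
(\<open>grassmannian_gen\<close>).  The elements \<open>w_lam\<close> are of this kind (\<open>w_elt_grassmannian\<close>).

On the side of partitions, the set of \<open>w_lam\<close> is read off from the column lengths \<open>C\<close> of \<open>lam\<close>
(\<open>tail_entries\<close>).  Call \<open>x + C (k + x + 1)\<close> the diagonal of the bottom box of column \<open>k + x + 1\<close>.
As a function of \<open>x\<close> it grows by 1 at each step except at the parts \<open>x\<close> of the strict partition
\<open>lam\<^sup>1\<close>, where it stays constant.  Hence it enumerates the diagonals by the numbers \<open>x\<close> that are not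
parts of \<open>lam\<^sup>1\<close>, and the inverse of this enumeration is the length of the diagonal.  A value \<open>x + 1\<close>
is barred in \<open>w_lam\<close>, stands among the first \<open>k\<close> entries, or stands later without a bar, according
to whether \<open>x\<close> is a part of \<open>lam\<^sup>1\<close>, belongs to a related diagonal, or to a non-related one.

The heart of the proof is that the generators that increase the number of inversions correspond to
the typed strips with a single box.  A box added to a column beyond \<open>k\<close> turns the part \<open>x\<close> into \<open>x + 1\<close>
and always gives a strip; a box added to a column \<open>c \<le> k\<close> moves a related diagonal on by one, and it
gives a strip if and only if only one column beyond \<open>k\<close> has its bottom box on the diagonal of column
\<open>c\<close> (\<open>horiz_strip_one_box\<close>), which says that \<open>x + 1\<close> is not a part.  In both cases the effect on the
set is an exchange of the values \<open>x + 1\<close> and \<open>x + 2\<close>, that is, the action of a simple reflection; for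
\<open>x = 0\<close> the sign of the value 1, respectively the type of the partition, tells whether it is that of
\<open>s\<^sub>1\<close> or of \<open>s\<^sub>0\<close> (\<open>row_move\<close>, \<open>column_move\<close>, \<open>ascent_strip_ok\<close>).

Consequently a reduced word for \<open>w\<close>, read from right to left, walks from the set of \<open>w_mu\<close> to that of
\<open>w_lam\<close> through sets of partitions that grow by one box at a time, and every such walk comes from
exactly one word (\<open>card_ascending_words\<close>).  These walks are the standard tableaux
(\<open>standard_typed_tableaux_eq\<close>).
\<close>

section \<open>Generators acting on sets of entries\<close>

text \<open>
Each generator is the product of an exchange of \<open>lo i\<close> and \<open>hi i\<close> with its negative.  This notation
treats the exceptional generator \<open>s\<^sub>0\<close> like the others: it exchanges \<open>- 2\<close> and \<open>1\<close>, which are neighbours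
once 0 and \<open>- 1\<close> are left out.
\<close>

definition lo :: "nat \<Rightarrow> int" where "lo i = (if i = 0 then - 2 else int i)"
definition hi :: "nat \<Rightarrow> int" where "hi i = (if i = 0 then 1 else int i + 1)"

lemma lo_hi: "lo i < hi i" "lo i \<noteq> - hi i" "lo i \<noteq> 0" "hi i \<noteq> 0"
  by (auto simp: lo_def hi_def)

lemma gen_eq:
  "gen i v = (if v = lo i then hi i else if v = hi i then lo i
     else if v = - lo i then - hi i else if v = - hi i then - lo i else v)"
  by (auto simp: gen_def lo_def hi_def transpose_def)

lemma gen_lo [simp]: "gen i (lo i) = hi i" and gen_hi [simp]: "gen i (hi i) = lo i"
  using lo_hi[of i] by (auto simp: gen_eq)

lemma gen_gen [simp]: "gen i (gen i v) = v"
  using lo_hi[of i] by (auto simp: gen_eq)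

lemma gen_minus [simp]: "gen i (- v) = - gen i v"
  using lo_hi[of i] by (auto simp: gen_eq)

lemma gen_0 [simp]: "gen i 0 = 0"
  using lo_hi[of i] by (auto simp: gen_eq)

lemma gen_eq_iff [simp]: "gen i a = gen i b \<longleftrightarrow> a = b"
  by (metis gen_gen)

lemma bij_gen: "bij (gen i)"
  by (rule involuntory_imp_bij) simp

lemma in_gen_image: "v \<in> gen i ` A \<longleftrightarrow> gen i v \<in> A"
  by (metis gen_gen image_iff)

text \<open>
Up to a common sign, a generator reverses the order of a single pair.  Pairs of the form \<open>(- v, v)\<close> do
not correspond to roots of type D and are left out.
\<close>

lemma gen_reverses:
  assumes "a < b" "a \<noteq> - b" "a \<noteq> 0" "b \<noteq> 0"
  shows "gen i a < gen i b \<or> (a, b) = (lo i, hi i) \<or> (a, b) = (- hi i, - lo i)"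
proof (cases "i = 0")
  case True
  thus ?thesis using assms by (simp add: gen_eq lo_def hi_def)
next
  case False
  thus ?thesis using assms unfolding gen_eq lo_def hi_def Pair_inject by (smt (verit) of_nat_0_less_iff)
qed

text \<open>
The position of the value \<open>v\<close>: beyond \<open>k\<close> (1), at a mirrored position below \<open>- k\<close> (-1), or among
\<open>- k, \<dots>, k\<close> (0).
\<close>

definition side :: "int set \<Rightarrow> int \<Rightarrow> int" where
  "side A v = of_bool (v \<in> A) - of_bool (- v \<in> A)"

lemma side_minus [simp]: "side A (- v) = - side A v"
  by (simp add: side_def)

lemma side_gen [simp]: "side (gen i ` A) v = side A (gen i v)"
  by (simp add: side_def in_gen_image)

text \<open>
Pairs of values in the wrong order of positions, where positions inside one of the three blocks are
not compared.  Each inversion of the minimal coset representative occurs twice, as \<open>(a, b)\<close> and as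
\<open>(- b, - a)\<close>; counting both keeps the action of the generators uniform.
\<close>

definition inversions :: "int set \<Rightarrow> (int \<times> int) set" where
  "inversions A = {(a, b). a < b \<and> a \<noteq> - b \<and> a \<noteq> 0 \<and> b \<noteq> 0 \<and> side A b < side A a}"

text \<open>
The two properties of a set of entries beyond position \<open>k\<close> that make its inversions finite in number and
its blocks disjoint.
\<close>

definition tail_set :: "int set \<Rightarrow> bool" where
  "tail_set A \<longleftrightarrow> (\<forall>v\<in>A. - v \<notin> A) \<and> (\<exists>N. \<forall>v>N. v \<in> A)"

lemma tail_set_gen: assumes "tail_set A" shows "tail_set (gen i ` A)"
proof -
  obtain N where N: "\<forall>v>N. v \<in> A" using assms by (auto simp: tail_set_def)
  have "gen i v = v" if "v > max N (max 2 (int i + 1))" for v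
    using that by (auto simp: gen_eq lo_def hi_def)
  hence "\<forall>v>max N (max 2 (int i + 1)). gen i v \<in> A" using N by simp
  hence "\<exists>N. \<forall>v>N. gen i v \<in> A" by blast
  thus ?thesis using assms by (auto simp: tail_set_def in_gen_image)
qed

lemma finite_inversions: assumes "tail_set A" shows "finite (inversions A)"
proof -
  obtain N where N: "\<forall>v>N. v \<in> A" using assms by (auto simp: tail_set_def)
  have top: "side A v = 1" if "v > N" for v
    using assms N that by (auto simp: tail_set_def side_def)
  have le: "\<bar>side A v\<bar> \<le> 1" for v by (auto simp: side_def)
  have "a \<in> {- N..N} \<and> b \<in> {- N..N}" if "(a, b) \<in> inversions A" for a b
  proof -
    have ab: "a < b" "side A b < side A a" using that by (auto simp: inversions_def)
    have "b \<le> N" using top[of b] le[of a] ab by force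
    moreover have "- N \<le> a" using top[of "- a"] le[of b] ab by force
    ultimately show ?thesis using ab by simp
  qed
  hence "inversions A \<subseteq> {- N..N} \<times> {- N..N}" by auto
  thus ?thesis by (rule finite_subset) simp
qed

definition ascent :: "int set \<Rightarrow> nat \<Rightarrow> bool" where
  "ascent A i \<longleftrightarrow> side A (lo i) < side A (hi i)"

text \<open>
Applying the generator to both members of a pair preserves being an inversion, except for the two
pairs whose order the generator reverses; at an ascent these two are new.
\<close>

lemma card_inversions_ascent:
  assumes A: "tail_set A" and up: "ascent A i"
  shows "card (inversions (gen i ` A)) = card (inversions A) + 2"
proof -
  let ?m = "\<lambda>(a, b). (gen i a, gen i b)" and ?R = "{(lo i, hi i), (- hi i, - lo i)}"
  note lh = lo_hi[of i]
  have up': "side A (lo i) < side A (hi i)" using up by (simp add: ascent_def)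
  have noR: "x \<notin> ?R" if "x \<in> inversions A" for x
    using that up' by (auto simp: inversions_def)
  have sub: "?m x \<in> inversions (gen i ` A)" if x: "x \<in> inversions A" for x
  proof -
    obtain a b where [simp]: "x = (a, b)" by (cases x)
    have ab: "a < b" "a \<noteq> - b" "a \<noteq> 0" "b \<noteq> 0" "side A b < side A a"
      using x by (auto simp: inversions_def)
    have "gen i a < gen i b" using gen_reverses[OF ab(1-4), of i] noR[OF x] by auto
    moreover have "gen i a \<noteq> - gen i b" using ab by (metis gen_eq_iff gen_minus)
    moreover have "gen i a \<noteq> 0" "gen i b \<noteq> 0" using ab by (metis gen_eq_iff gen_0)+
    ultimately show ?thesis using ab by (simp add: inversions_def)
  qed
  have "inversions (gen i ` A) = ?m ` inversions A \<union> ?R"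
  proof (intro equalityI subsetI)
    fix x assume x: "x \<in> inversions (gen i ` A)"
    obtain a b where [simp]: "x = (a, b)" by (cases x)
    have ab: "a < b" "a \<noteq> - b" "a \<noteq> 0" "b \<noteq> 0" "side A (gen i b) < side A (gen i a)"
      using x by (auto simp: inversions_def)
    show "x \<in> ?m ` inversions A \<union> ?R"
    proof (cases "x \<in> ?R")
      case False
      have "gen i a < gen i b" using gen_reverses[OF ab(1-4), of i] False by auto
      moreover have "gen i a \<noteq> - gen i b" using ab by (metis gen_eq_iff gen_minus)
      moreover have "gen i a \<noteq> 0" "gen i b \<noteq> 0" using ab by (metis gen_eq_iff gen_0)+
      ultimately have "(gen i a, gen i b) \<in> inversions A" using ab by (simp add: inversions_def)
      hence "?m (gen i a, gen i b) \<in> ?m ` inversions A" by blast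
      thus ?thesis by simp
    qed blast
  next
    fix x assume "x \<in> ?m ` inversions A \<union> ?R"
    thus "x \<in> inversions (gen i ` A)"
    proof
      assume "x \<in> ?R" thus ?thesis using lh up' by (auto simp: inversions_def)
    qed (use sub in blast)
  qed
  moreover have "?m ` inversions A \<inter> ?R = {}"
  proof -
    have "x \<notin> ?R" if "x \<in> ?m ` inversions A" for x
    proof
      from that obtain a b where ab: "(a, b) \<in> inversions A" and x: "x = (gen i a, gen i b)"
        by auto
      assume "x \<in> ?R"
      hence "gen i a = lo i \<and> gen i b = hi i \<or> gen i a = - hi i \<and> gen i b = - lo i"
        using x by simp
      hence "(a, b) = (hi i, lo i) \<or> (a, b) = (- lo i, - hi i)"
        by (metis gen_gen gen_hi gen_lo gen_minus)
      thus False using ab lh by (auto simp: inversions_def)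
    qed
    thus ?thesis by (simp only: disjoint_iff) blast
  qed
  moreover have "inj_on ?m (inversions A)" by (auto simp: inj_on_def)
  moreover have "card ?R = 2" using lh by auto
  moreover have "finite (?m ` inversions A)" using finite_inversions[OF A] by simp
  ultimately have "card (inversions (gen i ` A)) = card (?m ` inversions A) + card ?R"
    by (simp only: card_Un_disjoint finite.emptyI finite.insertI)
  thus ?thesis using card_image[of ?m "inversions A"] \<open>inj_on ?m (inversions A)\<close> \<open>card ?R = 2\<close>
    by linarith
qed

lemma gen_fixes_if_level:
  assumes "tail_set A" "side A (lo i) = side A (hi i)"
  shows "gen i ` A = A"
proof -
  have *: "lo i \<in> A \<longleftrightarrow> hi i \<in> A" "- lo i \<in> A \<longleftrightarrow> - hi i \<in> A"
    using assms by (auto simp: side_def tail_set_def of_bool_def split: if_splits)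
  have "v \<in> gen i ` A \<longleftrightarrow> v \<in> A" for v
    unfolding in_gen_image using * by (simp add: gen_eq)
  thus ?thesis by blast
qed

text \<open>
If the two exchanged values lie in the same block, the set does not change; otherwise the generator
is an ascent of the set or of its image.
\<close>

lemma card_inversions_gen:
  assumes A: "tail_set A"
  shows "card (inversions (gen i ` A)) \<le> card (inversions A) + 2"
    and "card (inversions (gen i ` A)) = card (inversions A) + 2 \<Longrightarrow> ascent A i"
proof -
  consider "ascent A i" | "side A (lo i) = side A (hi i)" | "ascent (gen i ` A) i"
    unfolding ascent_def side_gen gen_lo gen_hi by linarith
  hence "card (inversions (gen i ` A)) \<le> card (inversions A) + 2 \<and>
    (card (inversions (gen i ` A)) = card (inversions A) + 2 \<longrightarrow> ascent A i)"
  proof cases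
    case 1 thus ?thesis using card_inversions_ascent[OF A] by simp
  next
    case 2 thus ?thesis using gen_fixes_if_level[OF A] by simp
  next
    case 3
    have "gen i ` gen i ` A = A" by (simp add: image_comp comp_def)
    thus ?thesis using card_inversions_ascent[OF tail_set_gen[OF A] 3] by simp
  qed
  thus "card (inversions (gen i ` A)) \<le> card (inversions A) + 2"
    and "card (inversions (gen i ` A)) = card (inversions A) + 2 \<Longrightarrow> ascent A i" by blast+
qed

lemma ascent_changes:
  assumes "tail_set A" "ascent A i" shows "gen i ` A \<noteq> A"
  using card_inversions_ascent[OF assms] by auto

text \<open>
An ascent changes the block of \<open>\<plusminus>lo i\<close> and \<open>\<plusminus>hi i\<close>, and these values identify \<open>i\<close> up to the choice
between 0 and 1.  The actions of \<open>s\<^sub>0\<close> and \<open>s\<^sub>1\<close> differ by a sign, so they could agree only if the values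
1 and 2 were both in the middle block, where neither is an ascent.
\<close>

lemma ascent_unique:
  assumes A: "tail_set A" and i: "ascent A i" and j: "ascent A j" and eq: "gen i ` A = gen j ` A"
  shows "i = j"
proof (rule ccontr)
  assume ij: "i \<noteq> j"
  have c: "side A (gen i v) = side A (gen j v)" for v
    using eq by (metis side_gen)
  have *: "\<bar>lo i\<bar> \<in> {\<bar>lo j\<bar>, \<bar>hi j\<bar>}" "\<bar>hi i\<bar> \<in> {\<bar>lo j\<bar>, \<bar>hi j\<bar>}"
  proof -
    have "gen j (lo i) \<noteq> lo i" "gen j (hi i) \<noteq> hi i"
      using c[of "lo i"] c[of "hi i"] i by (auto simp: ascent_def)
    thus "\<bar>lo i\<bar> \<in> {\<bar>lo j\<bar>, \<bar>hi j\<bar>}" "\<bar>hi i\<bar> \<in> {\<bar>lo j\<bar>, \<bar>hi j\<bar>}"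
      by (auto simp: gen_eq split: if_splits)
  qed
  hence "i = 0 \<and> j = 1 \<or> i = 1 \<and> j = 0"
    using ij by (auto simp: lo_def hi_def split: if_splits)
  thus False
    using c[of 1] c[of 2] i j side_minus[of A 1] side_minus[of A 2]
    by (auto simp: gen_eq lo_def hi_def ascent_def)
qed

section \<open>Words and Grassmannian elements\<close>

lemma word_prod_Nil [simp]: "word_prod [] = id" 
  and word_prod_Cons [simp]: "word_prod (i # a) = gen i \<circ> word_prod a"
  by (simp_all add: word_prod_def)

lemma word_prod_append [simp]: "word_prod (a @ b) = word_prod a \<circ> word_prod b"
  by (induction a) (auto simp: fun_eq_iff)

lemma bij_word_prod: "bij (word_prod a)"
proof (induction a)
  case (Cons i a)
  thus ?case unfolding word_prod_Cons by (rule bij_comp) (rule bij_gen)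
next
  case Nil show ?case unfolding word_prod_Nil by (rule bij_id)
qed

lemma word_prod_minus [simp]: "word_prod a (- v) = - word_prod a v"
  by (induction a) auto

lemma word_prod_0 [simp]: "word_prod a 0 = 0"
  by (induction a) auto

lemma word_prod_eq_iff [simp]: "word_prod a u = word_prod a v \<longleftrightarrow> u = v"
  by (rule inj_eq) (rule bij_is_inj[OF bij_word_prod])

definition tail :: "nat \<Rightarrow> int set" where "tail k = {v. int k < v}"

lemma tail_set_word: "tail_set A \<Longrightarrow> tail_set (word_prod a ` A)"
proof (induction a)
  case (Cons i a)
  show ?case using tail_set_gen[OF Cons.IH[OF Cons.prems], of i] by (simp add: image_comp)
qed simp

lemma tail_set_tail: "tail_set (tail k)"
  by (auto simp: tail_set_def tail_def)

lemma inversions_tail: "inversions (tail k) = {}"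
  by (auto simp: inversions_def side_def tail_def)

lemma card_inversions_word:
  "tail_set A \<Longrightarrow> card (inversions (word_prod a ` A)) \<le> card (inversions A) + 2 * length a"
proof (induction a)
  case (Cons i a)
  show ?case using card_inversions_gen(1)[OF tail_set_word[OF Cons.prems], of i a] Cons
    by (simp add: image_comp)
qed simp

definition negs :: "(int \<Rightarrow> int) \<Rightarrow> int set" where "negs f = {j. 0 < j \<and> f j < 0}"

text \<open>
Only \<open>s\<^sub>0\<close> affects signs.  It negates the values 1 and 2, which sit at two different positions up to
sign, so the set of negative positions changes by a symmetric difference with a set of two elements.
\<close>

lemma even_negs_word: "finite (negs (word_prod a)) \<and> even (card (negs (word_prod a)))"
proof (induction a)
  case Nil
  have "negs id = {}" by (auto simp: negs_def)
  thus ?case unfolding word_prod_Nil by (metis card.empty even_zero finite.emptyI)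
next
  case (Cons i a)
  let ?f = "word_prod a"
  show ?case
  proof (cases "i = 0")
    case False
    have eq: "negs (word_prod (i # a)) = negs ?f"
      using False by (auto simp: negs_def gen_eq lo_def hi_def split: if_splits)
    show ?thesis unfolding eq by (rule Cons)
  next
    case True
    obtain p q where p: "?f p = 1" and q: "?f q = 2"
      using bij_word_prod[of a] by (metis bij_pointE)
    have pq: "p \<noteq> 0" "q \<noteq> 0" "\<bar>p\<bar> \<noteq> \<bar>q\<bar>"
      using p q by (auto simp: abs_if split: if_splits)
    let ?B = "{\<bar>p\<bar>, \<bar>q\<bar>}"
    have in_B: "j \<in> ?B \<longleftrightarrow> ?f j \<in> {1, -1, 2, -2}" if "j > 0" for j
    proof -
      have "?f j = 1 \<longleftrightarrow> j = p" "?f j = 2 \<longleftrightarrow> j = q" "?f j = - 1 \<longleftrightarrow> j = - p" "?f j = - 2 \<longleftrightarrow> j = - q"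
        using p q word_prod_minus[of a p] word_prod_minus[of a q] word_prod_eq_iff[of a j] by metis+
      moreover have "j \<in> ?B \<longleftrightarrow> j = p \<or> j = - p \<or> j = q \<or> j = - q"
        using that by (simp add: abs_if)
      ultimately show ?thesis by blast
    qed
    have flip: "gen 0 v < 0 \<longleftrightarrow> (if v \<in> {1, -1, 2, -2} then 0 < v else v < 0)" for v
      by (simp add: gen_eq lo_def hi_def)
    have eq: "negs (word_prod (i # a)) = (negs ?f - ?B) \<union> (?B - negs ?f)" (is "?N = _")
    proof (intro set_eqI)
      fix j
      show "j \<in> ?N \<longleftrightarrow> j \<in> (negs ?f - ?B) \<union> (?B - negs ?f)"
      proof (cases "0 < j")
        case j: True
        have "?f j \<noteq> 0" using j by (metis less_irrefl word_prod_0 word_prod_eq_iff)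
        have "j \<in> ?N \<longleftrightarrow> gen 0 (?f j) < 0" using j True by (simp add: negs_def)
        also have "\<dots> \<longleftrightarrow> (if j \<in> ?B then 0 < ?f j else ?f j < 0)"
          unfolding flip in_B[OF j] ..
        also have "\<dots> \<longleftrightarrow> (if j \<in> ?B then j \<notin> negs ?f else j \<in> negs ?f)"
          using j \<open>?f j \<noteq> 0\<close> by (auto simp: negs_def)
        finally show ?thesis unfolding Un_iff Diff_iff by argo
      next
        case False
        hence "j \<notin> ?B" using pq by auto
        thus ?thesis using False by (simp add: negs_def)
      qed
    qed
    have fin: "finite (negs ?f)" using Cons by simp
    have "card ?N = card (negs ?f - ?B) + card (?B - negs ?f)"
      unfolding eq using fin by (intro card_Un_disjoint) auto
    moreover have "card (negs ?f) = card (negs ?f \<inter> ?B) + card (negs ?f - ?B)"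
      by (rule card_Int_Diff[OF fin])
    moreover have "card ?B = card (?B \<inter> negs ?f) + card (?B - negs ?f)"
      by (rule card_Int_Diff) simp
    moreover have "card ?B = 2" using pq by simp
    moreover have "card (?B \<inter> negs ?f) = card (negs ?f \<inter> ?B)" by (simp only: Int_commute)
    ultimately have "card ?N + 2 * card (negs ?f \<inter> ?B) = card (negs ?f) + 2" by linarith
    moreover have "even (card (negs ?f) + 2)" using Cons by simp
    ultimately have "even (card ?N + 2 * card (negs ?f \<inter> ?B))" by metis
    hence "even (card ?N)" by simp
    thus ?thesis using fin unfolding eq by simp
  qed
qed

text \<open>
The minimal representatives modulo the parabolic subgroup.
\<close>

definition grassmannian :: "nat \<Rightarrow> (int \<Rightarrow> int) \<Rightarrow> bool" where
  "grassmannian k f \<longleftrightarrow> (\<forall>j j'. int k < j \<longrightarrow> j < j' \<longrightarrow> f j < f j') \<and>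
     (\<forall>j j'. 1 \<le> j \<longrightarrow> j < j' \<longrightarrow> j' \<le> int k \<longrightarrow> \<bar>f j\<bar> < f j')"

text \<open>
A violation could only arise at a pair of values that the generator exchanges.  Both would then lie in
the same block, and the generator would fix the set.
\<close>

lemma grassmannian_gen:
  assumes gr: "grassmannian k (word_prod a)"
    and ch: "gen i ` (word_prod a ` tail k) \<noteq> word_prod a ` tail k"
  shows "grassmannian k (gen i \<circ> word_prod a)"
proof -
  let ?f = "word_prod a" let ?A = "?f ` tail k"
  have nz: "?f j \<noteq> 0" if "j \<noteq> 0" for j using that by (metis word_prod_0 word_prod_eq_iff)
  have opp: "?f j \<noteq> - ?f j'" if "j \<noteq> - j'" for j j' using that by (metis word_prod_minus word_prod_eq_iff)
  have inA: "?f j \<in> ?A \<longleftrightarrow> int k < j" for j by (auto simp: tail_def image_iff)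
  have inA': "- ?f j \<in> ?A \<longleftrightarrow> int k < - j" for j using inA[of "- j"] by simp
  have tsA: "tail_set ?A" by (intro tail_set_word tail_set_tail)
  have "gen i (?f j) < gen i (?f j')" if "int k < j" "j < j'" for j j'
  proof (rule ccontr)
    assume c: "\<not> ?thesis"
    have "?f j < ?f j'" using gr that by (auto simp: grassmannian_def)
    with gen_reverses[OF this, of i] c nz[of j] nz[of j'] opp[of j j'] that
    have "(?f j, ?f j') = (lo i, hi i) \<or> (?f j, ?f j') = (- hi i, - lo i)" by auto
    moreover have "side ?A (?f j) = 1" "side ?A (?f j') = 1"
      unfolding side_def inA inA' using that by auto
    ultimately have "side ?A (lo i) = side ?A (hi i)"
      using side_minus[of ?A "lo i"] side_minus[of ?A "hi i"] by (elim disjE) simp_all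
    thus False using gen_fixes_if_level[OF tsA] ch by simp
  qed
  moreover have "\<bar>gen i (?f j)\<bar> < gen i (?f j')" if "1 \<le> j" "j < j'" "j' \<le> int k" for j j'
  proof -
    have *: "gen i v < gen i (?f j')" if v: "v = ?f j \<or> v = - ?f j" for v
    proof (rule ccontr)
      assume c: "\<not> ?thesis"
      have lt: "v < ?f j'" using gr that v \<open>1 \<le> j\<close> \<open>j < j'\<close> \<open>j' \<le> int k\<close>
        by (force simp: grassmannian_def)
      have "v \<noteq> 0" "?f j' \<noteq> 0" "v \<noteq> - ?f j'"
        using v nz[of j] nz[of j'] opp[of j j'] opp[of "- j" j'] \<open>1 \<le> j\<close> \<open>j < j'\<close> by auto
      with gen_reverses[OF lt, of i] c
      have sw: "(v, ?f j') = (lo i, hi i) \<or> (v, ?f j') = (- hi i, - lo i)" by auto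
      have c0: "side ?A (?f j) = 0" "side ?A (?f j') = 0"
        unfolding side_def inA inA' using \<open>1 \<le> j\<close> \<open>j < j'\<close> \<open>j' \<le> int k\<close> by auto
      hence "side ?A v = 0" using v by (elim disjE) simp_all
      hence "side ?A (lo i) = side ?A (hi i)"
        using sw c0(2) side_minus[of ?A "lo i"] side_minus[of ?A "hi i"] by (elim disjE) simp_all
      hence "gen i ` ?A = ?A" using gen_fixes_if_level[OF tsA] by simp
      thus False using ch by simp
    qed
    show ?thesis using *[of "?f j"] *[of "- ?f j"] by (simp add: abs_if)
  qed
  ultimately show ?thesis by (simp add: grassmannian_def)
qed

text \<open>
By strong induction: the value at \<open>m\<close> is attained by the other function, and not at an earlier argument,
since the functions agree there.
\<close>

lemma strict_mono_on_same_image: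
  fixes f g :: "nat \<Rightarrow> 'a::linorder"
  assumes f: "strict_mono_on S f" and g: "strict_mono_on S g" and eq: "f ` S = g ` S" and "m \<in> S"
  shows "f m = g m"
  using \<open>m \<in> S\<close>
proof (induction m rule: less_induct)
  case (less m)
  have *: "h' m \<le> h m" if h: "strict_mono_on S h" "strict_mono_on S h'" "h ` S = h' ` S"
    and IH: "\<And>j. j < m \<Longrightarrow> j \<in> S \<Longrightarrow> h j = h' j" for h h' :: "nat \<Rightarrow> 'a"
  proof -
    obtain j where j: "j \<in> S" "h m = h' j" using h(3) less.prems by (metis image_iff)
    have "\<not> j < m"
      using IH[of j] j strict_mono_onD[OF h(1) j(1) less.prems] by force
    thus ?thesis using strict_mono_onD[OF h(2) less.prems j(1)] j by (cases "m = j") auto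
  qed
  show ?case using *[OF f g eq] *[OF g f eq[symmetric]] less.IH by (metis antisym)
qed

lemma word_prod_abs_image:
  "(\<lambda>m. \<bar>word_prod a (int m)\<bar>) ` {1..k} =
     {v. 0 < v \<and> v \<notin> word_prod a ` tail k \<and> - v \<notin> word_prod a ` tail k}"
proof (intro equalityI subsetI)
  have in_tail: "word_prod a j \<in> word_prod a ` tail k \<longleftrightarrow> int k < j" for j
    by (auto simp: tail_def image_iff)
  {
    fix v assume "v \<in> (\<lambda>m. \<bar>word_prod a (int m)\<bar>) ` {1..k}"
    then obtain m where m: "1 \<le> m" "m \<le> k" "v = \<bar>word_prod a (int m)\<bar>" by auto
    have "word_prod a (int m) \<noteq> word_prod a 0" using m by (simp del: word_prod_0)
    hence "0 < v" using m(3) by simp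
    moreover have "v = word_prod a (int m) \<or> v = word_prod a (- int m)"
      using m(3) by (simp add: abs_if)
    hence "v \<notin> word_prod a ` tail k \<and> - v \<notin> word_prod a ` tail k"
    proof
      assume v: "v = word_prod a (int m)"
      hence "- v = word_prod a (- int m)" by simp
      thus ?thesis using v m(2) in_tail[of "int m"] in_tail[of "- int m"] by simp
    next
      assume v: "v = word_prod a (- int m)"
      hence "- v = word_prod a (int m)" by simp
      thus ?thesis using v m(2) in_tail[of "int m"] in_tail[of "- int m"] by simp
    qed
    ultimately show "v \<in> {v. 0 < v \<and> v \<notin> word_prod a ` tail k \<and> - v \<notin> word_prod a ` tail k}"
      by blast
  next
    fix v assume v: "v \<in> {v. 0 < v \<and> v \<notin> word_prod a ` tail k \<and> - v \<notin> word_prod a ` tail k}"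
    obtain j where j: "word_prod a j = v" using bij_word_prod[of a] by (metis bij_pointE)
    have "j \<noteq> 0" using j v by auto
    moreover have "\<not> int k < j" using v in_tail[of j] unfolding j by blast
    moreover have "\<not> int k < - j" using v in_tail[of "- j"] unfolding word_prod_minus j by blast
    moreover have "word_prod a \<bar>j\<bar> = v \<or> word_prod a \<bar>j\<bar> = - v" using j by (simp add: abs_if)
    ultimately show "v \<in> (\<lambda>m. \<bar>word_prod a (int m)\<bar>) ` {1..k}"
      using v by (intro image_eqI[of _ _ "nat \<bar>j\<bar>"]) auto
  }
qed

text \<open>
Beyond position \<open>k\<close> the element enumerates the given set, and its absolute values in the first \<open>k\<close>
positions enumerate the absolute values that remain.  Only the sign of the first entry is left open,
and the even number of negative entries decides it.
\<close>

lemma grassmannian_unique: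
  assumes f: "grassmannian k (word_prod a)" and g: "grassmannian k (word_prod b)" and "1 \<le> k"
    and eq: "word_prod a ` tail k = word_prod b ` tail k"
  shows "word_prod a = word_prod b"
proof -
  let ?f = "word_prod a" and ?g = "word_prod b"
  have tail_int: "tail k = int ` {k<..}"
  proof (intro equalityI subsetI)
    fix x assume "x \<in> tail k"
    thus "x \<in> int ` {k<..}" by (intro image_eqI[of _ _ "nat x"]) (auto simp: tail_def)
  qed (auto simp: tail_def)
  have big: "?f (int m) = ?g (int m)" if "k < m" for m
  proof (rule strict_mono_on_same_image[of "{k<..}" "\<lambda>m. ?f (int m)" "\<lambda>m. ?g (int m)"])
    show "strict_mono_on {k<..} (\<lambda>m. ?f (int m))" "strict_mono_on {k<..} (\<lambda>m. ?g (int m))"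
      using f g by (simp_all add: grassmannian_def strict_mono_on_def)
    show "(\<lambda>m. ?f (int m)) ` {k<..} = (\<lambda>m. ?g (int m)) ` {k<..}"
      using eq by (simp add: tail_int image_comp comp_def)
  qed (use that in simp)
  have small: "\<bar>?f (int m)\<bar> = \<bar>?g (int m)\<bar>" if "1 \<le> m" "m \<le> k" for m
  proof (rule strict_mono_on_same_image[of "{1..k}" "\<lambda>m. \<bar>?f (int m)\<bar>" "\<lambda>m. \<bar>?g (int m)\<bar>"])
    have "strict_mono_on {1..k} (\<lambda>m. \<bar>h (int m)\<bar>)" if "grassmannian k h" for h
    proof (rule strict_mono_onI)
      fix m m' assume "m \<in> {1..k}" "m' \<in> {1..k}" "m < m'"
      hence "\<bar>h (int m)\<bar> < h (int m')" using that by (simp add: grassmannian_def)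
      thus "\<bar>h (int m)\<bar> < \<bar>h (int m')\<bar>" by linarith
    qed
    thus "strict_mono_on {1..k} (\<lambda>m. \<bar>?f (int m)\<bar>)" "strict_mono_on {1..k} (\<lambda>m. \<bar>?g (int m)\<bar>)"
      using f g by blast+
    show "(\<lambda>m. \<bar>?f (int m)\<bar>) ` {1..k} = (\<lambda>m. \<bar>?g (int m)\<bar>) ` {1..k}"
      unfolding word_prod_abs_image eq ..
  qed (use that in simp)
  have pos: "?f (int m) = ?g (int m)" if "2 \<le> m" for m
  proof (cases "m \<le> k")
    case True
    have "0 < word_prod c (int m)" if "grassmannian k (word_prod c)" for c
    proof -
      have "\<bar>word_prod c 1\<bar> < word_prod c (int m)"
        using that True \<open>2 \<le> m\<close> by (auto simp: grassmannian_def)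
      thus ?thesis by linarith
    qed
    hence "0 < ?f (int m)" "0 < ?g (int m)" using f g by blast+
    thus ?thesis using small[of m] True that by simp
  qed (use big in simp)
  have 1: "?f 1 = ?g 1"
  proof (rule ccontr)
    assume ne: "?f 1 \<noteq> ?g 1"
    hence neg: "?f 1 = - ?g 1" using small[of 1] \<open>1 \<le> k\<close> by (auto simp: abs_if split: if_splits)
    have nz: "?g 1 \<noteq> 0" using ne neg by auto
    have *: "negs ?f - {1} = negs ?g - {1}"
    proof -
      have "?f j = ?g j" if "j > 1" for j using pos[of "nat j"] that by simp
      thus ?thesis by (auto simp: negs_def)
    qed
    have fin: "finite (negs ?f)" "finite (negs ?g)" and ev: "even (card (negs ?f))" "even (card (negs ?g))"
      using even_negs_word by auto
    have neg1: "1 \<in> negs ?f \<longleftrightarrow> 1 \<notin> negs ?g" using neg nz by (auto simp: negs_def)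
    have "card (negs h) = card (negs h - {1}) + of_bool (1 \<in> negs h)"
      if "finite (negs h)" for h
    proof (cases "1 \<in> negs h")
      case True
      hence "Suc (card (negs h - {1})) = card (negs h)" by (rule card_Suc_Diff1[OF that])
      thus ?thesis unfolding of_bool_def using True by presburger
    qed simp
    note card1 = this[OF fin(1)] this[OF fin(2)]
    have "odd (card (negs ?f) + card (negs ?g))"
      unfolding card1 * using neg1 by (cases "1 \<in> negs ?g") simp_all
    thus False using ev by simp
  qed
  have nat: "?f (int m) = ?g (int m)" for m
    using pos[of m] 1 by (cases "m = 0"; cases "m = 1") auto
  show ?thesis
  proof
    fix v :: int
    show "?f v = ?g v"
    proof (cases "v \<ge> 0")
      case True thus ?thesis using nat[of "nat v"] by simp
    next
      case False thus ?thesis using nat[of "nat (- v)"] by simp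
    qed
  qed
qed

section \<open>Column lengths and diagonals\<close>

text \<open>
The functions that arise as column lengths of \<open>k\<close>-strict partitions.  The value at 0 is a default, and
the last condition says that consecutive columns beyond \<open>k\<close> differ by at most one box, that is, that
each part greater than \<open>k\<close> occurs once.
\<close>

definition strict_cols :: "nat \<Rightarrow> (nat \<Rightarrow> nat) \<Rightarrow> bool" where
  "strict_cols k C \<longleftrightarrow> C 0 = 0 \<and> (\<forall>i\<ge>1. C (Suc i) \<le> C i) \<and> (\<exists>N. \<forall>i\<ge>N. C i = 0) \<and>
     (\<forall>i>k. C i \<le> Suc (C (Suc i)))"

text \<open>
The number of the diagonal through the bottom box of column \<open>k + x + 1\<close>.
\<close>

definition bdiag :: "nat \<Rightarrow> (nat \<Rightarrow> nat) \<Rightarrow> nat \<Rightarrow> nat" where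
  "bdiag k C x = x + C (k + x + 1)"

text \<open>
The parts of the strict partition that remains when the first \<open>k\<close> columns are removed.
\<close>

definition long_parts :: "nat \<Rightarrow> (nat \<Rightarrow> nat) \<Rightarrow> nat set" where
  "long_parts k C = {x. 1 \<le> x \<and> C (k + x + 1) < C (k + x)}"

definition related :: "nat \<Rightarrow> (nat \<Rightarrow> nat) \<Rightarrow> nat set" where
  "related k C = (\<lambda>i. C i + k - i) ` {1..k}"

text \<open>
The lengths of the related diagonals, by \<open>w_elt_lists\<close>; \<open>Vs\<close> is the analogue for the non-related ones,
without a bound \<open>n\<close>.
\<close>

definition Us :: "nat \<Rightarrow> (nat \<Rightarrow> nat) \<Rightarrow> nat set" where
  "Us k C = {x. x \<notin> long_parts k C \<and> bdiag k C x \<in> related k C}"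

definition Vs :: "nat \<Rightarrow> (nat \<Rightarrow> nat) \<Rightarrow> nat set" where
  "Vs k C = {x. x \<notin> long_parts k C \<and> bdiag k C x \<notin> related k C}"

lemma zero_notin_long_parts [simp]: "0 \<notin> long_parts k C"
  by (simp add: long_parts_def)

lemma cols_antimono:
  assumes "strict_cols k C" "1 \<le> i" "i \<le> j" shows "C j \<le> C i"
  using assms(3)
proof (induction j rule: dec_induct)
  case (step j)
  have "C (Suc j) \<le> C j" using assms(1,2) step.hyps by (auto simp: strict_cols_def)
  thus ?case using step.IH by simp
qed simp

lemma bdiag_Suc:
  assumes "strict_cols k C"
  shows "bdiag k C (Suc x) = (if Suc x \<in> long_parts k C then bdiag k C x else Suc (bdiag k C x))"
proof -
  have "C (k + x + 2) \<le> C (k + x + 1)" "C (k + x + 1) \<le> Suc (C (k + x + 2))"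
    using assms by (auto simp: strict_cols_def)
  thus ?thesis by (auto simp: bdiag_def long_parts_def)
qed

lemma bdiag_mono: assumes "strict_cols k C" "x \<le> y" shows "bdiag k C x \<le> bdiag k C y"
  using assms(2)
proof (induction y rule: dec_induct)
  case (step y)
  thus ?case using bdiag_Suc[OF assms(1), of y] by (auto split: if_splits)
qed simp

lemma bdiag_less:
  assumes "strict_cols k C" "x < y" "y \<notin> long_parts k C" shows "bdiag k C x < bdiag k C y"
proof -
  obtain z where y: "y = Suc z" using assms(2) by (cases y) auto
  have "bdiag k C x \<le> bdiag k C z" using assms y by (intro bdiag_mono) auto
  thus ?thesis using bdiag_Suc[OF assms(1), of z] assms(3) y by simp
qed

lemma bdiag_inj:
  assumes "strict_cols k C" "x \<notin> long_parts k C" "y \<notin> long_parts k C" "bdiag k C x = bdiag k C y"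
  shows "x = y"
  using bdiag_less[OF assms(1), of x y] bdiag_less[OF assms(1), of y x] assms by (metis nat_neq_iff)

lemma bdiag_surj:
  assumes "strict_cols k C" "bdiag k C 0 \<le> d"
  obtains x where "x \<notin> long_parts k C" "bdiag k C x = d"
proof -
  define x where "x = (LEAST x. d \<le> bdiag k C x)"
  have "d \<le> bdiag k C d" by (simp add: bdiag_def)
  hence ge: "d \<le> bdiag k C x" unfolding x_def by (rule LeastI)
  show thesis
  proof (cases x)
    case 0 thus ?thesis using that[of 0] assms ge by simp
  next
    case (Suc z)
    have "\<not> d \<le> bdiag k C z" using not_less_Least[of z "\<lambda>x. d \<le> bdiag k C x"] Suc x_def by simp
    thus ?thesis using that[of x] ge bdiag_Suc[OF assms(1), of z] Suc by (auto split: if_splits)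
  qed
qed

text \<open>
The number of the diagonal is weakly increasing in \<open>x\<close> and constant exactly on the steps that lead to a
part.
\<close>

lemma bdiag_fibre_unique_iff:
  assumes C: "strict_cols k C" and x: "x \<notin> long_parts k C"
  shows "(\<exists>!y. bdiag k C y = bdiag k C x) \<longleftrightarrow> Suc x \<notin> long_parts k C"
proof
  assume u: "\<exists>!y. bdiag k C y = bdiag k C x"
  show "Suc x \<notin> long_parts k C"
  proof
    assume "Suc x \<in> long_parts k C"
    hence "bdiag k C (Suc x) = bdiag k C x" using bdiag_Suc[OF C] by simp
    with u have "Suc x = x" by blast
    thus False by simp
  qed
next
  assume S: "Suc x \<notin> long_parts k C"
  show "\<exists>!y. bdiag k C y = bdiag k C x"
  proof (rule ex1I[of _ x])
    fix y assume y: "bdiag k C y = bdiag k C x"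
    have "\<not> y < x" using bdiag_less[OF C _ x, of y] y by auto
    moreover have "\<not> Suc x \<le> y" using bdiag_mono[OF C, of "Suc x" y] bdiag_Suc[OF C, of x] S y by auto
    ultimately show "y = x" by simp
  qed simp
qed

lemma related_strict:
  assumes "strict_cols k C" "1 \<le> i" "i < j" "j \<le> k" shows "C j + k - j < C i + k - i"
  using cols_antimono[OF assms(1,2), of j] assms by auto

lemma related_inj:
  assumes "strict_cols k C" "i \<in> {1..k}" "j \<in> {1..k}" "C i + k - i = C j + k - j"
  shows "i = j"
  using related_strict[OF assms(1), of i j] related_strict[OF assms(1), of j i] assms(2-4)
  by (metis atLeastAtMost_iff nat_neq_iff)

lemma related_ge:
  assumes "strict_cols k C" "d \<in> related k C" shows "C k \<le> d"
proof -
  obtain i where i: "1 \<le> i" "i \<le> k" "d = C i + k - i" using assms(2) by (auto simp: related_def)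
  show ?thesis using cols_antimono[OF assms(1) i(1,2)] i by simp
qed

lemma last_col_related: "1 \<le> k \<Longrightarrow> C k \<in> related k C"
  by (auto simp: related_def intro!: image_eqI[of _ _ k])

lemma bdiag_0_le_related:
  assumes "strict_cols k C" "1 \<le> k" "d \<in> related k C" shows "bdiag k C 0 \<le> d"
  using related_ge[OF assms(1,3)] cols_antimono[OF assms(1,2), of "k + 1"] by (simp add: bdiag_def)

lemma related_eq_bdiag_image:
  assumes "strict_cols k C" "1 \<le> k" shows "related k C = bdiag k C ` Us k C"
proof (intro equalityI subsetI)
  fix d assume d: "d \<in> related k C"
  obtain x where "x \<notin> long_parts k C" "bdiag k C x = d"
    using bdiag_surj[OF assms(1) bdiag_0_le_related[OF assms d]] by blast
  thus "d \<in> bdiag k C ` Us k C" using d by (auto simp: Us_def)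
qed (auto simp: Us_def)

text \<open>
The smallest diagonal that can be related is the one of column \<open>k\<close>, and it is the 0-th of the
enumeration exactly if no part equals \<open>k\<close>.
\<close>

lemma zero_in_Us_iff:
  assumes "strict_cols k C" "1 \<le> k"
  shows "0 \<in> Us k C \<longleftrightarrow> \<not> C (k + 1) < C k"
  using related_ge[OF assms(1), of "C (k + 1)"] last_col_related[OF assms(2), of C]
    cols_antimono[OF assms(1,2), of "k + 1"]
  by (auto simp: Us_def bdiag_def)

lemma finite_long_parts: assumes "strict_cols k C" shows "finite (long_parts k C)"
proof -
  obtain N where "\<forall>i\<ge>N. C i = 0" using assms by (auto simp: strict_cols_def)
  hence "x \<le> N" if "x \<in> long_parts k C" for x
    using that by (cases "x \<le> N") (auto simp: long_parts_def)
  hence "long_parts k C \<subseteq> {..N}" by blast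
  thus ?thesis by (rule finite_subset) simp
qed

lemma finite_related: "finite (related k C)" by (simp add: related_def)

section \<open>The entries beyond position k\<close>

definition typed_cols :: "nat \<Rightarrow> (nat \<Rightarrow> nat) \<Rightarrow> nat \<Rightarrow> bool" where
  "typed_cols k C t \<longleftrightarrow> strict_cols k C \<and> t \<in> {0, 1, 2} \<and> (0 < t \<longleftrightarrow> C (k + 1) < C k)"

text \<open>
The sign of the entry 1 when it stands beyond position \<open>k\<close>.  The total number of bars is even: they
belong to the long parts, to the first entry for type 2, and possibly to 1.
\<close>

definition unit_sign :: "nat \<Rightarrow> (nat \<Rightarrow> nat) \<Rightarrow> nat \<Rightarrow> int" where
  "unit_sign k C t = (if even (card (long_parts k C) + of_bool (t = 2)) then 1 else - 1)"

text \<open>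
The set of entries of \<open>w_lam\<close> beyond position \<open>k\<close>, including those beyond \<open>n + 1\<close>.
\<close>

definition tail_entries :: "nat \<Rightarrow> (nat \<Rightarrow> nat) \<Rightarrow> nat \<Rightarrow> int set" where
  "tail_entries k C t = {v. 1 < v \<and> nat (v - 1) \<in> Vs k C \<or> v < - 1 \<and> nat (- v - 1) \<in> long_parts k C \<or>
     t \<noteq> 0 \<and> v = unit_sign k C t}"

lemma unit_sign_cases: "unit_sign k C t = 1 \<or> unit_sign k C t = - 1"
  by (simp add: unit_sign_def)

lemma in_tail_entries:
  "1 \<le> x \<Longrightarrow> int x + 1 \<in> tail_entries k C t \<longleftrightarrow> x \<in> Vs k C"
  "1 \<le> x \<Longrightarrow> - (int x + 1) \<in> tail_entries k C t \<longleftrightarrow> x \<in> long_parts k C"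
  "1 \<in> tail_entries k C t \<longleftrightarrow> t \<noteq> 0 \<and> unit_sign k C t = 1"
  "- 1 \<in> tail_entries k C t \<longleftrightarrow> t \<noteq> 0 \<and> unit_sign k C t = - 1"
  "0 \<notin> tail_entries k C t"
  using unit_sign_cases[of k C t] by (auto simp: tail_entries_def)

lemma int_cases_unit:
  obtains "v = 0" | "v = 1" | "v = - 1" | x where "1 \<le> x" "v = int x + 1"
    | x where "1 \<le> x" "v = - (int x + 1)"
proof -
  consider "v = 0" | "v = 1" | "v = - 1" | "1 < v" | "v < - 1" by linarith
  thus thesis
  proof cases
    case 4 thus ?thesis using that(4)[of "nat (v - 1)"] by auto
  next
    case 5 thus ?thesis using that(5)[of "nat (- v - 1)"] by auto
  qed (use that in auto)
qed

lemma tail_set_tail_entries: assumes "strict_cols k C" shows "tail_set (tail_entries k C t)"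
proof -
  have "- v \<notin> tail_entries k C t" if "v \<in> tail_entries k C t" for v
    using that
  proof (cases v rule: int_cases_unit)
    case (4 x) thus ?thesis using that in_tail_entries(1,2)[of x k C t] by (auto simp: Vs_def)
  next
    case (5 x)
    have "x \<in> long_parts k C" using that unfolding 5(2) in_tail_entries(2)[OF 5(1)] .
    thus ?thesis unfolding 5(2) minus_minus in_tail_entries(1)[OF 5(1)] by (simp add: Vs_def)
  qed (use that in_tail_entries(3-5)[of k C t] unit_sign_cases[of k C t] in auto)
  moreover have "\<exists>N. \<forall>v>N. v \<in> tail_entries k C t"
  proof -
    have "finite (long_parts k C \<union> related k C)"
      using finite_long_parts[OF assms] finite_related by simp
    then obtain m where m: "\<And>x. x \<in> long_parts k C \<union> related k C \<Longrightarrow> x \<le> m"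
      by (meson finite_nat_set_iff_bounded_le)
    have "v \<in> tail_entries k C t" if "v > int m + 1" for v
    proof -
      let ?x = "nat (v - 1)"
      have x: "m < ?x" using that by simp
      moreover have "?x \<le> bdiag k C ?x" by (simp add: bdiag_def)
      ultimately have "?x \<in> Vs k C" using m[of ?x] m[of "bdiag k C ?x"] by (auto simp: Vs_def)
      thus ?thesis using that by (simp add: tail_entries_def)
    qed
    thus ?thesis by blast
  qed
  ultimately show ?thesis by (simp add: tail_set_def)
qed

lemma side_tail_entries:
  assumes "1 \<le> x"
  shows "side (tail_entries k C t) (int x + 1) =
    (if x \<in> Vs k C then 1 else if x \<in> long_parts k C then - 1 else 0)"
  using in_tail_entries(1,2)[OF assms, of k C t] by (auto simp: side_def Vs_def)

lemma side_tail_entries_1: "side (tail_entries k C t) 1 = (if t = 0 then 0 else unit_sign k C t)"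
  using unit_sign_cases[of k C t] in_tail_entries(3,4)[of k C t] by (auto simp: side_def)

lemma side_tail_entries_2: "side (tail_entries k C t) 2 =
    (if 1 \<in> Vs k C then 1 else if 1 \<in> long_parts k C then - 1 else 0)"
  using side_tail_entries[of 1 k C t] by simp

lemma tail_set_eqI:
  assumes A: "tail_set A" and B: "tail_set B"
    and eq: "\<And>x. side A (int x + 1) = side B (int x + 1)"
  shows "A = B"
proof -
  have "side A v = side B v" for v
  proof -
    consider "v = 0" | "v > 0" | "v < 0" by linarith
    thus ?thesis
    proof cases
      case 1 thus ?thesis by (simp add: side_def)
    next
      case 2 thus ?thesis using eq[of "nat (v - 1)"] by simp
    next
      case 3 thus ?thesis using eq[of "nat (- v - 1)"] by simp
    qed
  qed
  moreover have "v \<in> A \<longleftrightarrow> side A v = 1" "v \<in> B \<longleftrightarrow> side B v = 1" for v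
    using A B by (auto simp: side_def tail_set_def of_bool_def)
  ultimately show ?thesis by auto
qed

section \<open>Adding a box\<close>

text \<open>
Away from the value 1 a generator acts by exchanging the roles of \<open>x\<close> and \<open>x + 1\<close>.
\<close>

lemma tail_entries_swap:
  assumes C: "strict_cols k C" and C': "strict_cols k C'" and x: "1 \<le> x"
    and one: "side (tail_entries k C' t') 1 = side (tail_entries k C t) 1"
    and V: "\<And>y. 1 \<le> y \<Longrightarrow> y \<in> Vs k C' \<longleftrightarrow> transpose x (Suc x) y \<in> Vs k C"
    and P: "\<And>y. 1 \<le> y \<Longrightarrow> y \<in> long_parts k C' \<longleftrightarrow> transpose x (Suc x) y \<in> long_parts k C"
  shows "tail_entries k C' t' = gen (Suc x) ` tail_entries k C t"
proof (rule tail_set_eqI)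
  show "tail_set (tail_entries k C' t')" "tail_set (gen (Suc x) ` tail_entries k C t)"
    using C C' by (auto intro: tail_set_tail_entries tail_set_gen)
  fix y
  show "side (tail_entries k C' t') (int y + 1) = side (gen (Suc x) ` tail_entries k C t) (int y + 1)"
  proof (cases "y = 0")
    case True
    have "gen (Suc x) 1 = 1" using x by (auto simp: gen_eq lo_def hi_def)
    thus ?thesis using one True by simp
  next
    case False
    have g: "gen (Suc x) (int y + 1) = int (transpose x (Suc x) y) + 1"
      by (auto simp: gen_eq lo_def hi_def transpose_def)
    have y: "1 \<le> y" "1 \<le> transpose x (Suc x) y" using False x by (auto simp: transpose_def)
    show ?thesis unfolding side_gen g side_tail_entries[OF y(1)] side_tail_entries[OF y(2)] V[OF y(1)] P[OF y(1)] ..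
  qed
qed

text \<open>
The values 1 and 2 are exchanged, with a change of sign for \<open>s\<^sub>0\<close> only.
\<close>

lemma tail_entries_swap_0:
  assumes C: "strict_cols k C" and C': "strict_cols k C'"
    and i: "i = 1 \<and> s = 1 \<or> i = 0 \<and> s = - 1"
    and one: "side (tail_entries k C' t') 1 = s * side (tail_entries k C t) 2"
    and two: "side (tail_entries k C' t') 2 = s * side (tail_entries k C t) 1"
    and V: "\<And>y. 2 \<le> y \<Longrightarrow> y \<in> Vs k C' \<longleftrightarrow> y \<in> Vs k C"
    and P: "\<And>y. 2 \<le> y \<Longrightarrow> y \<in> long_parts k C' \<longleftrightarrow> y \<in> long_parts k C"
  shows "tail_entries k C' t' = gen i ` tail_entries k C t"
proof (rule tail_set_eqI)
  show "tail_set (tail_entries k C' t')" "tail_set (gen i ` tail_entries k C t)"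
    using C C' by (auto intro: tail_set_tail_entries tail_set_gen)
  fix y :: nat
  have g: "gen i 1 = s * 2" "gen i 2 = s"
    using i by (auto simp: gen_eq lo_def hi_def)
  have s: "side A (s * v) = s * side A v" for A v using i by auto
  consider "y = 0" | "y = 1" | "2 \<le> y" by linarith
  thus "side (tail_entries k C' t') (int y + 1) = side (gen i ` tail_entries k C t) (int y + 1)"
  proof cases
    case 1 thus ?thesis using one g s[of "tail_entries k C t" 2] by simp
  next
    case 2 thus ?thesis using two g s[of "tail_entries k C t" 1] by simp
  next
    case 3
    have "gen i (int y + 1) = int y + 1" using i 3 by (auto simp: gen_eq lo_def hi_def)
    thus ?thesis using V[OF 3] P[OF 3] 3 by (simp add: side_tail_entries)
  qed
qed

text \<open>
The condition under which a box added to column \<open>c\<close> forms a strip; see \<open>horiz_strip_one_box\<close>.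
\<close>

definition strip_ok :: "nat \<Rightarrow> (nat \<Rightarrow> nat) \<Rightarrow> nat \<Rightarrow> bool" where
  "strip_ok k C c \<longleftrightarrow> k < c \<or> (\<exists>!y. bdiag k C y = C c + k - c)"

lemma type_cong:
  assumes "typed_cols k C t" "typed_cols k C' t'" "t + t' \<noteq> 3"
    and "C (k + 1) < C k \<longleftrightarrow> C' (k + 1) < C' k"
  shows "t = t'"
  using assms by (auto simp: typed_cols_def)

text \<open>
The set of related diagonals does not see the columns beyond \<open>k\<close>, but its enumeration shifts at \<open>x\<close>: the
diagonal that was numbered by \<open>x + 1\<close> is afterwards numbered by \<open>x\<close>.  So the part \<open>x\<close> and whatever
belonged to \<open>x + 1\<close> change places.  For \<open>x = 0\<close> the part is new, the last part \<open>k\<close> may disappear (then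
the type becomes 0), and the sign of 1 decides between the generators 0 and 1.
\<close>

lemma row_move:
  assumes k: "1 \<le> k" and C: "typed_cols k C t" and C': "typed_cols k (C(c := Suc (C c))) t'"
    and t: "t + t' \<noteq> 3" and c: "c = k + x + 1"
  defines "C' \<equiv> C(c := Suc (C c))"
  defines "i \<equiv> (if 1 \<le> x then Suc x else if unit_sign k C t = 1 then 0 else 1)"
  shows "ascent (tail_entries k C t) i \<and> tail_entries k C' t' = gen i ` tail_entries k C t"
proof -
  have sC: "strict_cols k C" and sC': "strict_cols k C'"
    using C C' by (auto simp: typed_cols_def C'_def)
  have eqc: "C (k + x + 1) = C (k + x + 2)"
  proof -
    have "C' c \<le> Suc (C' (Suc c))" using sC' c by (auto simp: strict_cols_def)
    moreover have "C (k + x + 2) \<le> C (k + x + 1)" using sC by (auto simp: strict_cols_def)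
    ultimately show ?thesis by (auto simp: C'_def c)
  qed
  have ltc: "C (k + x + 1) < C (k + x)"
    using cols_antimono[OF sC', of "k + x" "k + x + 1"] k by (simp add: C'_def c)
  have lec: "C (k + x) \<le> Suc (C (k + x + 1))" if "1 \<le> x"
    using sC that by (auto simp: strict_cols_def)
  have P': "y \<in> long_parts k C' \<longleftrightarrow> y \<noteq> x \<and> (y \<in> long_parts k C \<or> y = Suc x)" for y
  proof -
    consider "y = x" | "y = Suc x" | "y \<noteq> x" "y \<noteq> Suc x" by blast
    thus ?thesis
    proof cases
      case 1 thus ?thesis using lec by (cases "1 \<le> x") (simp_all add: long_parts_def C'_def c)
    next
      case 2 thus ?thesis using eqc by (simp add: long_parts_def C'_def c)
    next
      case 3 thus ?thesis by (auto simp: long_parts_def C'_def c)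
    qed
  qed
  have SxP: "Suc x \<notin> long_parts k C" using eqc by (simp add: long_parts_def)
  have bdiag': "bdiag k C' y = (if y = x then Suc (bdiag k C x) else bdiag k C y)" for y
    by (auto simp: bdiag_def C'_def c)
  have bdiag_Sx: "bdiag k C (Suc x) = Suc (bdiag k C x)" using bdiag_Suc[OF sC, of x] SxP by simp
  have rel': "related k C' = related k C"
    unfolding related_def by (rule image_cong) (auto simp: C'_def c)
  have V': "y \<in> Vs k C' \<longleftrightarrow> (if y = x then Suc x \<in> Vs k C else y \<noteq> Suc x \<and> y \<in> Vs k C)" for y
    using SxP bdiag_Sx by (auto simp: Vs_def P' bdiag' rel')
  show ?thesis
  proof (cases "1 \<le> x")
    case True
    have xP: "x \<in> long_parts k C" using ltc True by (simp add: long_parts_def)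
    hence xV: "x \<notin> Vs k C" by (simp add: Vs_def)
    have tt: "t = t'" using type_cong[OF C C' t] True by (simp add: c)
    have "long_parts k C' = insert (Suc x) (long_parts k C - {x})"
      by (rule set_eqI, unfold P') auto
    hence "card (long_parts k C') = Suc (card (long_parts k C - {x}))"
      using finite_long_parts[OF sC] SxP by simp
    also have "\<dots> = card (long_parts k C)"
      by (rule card_Suc_Diff1[OF finite_long_parts[OF sC] xP])
    finally have "card (long_parts k C') = card (long_parts k C)" .
    hence "side (tail_entries k C' t') 1 = side (tail_entries k C t) 1"
      by (simp add: side_tail_entries_1 unit_sign_def tt)
    hence "tail_entries k C' t' = gen (Suc x) ` tail_entries k C t"
      by (rule tail_entries_swap[OF sC sC' True])
        (use xP SxP xV in \<open>auto simp: V' P' transpose_def\<close>)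
    moreover have "ascent (tail_entries k C t) (Suc x)"
    proof -
      have lo: "lo (Suc x) = int x + 1" and hi: "hi (Suc x) = int (Suc x) + 1"
        by (auto simp: lo_def hi_def)
      have "1 \<le> Suc x" by simp
      thus ?thesis unfolding ascent_def lo hi
        using xP SxP True by (simp only: side_tail_entries) (auto simp: Vs_def)
    qed
    ultimately show ?thesis using True by (simp add: i_def)
  next
    case False
    hence x: "x = 0" by simp
    \<comment> \<open>The generator \<open>i\<close> maps 2 to \<open>s\<close> and 1 to \<open>2 * s\<close>.\<close>
    define s :: int where "s = - unit_sign k C t"
    have t0: "t \<noteq> 0" using C ltc x by (auto simp: typed_cols_def)
    have i_s: "i = 1 \<and> s = 1 \<or> i = 0 \<and> s = - 1"
      using unit_sign_cases[of k C t] x by (auto simp: i_def s_def)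
    have c1: "side (tail_entries k C t) 1 = - s" using t0 by (simp add: side_tail_entries_1 s_def)
    have c2: "side (tail_entries k C t) 2 = of_bool (1 \<in> Vs k C)" using SxP x by (simp add: side_tail_entries_2)
    have t'_iff: "t' = 0 \<longleftrightarrow> 1 \<notin> Vs k C"
    proof -
      have "1 \<in> Vs k C \<longleftrightarrow> Suc (C (k + 1)) \<notin> related k C"
        using SxP bdiag_Sx x by (simp add: Vs_def bdiag_def)
      also have "\<dots> \<longleftrightarrow> Suc (C (k + 1)) \<noteq> C k"
        using related_ge[OF sC, of "Suc (C (k + 1))"] last_col_related[OF k, of C] ltc x by auto
      also have "\<dots> \<longleftrightarrow> t' \<noteq> 0" using C' ltc x by (auto simp: typed_cols_def c)
      finally show ?thesis by simp
    qed
    have sign': "unit_sign k C' t' = s" if "1 \<in> Vs k C"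
    proof -
      have "t' = t" using C C' t t0 t'_iff that by (auto simp: typed_cols_def)
      moreover have "long_parts k C' = insert 1 (long_parts k C)"
        by (rule set_eqI, unfold P' x) (auto intro: gr0I)
      hence "card (long_parts k C') = Suc (card (long_parts k C))"
        using finite_long_parts[OF sC] SxP x by simp
      ultimately show ?thesis by (simp add: unit_sign_def s_def)
    qed
    have "tail_entries k C' t' = gen i ` tail_entries k C t"
    proof (rule tail_entries_swap_0[OF sC sC' i_s])
      show "side (tail_entries k C' t') 1 = s * side (tail_entries k C t) 2"
        using sign' t'_iff by (auto simp: side_tail_entries_1 c2)
      show "side (tail_entries k C' t') 2 = s * side (tail_entries k C t) 1"
        using i_s x by (auto simp: side_tail_entries_2 c1 V' P')
    qed (use x in \<open>auto simp: V' P'\<close>)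
    moreover have "ascent (tail_entries k C t) i"
      using i_s c1 c2 side_minus[of "tail_entries k C t" 2] by (auto simp: ascent_def lo_def hi_def)
    ultimately show ?thesis by simp
  qed
qed

text \<open>
The enumeration of the diagonals is unchanged, and the related diagonal of \<open>x\<close> is replaced by its
successor, which belongs to \<open>x + 1\<close> because that is not a part.  For \<open>x = 0\<close> the type of the partition
changes from 0 to a type that can be chosen, and the choice corresponds to the generators 0 and 1.
\<close>

lemma column_move:
  assumes k: "1 \<le> k" and C: "typed_cols k C t" and C': "typed_cols k (C(c := Suc (C c))) t'"
    and t: "t + t' \<noteq> 3" and c: "1 \<le> c" "c \<le> k"
    and x: "x \<notin> long_parts k C" "Suc x \<notin> long_parts k C" "bdiag k C x = C c + k - c"
  defines "C' \<equiv> C(c := Suc (C c))"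
  defines "i \<equiv> (if 1 \<le> x then Suc x else if unit_sign k C' t' = 1 then 1 else 0)"
  shows "ascent (tail_entries k C t) i \<and> tail_entries k C' t' = gen i ` tail_entries k C t"
proof -
  have sC: "strict_cols k C" and sC': "strict_cols k C'"
    using C C' by (auto simp: typed_cols_def C'_def)
  have P': "long_parts k C' = long_parts k C"
    using c by (auto simp: long_parts_def C'_def)
  have bdiag': "bdiag k C' y = bdiag k C y" for y using c by (simp add: bdiag_def C'_def)
  define d where "d = C c + k - c"
  have d': "C' c + k - c = Suc d" using c by (simp add: C'_def d_def)
  have same: "C' j + k - j = C j + k - j" if "j \<noteq> c" for j using that by (simp add: C'_def)
  have ci: "c \<in> {1..k}" using c by simp
  have rel': "e \<in> related k C' \<longleftrightarrow> e = Suc d \<or> e \<noteq> d \<and> e \<in> related k C" for e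
  proof
    assume "e \<in> related k C'"
    then obtain j where j: "j \<in> {1..k}" "e = C' j + k - j" by (auto simp: related_def)
    show "e = Suc d \<or> e \<noteq> d \<and> e \<in> related k C"
    proof (cases "j = c")
      case True thus ?thesis using j d' by simp
    next
      case False
      hence e: "e = C j + k - j" using j same by simp
      hence "e \<noteq> d" using related_inj[OF sC j(1) ci] False by (auto simp: d_def)
      thus ?thesis using e j by (auto simp: related_def)
    qed
  next
    assume e: "e = Suc d \<or> e \<noteq> d \<and> e \<in> related k C"
    show "e \<in> related k C'"
    proof (cases "e = Suc d")
      case True thus ?thesis using d' ci by (auto simp: related_def intro!: image_eqI[of _ _ c])
    next
      case False
      then obtain j where j: "j \<in> {1..k}" "e = C j + k - j" using e by (auto simp: related_def)
      have "j \<noteq> c" using e False j by (auto simp: d_def)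
      hence "e = C' j + k - j" using j same[of j] by simp
      thus ?thesis using j(1) unfolding related_def by blast
    qed
  qed
  have d_rel: "d \<in> related k C" using ci by (auto simp: related_def d_def)
  have Sd: "Suc d \<notin> related k C"
  proof
    assume "Suc d \<in> related k C"
    then obtain j where j: "j \<in> {1..k}" "Suc d = C j + k - j" by (auto simp: related_def)
    have "j \<noteq> c" using j by (auto simp: d_def)
    moreover have "j = c" using related_inj[OF sC' j(1) ci] j d' same[of j] \<open>j \<noteq> c\<close> by simp
    ultimately show False by simp
  qed
  have bdiag_x: "bdiag k C x = d" "bdiag k C (Suc x) = Suc d"
    using bdiag_Suc[OF sC, of x] x by (simp_all add: d_def)
  have V': "y \<in> Vs k C' \<longleftrightarrow> y \<noteq> Suc x \<and> (y = x \<or> y \<in> Vs k C)" for y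
  proof (cases "y \<in> long_parts k C")
    case True thus ?thesis using x P' by (auto simp: Vs_def)
  next
    case False
    have "bdiag k C y = d \<longleftrightarrow> y = x" "bdiag k C y = Suc d \<longleftrightarrow> y = Suc x"
      using bdiag_inj[OF sC False] x bdiag_x by auto
    thus ?thesis using False by (auto simp: Vs_def P' bdiag' rel')
  qed
  have xV: "x \<notin> Vs k C" and SxV: "Suc x \<in> Vs k C"
    using bdiag_x d_rel Sd x by (auto simp: Vs_def)
  show ?thesis
  proof (cases "1 \<le> x")
    case True
    have "0 \<in> Us k C' \<longleftrightarrow> 0 \<in> Us k C"
      using V'[of 0] True by (auto simp: Us_def Vs_def)
    hence tt: "t = t'"
      using type_cong[OF C C' t] zero_in_Us_iff[OF sC k] zero_in_Us_iff[OF sC' k] by (auto simp: C'_def)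
    hence "side (tail_entries k C' t') 1 = side (tail_entries k C t) 1"
      by (simp add: side_tail_entries_1 unit_sign_def P')
    hence "tail_entries k C' t' = gen (Suc x) ` tail_entries k C t"
      by (rule tail_entries_swap[OF sC sC' True])
        (use x xV SxV in \<open>auto simp: V' P' transpose_def\<close>)
    moreover have "ascent (tail_entries k C t) (Suc x)"
    proof -
      have lo: "lo (Suc x) = int x + 1" and hi: "hi (Suc x) = int (Suc x) + 1"
        by (auto simp: lo_def hi_def)
      have "1 \<le> Suc x" by simp
      thus ?thesis unfolding ascent_def lo hi
        using xV SxV x True by (simp only: side_tail_entries) auto
    qed
    ultimately show ?thesis using True by (simp add: i_def)
  next
    case False
    hence x0: "x = 0" by simp
    define s where "s = unit_sign k C' t'"
    have i_s: "i = 1 \<and> s = 1 \<or> i = 0 \<and> s = - 1"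
      using unit_sign_cases[of k C' t'] x0 by (auto simp: i_def s_def)
    have t0: "t = 0"
      using C zero_in_Us_iff[OF sC k] x0 x xV by (auto simp: typed_cols_def Us_def Vs_def)
    have t'0: "t' \<noteq> 0"
      using C' zero_in_Us_iff[OF sC' k] x0 V'[of 0] by (auto simp: typed_cols_def C'_def Us_def Vs_def)
    have c1: "side (tail_entries k C t) 1 = 0" using t0 by (simp add: side_tail_entries_1)
    have c2: "side (tail_entries k C t) 2 = 1" using SxV x0 by (simp add: side_tail_entries_2)
    have "tail_entries k C' t' = gen i ` tail_entries k C t"
    proof (rule tail_entries_swap_0[OF sC sC' i_s])
      show "side (tail_entries k C' t') 1 = s * side (tail_entries k C t) 2"
        using t'0 by (simp add: side_tail_entries_1 c2 s_def)
      show "side (tail_entries k C' t') 2 = s * side (tail_entries k C t) 1"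
        using x x0 by (auto simp: side_tail_entries_2 c1 V' P')
    qed (use x0 in \<open>auto simp: V' P'\<close>)
    moreover have "ascent (tail_entries k C t) i"
      using i_s c1 c2 side_minus[of "tail_entries k C t" 2] by (auto simp: ascent_def lo_def hi_def)
    ultimately show ?thesis by simp
  qed
qed

lemma side_bounds: "- 1 \<le> side A v" "side A v \<le> 1" by (simp_all add: side_def)

lemma strip_ok_ascent:
  assumes k: "1 \<le> k" and C: "typed_cols k C t" and C': "typed_cols k (C(c := Suc (C c))) t'"
    and t: "t + t' \<noteq> 3" and c: "1 \<le> c" and ok: "strip_ok k C c"
  shows "\<exists>i. ascent (tail_entries k C t) i \<and> tail_entries k (C(c := Suc (C c))) t' = gen i ` tail_entries k C t"
proof (cases "k < c")
  case True
  hence "c = k + (c - k - 1) + 1" by simp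
  from row_move[OF k C C' t this] show ?thesis by blast
next
  case False
  have sC: "strict_cols k C" using C by (simp add: typed_cols_def)
  have ck: "c \<le> k" using False by simp
  have "C c + k - c \<in> related k C" using c ck by (auto simp: related_def)
  then obtain x where x: "x \<notin> long_parts k C" "bdiag k C x = C c + k - c"
    using bdiag_surj[OF sC bdiag_0_le_related[OF sC k]] by blast
  have "Suc x \<notin> long_parts k C"
    using bdiag_fibre_unique_iff[OF sC x(1)] ok False by (simp add: strip_ok_def x(2))
  from column_move[OF k C C' t c ck x(1) this x(2)] show ?thesis by blast
qed

lemma row_addable:
  assumes k: "1 \<le> k" and C: "typed_cols k C t" and c: "c = k + x + 1"
    and x: "x \<in> long_parts k C \<or> x = 0 \<and> t \<noteq> 0" "Suc x \<notin> long_parts k C"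
  obtains t' where "typed_cols k (C(c := Suc (C c))) t'" "t + t' \<noteq> 3"
proof -
  have sC: "strict_cols k C" using C by (simp add: typed_cols_def)
  have lt: "C (k + x + 1) < C (k + x)" using x C by (auto simp: long_parts_def typed_cols_def)
  have le: "C (k + x + 1) \<le> C (k + x + 2)" using x(2) by (simp add: long_parts_def)
  have "strict_cols k (C(c := Suc (C c)))"
    unfolding strict_cols_def
  proof (intro conjI allI impI)
    show "(C(c := Suc (C c))) 0 = 0" using sC by (simp add: strict_cols_def c)
    obtain N where N: "\<forall>i\<ge>N. C i = 0" using sC by (auto simp: strict_cols_def)
    have "\<forall>i\<ge>max N (Suc c). (C(c := Suc (C c))) i = 0" using N by simp
    thus "\<exists>N. \<forall>i\<ge>N. (C(c := Suc (C c))) i = 0" by blast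
  next
    fix i :: nat assume "1 \<le> i"
    thus "(C(c := Suc (C c))) (Suc i) \<le> (C(c := Suc (C c))) i"
      using sC lt c by (auto simp: strict_cols_def le_Suc_eq)
  next
    fix i assume "k < i"
    thus "(C(c := Suc (C c))) i \<le> Suc ((C(c := Suc (C c))) (Suc i))"
      using sC le c by (auto simp: strict_cols_def le_Suc_eq)
  qed
  moreover have "C (k + 1) < C k" if "(C(c := Suc (C c))) (k + 1) < (C(c := Suc (C c))) k"
    using that c by (auto split: if_splits)
  ultimately have "typed_cols k (C(c := Suc (C c)))
      (if (C(c := Suc (C c))) (k + 1) < (C(c := Suc (C c))) k then t else 0)"
    using C by (auto simp: typed_cols_def)
  moreover have "t + (if (C(c := Suc (C c))) (k + 1) < (C(c := Suc (C c))) k then t else 0) \<noteq> 3"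
    using C by (auto simp: typed_cols_def)
  ultimately show thesis by (rule that)
qed

lemma column_addable:
  assumes k: "1 \<le> k" and C: "typed_cols k C t" and \<tau>: "\<tau> \<in> {1, 2}"
    and x: "x \<in> Us k C" "Suc x \<in> Vs k C"
  obtains c t' where "1 \<le> c" "c \<le> k" "bdiag k C x = C c + k - c"
    "typed_cols k (C(c := Suc (C c))) t'" "t + t' \<noteq> 3" "t = 0 \<Longrightarrow> t' \<noteq> 0 \<Longrightarrow> t' = \<tau>"
proof -
  have sC: "strict_cols k C" using C by (simp add: typed_cols_def)
  obtain c where c: "1 \<le> c" "c \<le> k" "bdiag k C x = C c + k - c"
    using x(1) by (auto simp: Us_def related_def)
  let ?C = "C(c := Suc (C c))"
  have Sd: "Suc (C c + k - c) \<notin> related k C"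
  proof -
    have "bdiag k C (Suc x) = Suc (C c + k - c)"
      using x(2) bdiag_Suc[OF sC, of x] c by (simp add: Vs_def)
    thus ?thesis using x(2) by (simp add: Vs_def)
  qed
  have above: "C c < C (c - 1)" if "2 \<le> c"
  proof -
    have "C c \<le> C (c - 1)" using cols_antimono[OF sC, of "c - 1" c] that by simp
    moreover have "C (c - 1) \<noteq> C c"
    proof
      assume "C (c - 1) = C c"
      hence "Suc (C c + k - c) = C (c - 1) + k - (c - 1)" using c that by simp
      moreover have "c - 1 \<in> {1..k}" using c that by auto
      ultimately show False using Sd unfolding related_def by blast
    qed
    ultimately show ?thesis by simp
  qed
  have sC': "strict_cols k ?C"
    unfolding strict_cols_def
  proof (intro conjI allI impI)
    show "?C 0 = 0" using sC c by (simp add: strict_cols_def)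
    obtain N where N: "\<forall>i\<ge>N. C i = 0" using sC by (auto simp: strict_cols_def)
    have "\<forall>i\<ge>max N (Suc c). ?C i = 0" using N by simp
    thus "\<exists>N. \<forall>i\<ge>N. ?C i = 0" by blast
  next
    fix i :: nat assume i: "1 \<le> i"
    have "C (Suc i) \<le> C i" using sC i by (simp add: strict_cols_def)
    moreover have "Suc (C c) \<le> C i" if "c = Suc i" using above i that by auto
    ultimately show "?C (Suc i) \<le> ?C i" by (auto simp: le_Suc_eq)
  next
    fix i assume "k < i"
    thus "?C i \<le> Suc (?C (Suc i))" using sC c by (auto simp: strict_cols_def)
  qed
  define t' where "t' = (if ?C (k + 1) < ?C k then if t = 0 then \<tau> else t else 0)"
  have mono: "?C (k + 1) < ?C k" if "C (k + 1) < C k" using that c by auto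
  have "typed_cols k ?C t'" "t + t' \<noteq> 3" "t = 0 \<Longrightarrow> t' \<noteq> 0 \<Longrightarrow> t' = \<tau>"
    using C \<tau> sC' mono by (auto simp: typed_cols_def t'_def)
  thus thesis using that c by blast
qed

text \<open>
The converse of \<open>strip_ok_ascent\<close>.  At an ascent the larger of the two values is not barred.  If the
smaller one is barred, a long part can grow; otherwise it is among the first \<open>k\<close> entries and the larger
one is not, so a related diagonal can move on.
\<close>

lemma ascent_strip_ok:
  assumes k: "1 \<le> k" and C: "typed_cols k C t" and up: "ascent (tail_entries k C t) i"
  obtains c t' where "1 \<le> c" "typed_cols k (C(c := Suc (C c))) t'" "t + t' \<noteq> 3" "strip_ok k C c"
    "tail_entries k (C(c := Suc (C c))) t' = gen i ` tail_entries k C t"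
proof -
  have sC: "strict_cols k C" using C by (simp add: typed_cols_def)
  define x where "x = i - 1"
  have up': "side (tail_entries k C t) (lo i) < side (tail_entries k C t) (hi i)" using up by (simp add: ascent_def)
  note sg = unit_sign_cases[of k C t]
  have c1: "side (tail_entries k C t) 1 = (if t = 0 then 0 else unit_sign k C t)" by (rule side_tail_entries_1)
  note c2 = side_tail_entries_2[of k C t]
  have big: "side (tail_entries k C t) (int x + 1) < side (tail_entries k C t) (int (Suc x) + 1)" if "2 \<le> i"
    using up' that by (simp add: lo_def hi_def x_def of_nat_diff)
  have Sx: "Suc x \<notin> long_parts k C"
  proof
    assume S: "Suc x \<in> long_parts k C"
    consider "2 \<le> i" | "i = 0" | "i = 1" by linarith
    thus False
    proof cases
      case 1
      have "side (tail_entries k C t) (int (Suc x) + 1) = - 1"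
        using S side_tail_entries[of "Suc x" k C t] by (simp add: Vs_def)
      thus False using big[OF 1] side_bounds(1)[of "tail_entries k C t" "int x + 1"] by simp
    next
      case 2
      have "side (tail_entries k C t) 2 = - 1" using S 2 c2 by (simp add: x_def Vs_def)
      thus False using up' 2 side_minus[of "tail_entries k C t" 2] side_bounds(2)[of "tail_entries k C t" 1]
        by (simp add: lo_def hi_def)
    next
      case 3
      have "side (tail_entries k C t) 2 = - 1" using S 3 c2 by (simp add: x_def Vs_def)
      thus False using up' 3 side_bounds(1)[of "tail_entries k C t" 1] by (simp add: lo_def hi_def)
    qed
  qed
  consider (row) "x \<in> long_parts k C \<or> x = 0 \<and> t \<noteq> 0"
    | (column) "x \<in> Us k C" "Suc x \<in> Vs k C" "x = 0 \<longrightarrow> t = 0"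
  proof (cases "2 \<le> i")
    case True
    hence x1: "1 \<le> x" by (simp add: x_def)
    have Sx1: "1 \<le> Suc x" by simp
    have "x \<in> long_parts k C \<or> x \<in> Us k C \<and> Suc x \<in> Vs k C"
      using big[OF True] Sx unfolding side_tail_entries[OF x1] side_tail_entries[OF Sx1]
      by (auto simp: Us_def Vs_def split: if_splits)
    thus thesis using that x1 by auto
  next
    case False
    hence i01: "i = 0 \<or> i = 1" and x0: "x = 0" by (auto simp: x_def)
    show thesis
    proof (cases "t = 0")
      case True
      have "0 \<in> Us k C" using True C zero_in_Us_iff[OF sC k] by (auto simp: typed_cols_def)
      moreover have "1 \<in> Vs k C"
        using up' i01 True c1 c2 side_minus[of "tail_entries k C t" 2] Sx x0
        by (auto simp: lo_def hi_def split: if_splits)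
      ultimately show thesis using that(2) x0 True by simp
    qed (use that(1) x0 in simp)
  qed
  thus thesis
  proof cases
    case row
    define c where "c = k + x + 1"
    obtain t' where t': "typed_cols k (C(c := Suc (C c))) t'" "t + t' \<noteq> 3"
      using row_addable[OF k C c_def row Sx] by blast
    have ii: "(if 1 \<le> x then Suc x else if unit_sign k C t = 1 then 0 else 1) = i"
    proof (cases "2 \<le> i")
      case False
      hence i01: "i = 0 \<or> i = 1" and x0: "x = 0" by (auto simp: x_def)
      show ?thesis using up' i01 row x0 c1 c2 sg Sx side_minus[of "tail_entries k C t" 2]
        by (auto simp: lo_def hi_def split: if_splits)
    qed (simp add: x_def)
    have "tail_entries k (C(c := Suc (C c))) t' = gen i ` tail_entries k C t"
      using row_move[OF k C t' c_def] unfolding ii by blast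
    moreover have "strip_ok k C c" "1 \<le> c" by (simp_all add: strip_ok_def c_def)
    ultimately show thesis using that t' by blast
  next
    case column
    \<comment> \<open>When the type was 0, the new type is chosen so that the sign of 1 selects the given generator.\<close>
    define \<tau> :: nat where "\<tau> = (if even (card (long_parts k C)) \<longleftrightarrow> i = 1 then 1 else 2)"
    have \<tau>12: "\<tau> \<in> {1, 2}" by (simp add: \<tau>_def)
    obtain c t' where ct: "1 \<le> c" "c \<le> k" "bdiag k C x = C c + k - c"
      "typed_cols k (C(c := Suc (C c))) t'" "t + t' \<noteq> 3" "t = 0 \<Longrightarrow> t' \<noteq> 0 \<Longrightarrow> t' = \<tau>"
      using column_addable[OF k C \<tau>12 column(1,2)] by blast
    have xP: "x \<notin> long_parts k C" using column by (simp add: Us_def)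
    note mv = column_move[OF k C ct(4,5,1,2) xP Sx ct(3)]
    have "tail_entries k (C(c := Suc (C c))) t' = gen i ` tail_entries k C t"
    proof (cases "2 \<le> i")
      case True
      hence "1 \<le> x" "Suc x = i" by (auto simp: x_def)
      thus ?thesis using mv by simp
    next
      case False
      hence i01: "i = 0 \<or> i = 1" and x0: "x = 0" by (auto simp: x_def)
      have t0: "t = 0" using column x0 by simp
      have "t' \<noteq> 0"
      proof
        assume t': "t' = 0"
        have "side (tail_entries k (C(c := Suc (C c))) t') 1 = 0" by (simp add: side_tail_entries_1 t')
        moreover have "side (tail_entries k C t) (gen j 1) \<noteq> 0" if "j \<in> {0, 1}" for j
          using that column x0 c2 side_minus[of "tail_entries k C t" 2] by (auto simp: gen_eq lo_def hi_def)
        ultimately show False using mv x0 by (auto split: if_splits)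
      qed
      hence "t' = \<tau>" using ct(6) t0 by simp
      moreover have "long_parts k (C(c := Suc (C c))) = long_parts k C"
        using ct(2) by (auto simp: long_parts_def)
      ultimately have "(if unit_sign k (C(c := Suc (C c))) t' = 1 then 1 else 0) = i"
        using i01 by (auto simp: unit_sign_def \<tau>_def)
      thus ?thesis using mv x0 by simp
    qed
    moreover have "strip_ok k C c"
      using bdiag_fibre_unique_iff[OF sC xP] Sx ct(3) by (simp add: strip_ok_def)
    ultimately show thesis using that ct by blast
  qed
qed

text \<open>
The smallest long part can always be shortened; if there is none, every removal gives a strip, since
the enumeration of the diagonals is then the identity.
\<close>

lemma removable_box:
  assumes k: "1 \<le> k" and C: "typed_cols k C t" and ne: "C \<noteq> (\<lambda>_. 0)"
  obtains C0 c t0 where "typed_cols k C0 t0" "1 \<le> c" "C = C0(c := Suc (C0 c))" "strip_ok k C0 c"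
    "t0 + t \<noteq> 3"
proof -
  have sC: "strict_cols k C" using C by (simp add: typed_cols_def)
  obtain N where N: "\<And>i. N \<le> i \<Longrightarrow> C i = 0" using sC by (auto simp: strict_cols_def)
  have anti: "C (Suc i) \<le> C i" if "1 \<le> i" for i using sC that by (simp add: strict_cols_def)
  have str: "C i \<le> Suc (C (Suc i))" if "k < i" for i using sC that by (simp add: strict_cols_def)
  obtain c where c: "1 \<le> c" "C (Suc c) < C c" "k < c \<longrightarrow> C (c - 1) \<le> C c \<or> c = k + 1"
    "k < c \<or> (\<forall>i>k. C i = 0)"
  proof (cases "long_parts k C = {}")
    case False
    define p where "p = Min (long_parts k C)"
    have p: "p \<in> long_parts k C" using False finite_long_parts[OF sC] by (simp add: p_def)
    have min: "q \<notin> long_parts k C" if "q < p" for q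
      using that Min_le[OF finite_long_parts[OF sC], of q] unfolding p_def by linarith
    show thesis
    proof (rule that[of "k + p"])
      show "k < k + p \<longrightarrow> C (k + p - 1) \<le> C (k + p) \<or> k + p = k + 1"
        using min[of "p - 1"] p by (cases p) (auto simp: long_parts_def)
    qed (use p in \<open>auto simp: long_parts_def\<close>)
  next
    case True
    have z: "C i = 0" if "k < i" for i
    proof -
      have "C i \<le> C (i + m)" for m
      proof (induction m)
        case (Suc m)
        have "i + m - k \<notin> long_parts k C" using True by simp
        moreover have "1 \<le> i + m - k" using that by simp
        ultimately show ?case using Suc that by (simp add: long_parts_def)
      qed simp
      thus ?thesis using N[of "i + N"] by (metis le_add2 le_zero_eq)
    qed
    obtain j where j: "C j \<noteq> 0" using ne by (auto simp: fun_eq_iff)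
    define c where "c = Max {i. C i \<noteq> 0}"
    have "{i. C i \<noteq> 0} \<subseteq> {..k}" using z by (metis (mono_tags) atMost_iff mem_Collect_eq not_le subsetI)
    hence fin: "finite {i. C i \<noteq> 0}" by (rule finite_subset) simp
    have cc: "C c \<noteq> 0" using Max_in[OF fin] j by (auto simp: c_def)
    have max: "C (Suc c) = 0" using Max_ge[OF fin, of "Suc c"] by (auto simp: c_def)
    have "1 \<le> c" using cc sC by (cases c) (auto simp: strict_cols_def)
    moreover have "\<not> k < c" using z cc by auto
    ultimately show thesis using that[of c] cc max z by simp
  qed
  define C0 where "C0 = C(c := C c - 1)"
  have CC0: "C = C0(c := Suc (C0 c))" using c(2) by (auto simp: C0_def)
  have sC0: "strict_cols k C0"
    unfolding strict_cols_def
  proof (intro conjI allI impI)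
    show "C0 0 = 0" using sC c by (simp add: strict_cols_def C0_def)
    have "\<forall>i\<ge>N. C0 i = 0" using N by (simp add: C0_def)
    thus "\<exists>N. \<forall>i\<ge>N. C0 i = 0" by blast
  next
    fix i :: nat assume "1 \<le> i"
    thus "C0 (Suc i) \<le> C0 i" using anti[of i] c(2) by (auto simp: C0_def)
  next
    fix i assume "k < i"
    thus "C0 i \<le> Suc (C0 (Suc i))" using str[of i] c by (auto simp: C0_def)
  qed
  \<comment> \<open>If shortening a part \<open>k + 1\<close> creates the only part \<open>k\<close>, either type is possible; 1 is taken.\<close>
  define t0 where "t0 = (if C0 (k + 1) < C0 k then if t = 0 then 1 else t else 0)"
  have "typed_cols k C0 t0" using sC0 C by (auto simp: typed_cols_def t0_def)
  moreover have "t0 + t \<noteq> 3" using C by (auto simp: typed_cols_def t0_def)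
  moreover have "strip_ok k C0 c"
  proof (cases "k < c")
    case False
    hence "\<forall>i>k. C0 i = 0" using c(4) by (simp add: C0_def)
    hence "bdiag k C0 y = y" for y by (simp add: bdiag_def)
    thus ?thesis by (simp add: strip_ok_def)
  qed (simp add: strip_ok_def)
  ultimately show thesis using that c(1) CC0 by blast
qed

section \<open>Recovering and reaching a typed partition\<close>

text \<open>
The set shows the long parts, hence the columns beyond \<open>k\<close> and the enumeration of the diagonals.  It
also shows which diagonals are related, and their increasing order gives back the first \<open>k\<close> columns.
The parity of the bars distinguishes types 1 and 2.
\<close>

lemma tail_entries_inject:
  assumes k: "1 \<le> k" and C: "typed_cols k C t" and C': "typed_cols k C' t'"
    and eq: "tail_entries k C t = tail_entries k C' t'"
  shows "C = C' \<and> t = t'"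
proof -
  have sC: "strict_cols k C" and sC': "strict_cols k C'" using C C' by (auto simp: typed_cols_def)
  have P: "long_parts k C = long_parts k C'"
  proof (rule set_eqI)
    fix x show "x \<in> long_parts k C \<longleftrightarrow> x \<in> long_parts k C'"
    proof (cases "1 \<le> x")
      case True
      show ?thesis using in_tail_entries(2)[OF True, of k C t] in_tail_entries(2)[OF True, of k C' t'] eq by simp
    qed (simp add: long_parts_def)
  qed
  have V: "x \<in> Vs k C \<longleftrightarrow> x \<in> Vs k C'" if "1 \<le> x" for x
    using in_tail_entries(1)[OF that, of k C t] in_tail_entries(1)[OF that, of k C' t'] eq by simp
  have nz: "u \<noteq> 0 \<longleftrightarrow> 1 \<in> tail_entries k D u \<or> - 1 \<in> tail_entries k D u" for D u
    unfolding in_tail_entries(3,4) using unit_sign_cases[of k D u] by blast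
  have t0: "t = 0 \<longleftrightarrow> t' = 0" using nz[of t C] nz[of t' C'] unfolding eq by blast
  have one: "unit_sign k D u = 1 \<longleftrightarrow> 1 \<in> tail_entries k D u" if "u \<noteq> 0" for D u
    unfolding in_tail_entries(3) using that by blast
  have sign: "unit_sign k C t = unit_sign k C' t'" if "t \<noteq> 0"
  proof -
    have "unit_sign k C t = 1 \<longleftrightarrow> unit_sign k C' t' = 1"
      using one[of t C] one[of t' C'] that t0 unfolding eq by blast
    thus ?thesis using unit_sign_cases[of k C t] unit_sign_cases[of k C' t'] by argo
  qed
  have "t = 2 \<longleftrightarrow> t' = 2" if "t \<noteq> 0"
    using sign[OF that] by (cases "t = 2"; cases "t' = 2") (simp_all add: unit_sign_def P split: if_splits)
  hence tt: "t = t'" using t0 C C' by (auto simp: typed_cols_def)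
  have U: "Us k C = Us k C'"
  proof (rule set_eqI)
    fix x show "x \<in> Us k C \<longleftrightarrow> x \<in> Us k C'"
    proof (cases "x = 0")
      case True
      thus ?thesis using zero_in_Us_iff[OF sC k] zero_in_Us_iff[OF sC' k] C C' tt
        by (auto simp: typed_cols_def)
    next
      case False thus ?thesis using V[of x] P by (auto simp: Us_def Vs_def)
    qed
  qed
  obtain N where N: "\<forall>i\<ge>N. C i = 0" using sC by (auto simp: strict_cols_def)
  obtain N' where N': "\<forall>i\<ge>N'. C' i = 0" using sC' by (auto simp: strict_cols_def)
  define M where "M = max k (max N N')"
  have high: "C i = C' i" if "k < i" for i
  proof (cases "i \<le> M")
    case True
    thus ?thesis
    proof (induction i rule: inc_induct)
      case base thus ?case using N N' by (simp add: M_def)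
    next
      case (step j)
      have kj: "k < j" using that step.hyps by simp
      have "j - k \<in> long_parts k C \<longleftrightarrow> j - k \<in> long_parts k C'" using P by simp
      moreover have "1 \<le> j - k" using kj by simp
      ultimately have "C (Suc j) < C j \<longleftrightarrow> C' (Suc j) < C' j" using kj by (simp add: long_parts_def)
      moreover have "C (Suc j) \<le> C j" "C j \<le> Suc (C (Suc j))" "C' (Suc j) \<le> C' j" "C' j \<le> Suc (C' (Suc j))"
        using sC sC' kj by (auto simp: strict_cols_def)
      ultimately show ?case using step.IH by linarith
    qed
  next
    case False thus ?thesis using N N' by (simp add: M_def)
  qed
  have "bdiag k C x = bdiag k C' x" for x using high[of "k + x + 1"] by (simp add: bdiag_def)
  hence rel: "related k C = related k C'"
    unfolding related_eq_bdiag_image[OF sC k] related_eq_bdiag_image[OF sC' k] U by (rule image_cong[OF refl])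
  have low: "C i = C' i" if "1 \<le> i" "i \<le> k" for i
  proof -
    \<comment> \<open>The related diagonals in increasing order, that is, from column \<open>k\<close> down to column 1.\<close>
    define f where "f = (\<lambda>D j. D (k - j) + j :: nat)"
    have mono: "strict_mono_on {..<k} (f D)" if "strict_cols k D" for D
    proof (rule strict_mono_onI)
      fix a b assume ab: "a \<in> {..<k}" "b \<in> {..<k}" "a < b"
      hence "1 \<le> k - b" "k - b \<le> k - a" by auto
      hence "D (k - a) \<le> D (k - b)" by (rule cols_antimono[OF that])
      thus "f D a < f D b" using ab by (simp add: f_def)
    qed
    have img: "f D ` {..<k} = related k D" for D
    proof (intro equalityI subsetI)
      fix d assume "d \<in> f D ` {..<k}"
      then obtain j where "j < k" "d = D (k - j) + j" by (auto simp: f_def)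
      thus "d \<in> related k D" unfolding related_def by (intro image_eqI[of _ _ "k - j"]) auto
    next
      fix d assume "d \<in> related k D"
      then obtain j where "1 \<le> j" "j \<le> k" "d = D j + k - j" by (auto simp: related_def)
      thus "d \<in> f D ` {..<k}" by (intro image_eqI[of _ _ "k - j"]) (auto simp: f_def)
    qed
    have "f C (k - i) = f C' (k - i)"
    proof (rule strict_mono_on_same_image[OF mono[OF sC] mono[OF sC']])
      show "f C ` {..<k} = f C' ` {..<k}" unfolding img by (rule rel)
      show "k - i \<in> {..<k}" using that by simp
    qed
    thus ?thesis using that by (simp add: f_def)
  qed
  have "C i = C' i" for i
  proof -
    consider "i = 0" | "1 \<le> i" "i \<le> k" | "k < i" by linarith
    thus ?thesis
    proof cases
      case 1 thus ?thesis using sC sC' by (simp add: strict_cols_def)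
    qed (use low high in blast)+
  qed
  thus ?thesis using tt by auto
qed

definition cols_size :: "(nat \<Rightarrow> nat) \<Rightarrow> nat" where
  "cols_size C = (\<Sum>i\<in>{i. C i \<noteq> 0}. C i)"

lemma cols_size_add_box:
  assumes "strict_cols k C" shows "cols_size (C(c := Suc (C c))) = Suc (cols_size C)"
proof -
  obtain N where N: "\<forall>i\<ge>N. C i = 0" using assms by (auto simp: strict_cols_def)
  define S where "S = insert c {..<N}"
  have supp: "i \<in> S" if "C i \<noteq> 0" for i
    using that N by (cases "i < N") (auto simp: S_def)
  have fin: "finite S" by (simp add: S_def)
  have "cols_size C = sum C S" unfolding cols_size_def
    by (rule sum.mono_neutral_left[OF fin]) (use supp in auto)
  moreover have "cols_size (C(c := Suc (C c))) = sum (C(c := Suc (C c))) S" unfolding cols_size_def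
    by (rule sum.mono_neutral_left[OF fin]) (use supp in \<open>auto simp: S_def split: if_splits\<close>)
  moreover have "sum (C(c := Suc (C c))) S = Suc (sum C S)"
  proof -
    have cS: "c \<in> S" by (simp add: S_def)
    have "sum (C(c := Suc (C c))) S = Suc (C c) + sum (C(c := Suc (C c))) (S - {c})"
      using sum.remove[OF fin cS, of "C(c := Suc (C c))"] by simp
    also have "sum (C(c := Suc (C c))) (S - {c}) = sum C (S - {c})" by (rule sum.cong) auto
    finally show ?thesis using sum.remove[OF fin cS, of C] by simp
  qed
  ultimately show ?thesis by simp
qed

lemma tail_entries_empty:
  assumes "1 \<le> k" shows "tail_entries k (\<lambda>_. 0) 0 = tail k"
proof -
  have P: "long_parts k (\<lambda>_. 0) = {}" by (simp add: long_parts_def)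
  have R: "related k (\<lambda>_. 0) = {..<k}"
  proof (intro equalityI subsetI)
    fix d assume "d \<in> {..<k}"
    thus "d \<in> related k (\<lambda>_. 0)" unfolding related_def by (intro image_eqI[of _ _ "k - d"]) auto
  qed (auto simp: related_def)
  have V: "Vs k (\<lambda>_. 0) = {k..}" by (auto simp: Vs_def P R bdiag_def)
  show ?thesis using assms by (auto simp: tail_entries_def P V tail_def)
qed

text \<open>
Removing boxes one at a time down to the empty partition shows that \<open>w_lam\<close> has a word of length
\<open>\<bar>lam\<bar>\<close> and that its set has \<open>2\<bar>lam\<bar>\<close> inversions.
\<close>

lemma typed_cols_reachable:
  assumes k: "1 \<le> k" and C: "typed_cols k C t"
  shows "\<exists>a. length a = cols_size C \<and> grassmannian k (word_prod a) \<and>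
    word_prod a ` tail k = tail_entries k C t \<and> card (inversions (tail_entries k C t)) = 2 * cols_size C"
  using C
proof (induction "cols_size C" arbitrary: C t rule: less_induct)
  case less
  show ?case
  proof (cases "C = (\<lambda>_. 0)")
    case True
    hence t: "t = 0" using less.prems by (simp add: typed_cols_def)
    have "grassmannian k (word_prod [])" by (simp add: grassmannian_def)
    moreover have "cols_size C = 0" using True by (simp add: cols_size_def)
    moreover have "tail_entries k C t = tail k" using tail_entries_empty[OF k] True t by simp
    ultimately show ?thesis
      by (intro exI[of _ "[]"]) (simp add: inversions_tail)
  next
    case False
    obtain C0 c t0 where C0: "typed_cols k C0 t0" "1 \<le> c" "C = C0(c := Suc (C0 c))"
      "strip_ok k C0 c" "t0 + t \<noteq> 3"
      using removable_box[OF k less.prems False] by blast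
    have size: "cols_size C = Suc (cols_size C0)"
      using cols_size_add_box C0(1,3) by (auto simp: typed_cols_def)
    obtain a where a: "length a = cols_size C0" "grassmannian k (word_prod a)"
      "word_prod a ` tail k = tail_entries k C0 t0" "card (inversions (tail_entries k C0 t0)) = 2 * cols_size C0"
      using less.hyps[of C0 t0] C0(1) size by auto
    obtain i where i: "ascent (tail_entries k C0 t0) i" "tail_entries k C t = gen i ` tail_entries k C0 t0"
      using strip_ok_ascent[OF k C0(1) _ C0(5,2,4)] less.prems unfolding C0(3) by blast
    have ts: "tail_set (tail_entries k C0 t0)" using C0(1) by (auto simp: typed_cols_def intro: tail_set_tail_entries)
    have "grassmannian k (word_prod (i # a))"
      using grassmannian_gen[OF a(2), of i] ascent_changes[OF ts i(1)] a(3) by simp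
    moreover have "word_prod (i # a) ` tail k = tail_entries k C t"
      unfolding word_prod_Cons image_comp[symmetric] a(3) i(2) ..
    moreover have "card (inversions (tail_entries k C t)) = 2 * cols_size C"
      using card_inversions_ascent[OF ts i(1)] a(4) i(2) size by simp
    ultimately show ?thesis using a(1) size by (intro exI[of _ "i # a"]) simp
  qed
qed

section \<open>Partitions and their column lengths\<close>

lemma initial_segment_eq:
  fixes S :: "nat set"
  assumes "finite S" "0 \<notin> S" "\<And>r r'. r \<in> S \<Longrightarrow> 1 \<le> r' \<Longrightarrow> r' \<le> r \<Longrightarrow> r' \<in> S"
  shows "S = {1..card S}"
proof (cases "S = {}")
  case False
  have "S = {1..Max S}"
  proof (intro equalityI subsetI)
    fix r assume r: "r \<in> S"
    hence "r \<noteq> 0" using assms(2) by metis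
    thus "r \<in> {1..Max S}" using r assms(1) by simp
  next
    fix r assume "r \<in> {1..Max S}"
    thus "r \<in> S" using assms(3)[OF Max_in[OF assms(1) False], of r] by simp
  qed
  thus ?thesis by (metis card_atLeastAtMost diff_Suc_1)
qed simp

lemma partition_nth_antimono:
  assumes "is_partition lam" "i \<le> j" "j < length lam" shows "lam ! j \<le> lam ! i"
  using assms sorted_wrt_nth_less[of "(\<ge>)" lam i j] by (cases "i = j") (auto simp: is_partition_def)

lemma in_diagram_iff:
  assumes "is_partition lam"
  shows "(r, c) \<in> diagram lam \<longleftrightarrow> 1 \<le> r \<and> 1 \<le> c \<and> r \<le> col_len lam c"
proof (cases "1 \<le> c")
  case True
  define S where "S = {r. (r, c) \<in> diagram lam}"
  have "S \<subseteq> {1..length lam}" by (auto simp: S_def diagram_def)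
  hence "finite S" by (rule finite_subset) simp
  moreover have "r' \<in> S" if "r \<in> S" "1 \<le> r'" "r' \<le> r" for r r'
  proof -
    have r: "1 \<le> r" "r \<le> length lam" "c \<le> lam ! (r - 1)" using that by (auto simp: S_def diagram_def)
    have "lam ! (r - 1) \<le> lam ! (r' - 1)"
      by (rule partition_nth_antimono[OF assms]) (use r that in auto)
    thus ?thesis using r that True by (simp add: S_def diagram_def)
  qed
  ultimately have "S = {1..card S}" by (intro initial_segment_eq) (auto simp: S_def diagram_def)
  hence "r \<in> S \<longleftrightarrow> 1 \<le> r \<and> r \<le> card S" by (metis atLeastAtMost_iff)
  thus ?thesis using True by (simp add: S_def col_len_def)
qed (auto simp: diagram_def)

lemma distinct_filterD:
  "distinct (filter P xs) \<Longrightarrow> i < j \<Longrightarrow> j < length xs \<Longrightarrow> P (xs ! i) \<Longrightarrow> xs ! i \<noteq> xs ! j"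
proof (induction xs arbitrary: i j)
  case (Cons x xs)
  show ?case
  proof (cases i)
    case 0
    then obtain j' where "j = Suc j'" using Cons.prems by (cases j) auto
    thus ?thesis using Cons.prems 0 by (auto dest: nth_mem)
  next
    case (Suc i')
    then obtain j' where "j = Suc j'" using Cons.prems by (cases j) auto
    thus ?thesis using Cons.IH[of i' j'] Cons.prems Suc by (auto split: if_splits)
  qed
qed simp

lemma distinct_filterI:
  "(\<And>i j. i < j \<Longrightarrow> j < length xs \<Longrightarrow> P (xs ! i) \<Longrightarrow> xs ! i \<noteq> xs ! j) \<Longrightarrow> distinct (filter P xs)"
proof (induction xs)
  case (Cons x xs)
  have "distinct (filter P xs)" using Cons.prems[of "Suc i" "Suc j" for i j] by (intro Cons.IH) auto
  moreover have "x \<notin> set xs" if "P x"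
  proof
    assume "x \<in> set xs"
    then obtain j where "j < length xs" "xs ! j = x" by (auto simp: in_set_conv_nth)
    thus False using Cons.prems[of 0 "Suc j"] that by simp
  qed
  ultimately show ?case by simp
qed simp

lemma col_len_0: "col_len lam 0 = 0"
  by (simp add: col_len_def diagram_def)

lemma strict_cols_col_len:
  assumes "k_strict k lam" shows "strict_cols k (col_len lam)"
proof -
  have part: "is_partition lam" using assms by (simp add: k_strict_def)
  note in_d = in_diagram_iff[OF part]
  have d: "(r, c) \<in> diagram lam \<longleftrightarrow> 1 \<le> r \<and> r \<le> length lam \<and> 1 \<le> c \<and> c \<le> lam ! (r - 1)" for r c
    by (simp add: diagram_def)
  have anti: "col_len lam (Suc c) \<le> col_len lam c" if "1 \<le> c" for c
  proof (cases "col_len lam (Suc c) = 0")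
    case False
    hence "(col_len lam (Suc c), Suc c) \<in> diagram lam" by (simp add: in_d)
    hence "(col_len lam (Suc c), c) \<in> diagram lam" using that by (simp add: d)
    thus ?thesis by (simp add: in_d)
  qed simp
  have zero: "col_len lam c = 0" if c: "Suc (sum_list lam) \<le> c" for c
  proof (rule ccontr)
    assume "col_len lam c \<noteq> 0"
    hence "(1, c) \<in> diagram lam" using c by (simp add: in_d)
    hence "0 < length lam" "c \<le> lam ! 0" by (auto simp: d)
    hence "lam ! 0 \<in> set lam" "c \<le> lam ! 0" by (auto intro: nth_mem)
    thus False using member_le_sum_list[of "lam ! 0" lam] c by simp
  qed
  have strict: "col_len lam i \<le> Suc (col_len lam (Suc i))" if i: "k < i" for i
  proof (rule ccontr)
    assume c: "\<not> ?thesis"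
    define a where "a = Suc (col_len lam (Suc i))"
    have "(a, i) \<in> diagram lam" "(Suc a, i) \<in> diagram lam" using c i by (auto simp: in_d a_def)
    moreover have "(a, Suc i) \<notin> diagram lam" "(Suc a, Suc i) \<notin> diagram lam" by (auto simp: in_d a_def)
    ultimately have "lam ! (a - 1) = i" "lam ! a = i" "a < length lam" "1 \<le> a"
      by (auto simp: d not_le less_Suc_eq_le)
    thus False using distinct_filterD[of "\<lambda>x. k < x" lam "a - 1" a] assms i by (simp add: k_strict_def)
  qed
  show ?thesis unfolding strict_cols_def
    using anti zero strict col_len_0 by blast
qed

lemma partition_of_cols:
  assumes C: "strict_cols k C"
  obtains lam where "k_strict k lam" "col_len lam = C"
proof -
  define R where "R = (\<lambda>j. card {c. 1 \<le> c \<and> j < C c})"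
  obtain N where N: "\<forall>i\<ge>N. C i = 0" using C by (auto simp: strict_cols_def)
  have R: "c \<le> R j \<longleftrightarrow> j < C c" if "1 \<le> c" for c j
  proof -
    let ?S = "{c. 1 \<le> c \<and> j < C c}"
    have "c \<le> N" if "c \<in> ?S" for c using that N by (cases "N \<le> c") auto
    hence "finite ?S" by (meson finite_nat_set_iff_bounded_le)
    moreover have "c' \<in> ?S" if "c \<in> ?S" "1 \<le> c'" "c' \<le> c" for c c'
      using cols_antimono[OF C that(2,3)] that by auto
    ultimately have "?S = {1..R j}" unfolding R_def by (intro initial_segment_eq) auto
    hence "c \<in> ?S \<longleftrightarrow> c \<in> {1..R j}" by metis
    thus ?thesis using that by auto
  qed
  define lam where "lam = map R [0..<C 1]"
  have len: "length lam = C 1" and nth: "j < C 1 \<Longrightarrow> lam ! j = R j" for j by (auto simp: lam_def)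
  have anti: "R j \<le> R i" if "i \<le> j" for i j
  proof (cases "R j = 0")
    case False
    hence "j < C (R j)" using R[of "R j" j] by simp
    thus ?thesis using R[of "R j" i] that False by simp
  qed simp
  have part: "is_partition lam"
    unfolding is_partition_def sorted_wrt_iff_nth_less using R[of 1] anti by (auto simp: lam_def Suc_le_eq)
  have dist: "distinct (filter (\<lambda>x. k < x) lam)"
  proof (rule distinct_filterI)
    fix i j assume ij: "i < j" "j < length lam" "k < lam ! i"
    show "lam ! i \<noteq> lam ! j"
    proof
      assume eq: "lam ! i = lam ! j"
      let ?m = "lam ! i"
      have m: "?m = R i" "?m = R j" "1 \<le> ?m" using ij eq by (auto simp: len nth)
      hence "j < C ?m" using R[of ?m j] by simp
      moreover have "\<not> i < C (Suc ?m)" using R[of "Suc ?m" i] m by simp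
      moreover have "C ?m \<le> Suc (C (Suc ?m))" using C ij by (simp add: strict_cols_def)
      ultimately show False using ij by simp
    qed
  qed
  have "col_len lam c = C c" for c
  proof (cases "1 \<le> c")
    case True
    have "(r, c) \<in> diagram lam \<longleftrightarrow> r \<in> {1..C c}" for r
    proof (cases "1 \<le> r \<and> r \<le> C 1")
      case r: True
      hence "lam ! (r - 1) = R (r - 1)" by (intro nth) auto
      thus ?thesis using r True R[OF True, of "r - 1"] by (auto simp: diagram_def len)
    next
      case False
      have "C c \<le> C 1" using cols_antimono[OF C _ True] by simp
      thus ?thesis using False by (auto simp: diagram_def len)
    qed
    hence "{r. (r, c) \<in> diagram lam} = {1..C c}" by blast
    thus ?thesis by (simp add: col_len_def)
  next
    case False
    hence "c = 0" by simp
    thus ?thesis using C by (simp add: col_len_0 strict_cols_def)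
  qed
  thus thesis using that part dist by (auto simp: k_strict_def)
qed

lemma length_eq_col_len: assumes "is_partition lam" shows "length lam = col_len lam 1"
proof -
  have "{r. (r, 1) \<in> diagram lam} = {1..length lam}"
    using assms by (auto simp: diagram_def is_partition_def Suc_le_eq)
  thus ?thesis by (simp add: col_len_def)
qed

lemma partition_eqI:
  assumes "is_partition lam" "is_partition mu" "col_len lam = col_len mu" shows "lam = mu"
proof (rule nth_equalityI)
  show len: "length lam = length mu" using assms by (simp add: length_eq_col_len)
  fix j assume j: "j < length lam"
  have "c \<le> lam ! j \<longleftrightarrow> c \<le> mu ! j" if "1 \<le> c" for c
    using in_diagram_iff[OF assms(1), of "Suc j" c] in_diagram_iff[OF assms(2), of "Suc j" c]
      assms(3) j len that by (simp add: diagram_def)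
  from this[of "lam ! j"] this[of "mu ! j"] show "lam ! j = mu ! j"
    by (metis le_antisym le_refl less_one linorder_not_le not_gr_zero zero_le)
qed

lemma mem_partition_iff:
  assumes "is_partition lam" "1 \<le> c"
  shows "c \<in> set lam \<longleftrightarrow> col_len lam (Suc c) < col_len lam c"
proof -
  have in_d: "j < length lam \<and> c' \<le> lam ! j \<longleftrightarrow> j < col_len lam c'" if "1 \<le> c'" for j c'
    using in_diagram_iff[OF assms(1), of "Suc j" c'] that by (auto simp: diagram_def)
  have "c \<in> set lam \<longleftrightarrow> (\<exists>j<length lam. lam ! j = c)" by (auto simp: in_set_conv_nth)
  also have "\<dots> \<longleftrightarrow> (\<exists>j. (j < length lam \<and> c \<le> lam ! j) \<and> \<not> (j < length lam \<and> Suc c \<le> lam ! j))"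
    by (auto simp: not_less_eq_eq le_antisym)
  also have "\<dots> \<longleftrightarrow> (\<exists>j. j < col_len lam c \<and> \<not> j < col_len lam (Suc c))"
    using in_d[of c] in_d[of "Suc c"] assms(2) by simp
  also have "\<dots> \<longleftrightarrow> col_len lam (Suc c) < col_len lam c" by (auto simp: not_less)
  finally show ?thesis .
qed

definition cols :: "typed_partition \<Rightarrow> nat \<Rightarrow> nat" where "cols L = col_len (shape L)"

lemma typed_k_strict_cols:
  assumes "1 \<le> k"
  shows "typed_k_strict k L \<longleftrightarrow> k_strict k (shape L) \<and> typed_cols k (cols L) (ptype L)"
  using mem_partition_iff[OF _ assms, of "shape L"] strict_cols_col_len[of k "shape L"]
  by (auto simp: typed_k_strict_def typed_cols_def cols_def k_strict_def)

lemma sum_list_eq_card_diagram: "sum_list lam = card (diagram lam)"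
proof -
  have "diagram lam = (SIGMA r:{1..length lam}. {1..lam ! (r - 1)})" by (auto simp: diagram_def)
  hence "card (diagram lam) = (\<Sum>r=1..length lam. lam ! (r - 1))" by simp
  also have "\<dots> = (\<Sum>j=0..<length lam. lam ! j)"
    by (rule sum.reindex_bij_witness[of _ Suc "\<lambda>r. r - 1"]) auto
  finally show ?thesis by (simp add: sum_list_sum_nth)
qed

lemma finite_diagram: "finite (diagram lam)"
proof -
  have "diagram lam = (SIGMA r:{1..length lam}. {1..lam ! (r - 1)})" by (auto simp: diagram_def)
  thus ?thesis by simp
qed

lemma sum_list_eq_cols_size:
  assumes "k_strict k lam" shows "sum_list lam = cols_size (col_len lam)"
proof -
  have part: "is_partition lam" using assms by (simp add: k_strict_def)
  obtain N where N: "\<And>i. N \<le> i \<Longrightarrow> col_len lam i = 0"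
    using strict_cols_col_len[OF assms] by (auto simp: strict_cols_def)
  let ?S = "{c. col_len lam c \<noteq> 0}"
  have "c \<le> N" if "c \<in> ?S" for c using that N[of c] by (cases "N \<le> c") auto
  hence fin: "finite ?S" by (meson finite_nat_set_iff_bounded_le)
  have "diagram lam = prod.swap ` (SIGMA c:?S. {1..col_len lam c})"
    using in_diagram_iff[OF part] by (force simp: col_len_0 image_iff Suc_le_eq intro: gr0I)
  hence "card (diagram lam) = card (SIGMA c:?S. {1..col_len lam c})"
    by (simp add: card_image)
  thus ?thesis using fin by (simp add: sum_list_eq_card_diagram cols_size_def)
qed

section \<open>Strips with one box\<close>

lemma col_len_Cons: "col_len (q # mu) c = col_len mu c + of_bool (1 \<le> c \<and> c \<le> q)"
proof -
  have "{r. (r, c) \<in> diagram (q # mu)} =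
      Suc ` {r. (r, c) \<in> diagram mu} \<union> (if 1 \<le> c \<and> c \<le> q then {1} else {})" (is "?A = ?B")
  proof (rule set_eqI)
    fix r
    show "r \<in> ?A \<longleftrightarrow> r \<in> ?B"
    proof (cases r)
      case (Suc r')
      thus ?thesis by (cases r') (auto simp: diagram_def image_iff)
    qed (auto simp: diagram_def)
  qed
  moreover have "finite {r. (r, c) \<in> diagram mu}"
    by (rule finite_subset[of _ "{..length mu}"]) (auto simp: diagram_def)
  moreover have "1 \<notin> Suc ` {r. (r, c) \<in> diagram mu}" by (auto simp: diagram_def)
  ultimately show ?thesis by (simp add: col_len_def card_image)
qed

lemma col_len_pos_le_first_part:
  assumes "is_partition lam" "0 < col_len lam c" shows "c \<le> first_part lam"
proof (cases "1 \<le> c")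
  case True
  hence "(1, c) \<in> diagram lam" using assms by (simp add: in_diagram_iff[OF assms(1)])
  thus ?thesis by (cases lam) (auto simp: diagram_def first_part_def)
qed simp

lemma col_len_le_length: "is_partition lam \<Longrightarrow> col_len lam c \<le> length lam"
proof (cases "1 \<le> c \<and> 0 < col_len lam c")
  case True
  assume "is_partition lam"
  hence "(col_len lam c, c) \<in> diagram lam" using True by (simp add: in_diagram_iff)
  thus ?thesis by (simp add: diagram_def)
qed (auto simp: col_len_0 not_le)

lemma one_box_cols:
  assumes lam: "is_partition lam" and mu: "is_partition mu"
    and sub: "diagram mu \<subseteq> diagram lam" and size: "sum_list lam = Suc (sum_list mu)"
  obtains c where "1 \<le> c" "col_len lam = (col_len mu)(c := Suc (col_len mu c))"
proof -
  have "card (diagram lam - diagram mu) = 1"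
    using size sub finite_diagram by (simp add: sum_list_eq_card_diagram card_Diff_subset)
  then obtain h c where hc: "diagram lam - diagram mu = {(h, c)}"
    by (metis card_1_singletonE surj_pair)
  have c1: "1 \<le> c" using hc by (auto simp: diagram_def)
  have fin: "finite {r. (r, i) \<in> diagram mu}" for i
    by (rule finite_subset[of _ "{..length mu}"]) (auto simp: diagram_def)
  have mem: "b \<in> diagram lam \<longleftrightarrow> b \<in> diagram mu \<or> b = (h, c)" for b using hc sub by blast
  have "col_len lam i = ((col_len mu)(c := Suc (col_len mu c))) i" for i
  proof (cases "i = c")
    case True
    have "{r. (r, c) \<in> diagram lam} = insert h {r. (r, c) \<in> diagram mu}" using mem by auto
    moreover have "(h, c) \<notin> diagram mu" using hc by blast
    ultimately show ?thesis using fin[of c] True by (simp add: col_len_def)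
  next
    case False
    thus ?thesis using mem by (simp add: col_len_def)
  qed
  thus thesis using that c1 by blast
qed

text \<open>
For a first box in the first \<open>k\<close> columns, relatedness means lying on a common diagonal inside these
columns, and on the reflected diagonal beyond them.
\<close>

lemma k_related_diagonal:
  assumes "c \<le> k"
  shows "k_related k (h, c) (r, i) \<longleftrightarrow>
    (if i \<le> k then h + i = r + c else h + k + k + 1 = r + i + c)"
  using assms by (auto simp: k_related_def abs_if of_nat_diff)

lemma card_Collect_eq_1_iff: "card {y. P y} = 1 \<longleftrightarrow> (\<exists>!y. P y)"
proof
  assume "card {y. P y} = 1"
  then obtain x where "{y. P y} = {x}" by (rule card_1_singletonE)
  thus "\<exists>!y. P y" by (metis (mono_tags) mem_Collect_eq singleton_iff)
next
  assume "\<exists>!y. P y"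
  then obtain x where "P x" "\<And>y. P y \<Longrightarrow> y = x" by blast
  hence "{y. P y} = {x}" by blast
  thus "card {y. P y} = 1" by simp
qed

text \<open>
The long first row of \<open>nu\<close> lengthens every column of \<open>mu\<close> by one, up to \<open>p + 1\<close>, so \<open>nu\<close> has exactly one
box outside \<open>lam\<close> in each of these columns except in column \<open>c\<close>.  Only column \<open>c\<close> can have equal length in
\<open>nu\<close> and \<open>lam\<close>, so the conditions on \<open>lam \<rightarrow> nu\<close> reduce to the first one for \<open>i = c \<le> k\<close>.  The new boxes
related to \<open>[\<alpha>\<^sub>c, c]\<close> lie in columns beyond \<open>k\<close> and correspond to the columns whose bottom box in \<open>mu\<close> is
on the diagonal \<open>\<mu>'\<^sub>c + k - c\<close>.
\<close>

lemma horiz_strip_one_box: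
  assumes k: "1 \<le> k" and lam: "k_strict k lam" and mu: "k_strict k mu" and c: "1 \<le> c"
    and cl: "col_len lam = (col_len mu)(c := Suc (col_len mu c))"
  shows "horiz_strip_k k lam mu \<longleftrightarrow> strip_ok k (col_len mu) c"
proof -
  define C where "C = col_len mu"
  have pl: "is_partition lam" and pm: "is_partition mu" using lam mu by (auto simp: k_strict_def)
  have sC: "strict_cols k C" unfolding C_def by (rule strict_cols_col_len[OF mu])
  have cl: "col_len lam = C(c := Suc (C c))" using cl by (simp add: C_def)
  note inl = in_diagram_iff[OF pl] and inm = in_diagram_iff[OF pm]
  have sub: "diagram mu \<subseteq> diagram lam"
  proof
    fix b assume "b \<in> diagram mu"
    thus "b \<in> diagram lam" by (cases b) (auto simp: inl inm cl C_def)
  qed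
  have size: "sum_list lam - sum_list mu = 1"
    using cols_size_add_box[OF sC, of c]
    by (simp add: sum_list_eq_cols_size[OF lam] sum_list_eq_cols_size[OF mu] cl C_def)
  have ne: "lam \<noteq> []"
  proof
    assume "lam = []"
    hence "col_len lam c = 0" by (simp add: col_len_def diagram_def)
    thus False by (simp add: cl)
  qed
  have key: "arrow k lam (q # mu) \<longleftrightarrow> strip_ok k C c"
    if p: "first_part lam + 2 \<le> q" "length lam + 2 * k \<le> q" for q
  proof -
    let ?nu = "q # mu"
    have Cq: "i \<le> first_part lam" if "0 < C i" for i
      using col_len_pos_le_first_part[OF pl, of i] that by (simp add: cl split: if_splits)
    have mu_le: "x \<le> first_part lam" if x: "x \<in> set mu" for x
    proof -
      obtain j where "j < length mu" "mu ! j = x" using x by (auto simp: in_set_conv_nth)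
      moreover have "0 < x" using pm x by (simp add: is_partition_def)
      ultimately have "(Suc j, x) \<in> diagram mu" by (simp add: diagram_def)
      thus ?thesis using Cq[of x] by (simp add: inm C_def)
    qed
    have nu: "k_strict k ?nu"
      using mu mu_le p(1) by (fastforce simp: k_strict_def is_partition_def)
    have pn: "is_partition ?nu" using nu by (simp add: k_strict_def)
    have Cnu: "col_len ?nu i = C i + of_bool (1 \<le> i \<and> i \<le> q)" for i
      by (simp add: col_len_Cons C_def)
    note inn = in_diagram_iff[OF pn]
    have new: "(r, i) \<in> diagram ?nu - diagram lam \<longleftrightarrow> 1 \<le> i \<and> i \<le> q \<and> i \<noteq> c \<and> r = Suc (C i)" for r i
      by (auto simp: inn inl Cnu cl)
    have "diagram lam \<subseteq> diagram ?nu"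
    proof
      fix b assume b: "b \<in> diagram lam"
      obtain r i where [simp]: "b = (r, i)" by (cases b)
      have r: "1 \<le> r" "1 \<le> i" "r \<le> col_len lam i" using b by (auto simp: inl)
      hence "i \<le> first_part lam" using col_len_pos_le_first_part[OF pl, of i] by simp
      hence "i \<le> q" using p by simp
      thus "b \<in> diagram ?nu" using r by (auto simp: inn Cnu cl split: if_splits)
    qed
    moreover have "horizontal_strip (diagram ?nu - diagram lam)"
      unfolding horizontal_strip_def using new by (metis prod.collapse)
    \<comment> \<open>Nothing needs to be removed: the witness is \<open>lam\<close> itself.\<close>
    ultimately have rho: "\<exists>rho. is_partition rho \<and>
        diagram rho \<subseteq> diagram lam \<and> vertical_strip (diagram lam - diagram rho) \<and>
        (\<forall>b \<in> diagram lam - diagram rho. snd b \<le> k) \<and>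
        diagram rho \<subseteq> diagram ?nu \<and> horizontal_strip (diagram ?nu - diagram rho)"
      using pl by (intro exI[of _ lam]) (auto simp: vertical_strip_def)
    let ?card = "card {b \<in> diagram ?nu - diagram lam. k_related k (col_len lam c, c) b}"
    have "arrow k lam ?nu \<longleftrightarrow> (c \<le> k \<longrightarrow> ?card \<le> 1)"
    proof -
      have kq: "k \<le> q" using p by simp
      have "(\<forall>i\<in>{1..k}.
        (col_len ?nu i = col_len lam i \<longrightarrow>
           card {b \<in> diagram ?nu - diagram lam. k_related k (col_len lam i, i) b} \<le> 1) \<and>
        (col_len ?nu i < col_len lam i \<longrightarrow>
           (\<forall>j\<in>{col_len ?nu i..col_len lam i}.
              \<exists>!b. b \<in> diagram ?nu - diagram lam \<and> k_related k (j, i) b) \<and>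
           (\<exists>row. \<forall>j\<in>{col_len ?nu i..col_len lam i}.
              \<forall>b \<in> diagram ?nu - diagram lam. k_related k (j, i) b \<longrightarrow> fst b = row)))
        \<longleftrightarrow> (\<forall>i\<in>{1..k}. i = c \<longrightarrow> ?card \<le> 1)"
      proof (rule ball_cong[OF refl], goal_cases)
        case (1 i)
        hence n: "col_len ?nu i = Suc (C i)" using kq by (simp add: Cnu)
        show ?case
        proof (cases "i = c")
          case True
          thus ?thesis unfolding n by (simp add: cl)
        next
          case False
          hence "col_len lam i = C i" by (simp add: cl)
          thus ?thesis unfolding n using False by simp
        qed
      qed
      also have "\<dots> \<longleftrightarrow> (c \<le> k \<longrightarrow> ?card \<le> 1)" using c by auto
      finally show ?thesis unfolding arrow_def using lam nu rho by blast
    qed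
    also have "\<dots> \<longleftrightarrow> strip_ok k C c"
    proof (cases "c \<le> k")
      case ck: True
      define d where "d = C c + k - c"
      let ?F = "{y. bdiag k C y = d}"
      let ?box = "\<lambda>y. (Suc (C (k + y + 1)), k + y + 1)"
      have yq: "k + y + 1 \<le> q" if "bdiag k C y = d" for y
      proof -
        have "C c \<le> length lam" using col_len_le_length[OF pl, of c] by (simp add: cl)
        moreover have "y \<le> d" using that by (simp add: bdiag_def)
        ultimately show ?thesis using p c ck by (simp add: d_def)
      qed
      have "{b \<in> diagram ?nu - diagram lam. k_related k (col_len lam c, c) b} = ?box ` ?F" (is "?L = ?R")
      proof (intro equalityI subsetI)
        fix b assume b: "b \<in> ?L"
        obtain r i where [simp]: "b = (r, i)" by (cases b)
        have i: "1 \<le> i" "i \<le> q" "i \<noteq> c" "r = Suc (C i)" using b new[of r i] by auto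
        have rel: "k_related k (Suc (C c), c) (r, i)" using b by (simp add: cl)
        show "b \<in> ?R"
        proof (cases "i \<le> k")
          case True
          have "C c + i = C i + c" using rel True i ck by (simp add: k_related_diagonal)
          hence "C i + k - i = C c + k - c" using True ck by simp
          hence "i = c" using related_inj[OF sC, of i c] i True ck c by simp
          thus ?thesis using i by simp
        next
          case False
          define y where "y = i - k - 1"
          have iy: "i = k + y + 1" using False by (simp add: y_def)
          have "bdiag k C y = d"
            using rel i ck unfolding iy by (simp add: k_related_diagonal bdiag_def d_def)
          thus ?thesis using iy i by auto
        qed
      next
        fix b assume "b \<in> ?R"
        then obtain y where y: "bdiag k C y = d" "b = ?box y" by auto
        have "k_related k (Suc (C c), c) (?box y)"
          using y(1) ck by (simp add: k_related_diagonal bdiag_def d_def)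
        thus "b \<in> ?L" using new[of "Suc (C (k + y + 1))" "k + y + 1"] yq[OF y(1)] y(2) ck
          by (simp add: cl)
      qed
      moreover have "inj_on ?box ?F" by (auto simp: inj_on_def)
      ultimately have card: "?card = card ?F" by (simp add: card_image)
      have "finite ?F" by (rule finite_subset[of _ "{..d}"]) (auto simp: bdiag_def)
      moreover have "?F \<noteq> {}"
      proof -
        have "d \<in> related k C" using c ck by (auto simp: related_def d_def)
        thus ?thesis using bdiag_surj[OF sC bdiag_0_le_related[OF sC k]] by blast
      qed
      ultimately have "card ?F \<le> 1 \<longleftrightarrow> card ?F = 1"
        by (metis card_0_eq le_eq_less_or_eq less_one)
      also have "\<dots> \<longleftrightarrow> (\<exists>!y. bdiag k C y = d)"
        by (rule card_Collect_eq_1_iff)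
      finally show ?thesis using ck card by (simp add: strip_ok_def d_def)
    qed (simp add: strip_ok_def)
    finally show ?thesis .
  qed
  have "arrow k lam ((p + 1) # mu) \<longleftrightarrow> strip_ok k C c"
    if "max (first_part lam + 1) (length lam + 2 * k - 1) \<le> p" for p
    by (rule key) (use that in auto)
  moreover have "\<exists>p. max (first_part lam + 1) (length lam + 2 * k - 1) \<le> p" by blast
  ultimately have "(\<forall>p\<ge>max (first_part lam + 1) (length lam + 2 * k - 1). arrow k lam ((p + 1) # mu)) \<longleftrightarrow>
      strip_ok k C c" by blast
  thus ?thesis unfolding horiz_strip_k_def size C_def[symmetric] using lam mu sub by blast
qed

lemma typed_horiz_strip_one_box_iff:
  assumes k: "1 \<le> k" and L: "typed_k_strict k L" and M: "typed_k_strict k M"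
  shows "typed_horiz_strip k L M \<and> psize L = Suc (psize M) \<longleftrightarrow>
    (\<exists>c\<ge>1. cols L = (cols M)(c := Suc (cols M c)) \<and> strip_ok k (cols M) c) \<and> ptype L + ptype M \<noteq> 3"
proof -
  have kL: "k_strict k (shape L)" and kM: "k_strict k (shape M)"
    using L M by (auto simp: typed_k_strict_def)
  hence pL: "is_partition (shape L)" and pM: "is_partition (shape M)" by (auto simp: k_strict_def)
  show ?thesis
  proof
    assume a: "typed_horiz_strip k L M \<and> psize L = Suc (psize M)"
    hence "diagram (shape M) \<subseteq> diagram (shape L)"
      by (simp add: typed_horiz_strip_def horiz_strip_k_def)
    then obtain c where c: "1 \<le> c"
      "col_len (shape L) = (col_len (shape M))(c := Suc (col_len (shape M) c))"
      using one_box_cols[OF pL pM] a by blast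
    thus "(\<exists>c\<ge>1. cols L = (cols M)(c := Suc (cols M c)) \<and> strip_ok k (cols M) c) \<and>
        ptype L + ptype M \<noteq> 3"
      using a horiz_strip_one_box[OF k kL kM c] by (auto simp: typed_horiz_strip_def cols_def)
  next
    assume a: "(\<exists>c\<ge>1. cols L = (cols M)(c := Suc (cols M c)) \<and> strip_ok k (cols M) c) \<and>
        ptype L + ptype M \<noteq> 3"
    then obtain c where c: "1 \<le> c"
      "col_len (shape L) = (col_len (shape M))(c := Suc (col_len (shape M) c))"
      "strip_ok k (col_len (shape M)) c" by (auto simp: cols_def)
    hence "horiz_strip_k k (shape L) (shape M)" using horiz_strip_one_box[OF k kL kM c(1,2)] by simp
    moreover have "psize L = Suc (psize M)"
      using cols_size_add_box[OF strict_cols_col_len[OF kM], of c] c(2)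
      by (simp add: sum_list_eq_cols_size[OF kL] sum_list_eq_cols_size[OF kM])
    ultimately show "typed_horiz_strip k L M \<and> psize L = Suc (psize M)"
      using a L M by (simp add: typed_horiz_strip_def)
  qed
qed

section \<open>The elements of the typed partitions\<close>

text \<open>
The entries after the end of the list are fixed points, so they continue the increasing order.
\<close>

lemma one_line_grassmannian:
  assumes len: "length ys = k" and ys: "sorted_wrt (\<lambda>a b. \<bar>a\<bar> < b) ys"
    and zs: "sorted_wrt (<) zs" and le: "\<forall>z\<in>set zs. z \<le> int (length (ys @ zs))"
  shows "grassmannian k (one_line (ys @ zs))"
    and "one_line (ys @ zs) ` tail k = set zs \<union> {int (length (ys @ zs))<..}"
proof -
  let ?m = "length (ys @ zs)" let ?f = "one_line (ys @ zs)"
  have f1: "?f j = ys ! nat (j - 1)" if "1 \<le> j" "j \<le> int k" for j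
    using that len by (auto simp: one_line_def nth_append)
  have f2: "?f j = zs ! (nat (j - 1) - k)" if "int k < j" "j \<le> int ?m" for j
    using that len by (auto simp: one_line_def nth_append)
  have f3: "?f j = j" if "int ?m < j" for j using that by (simp add: one_line_def)
  have "?f j < ?f j'" if "int k < j" "j < j'" for j j'
  proof (cases "j' \<le> int ?m")
    case True
    have "zs ! (nat (j - 1) - k) < zs ! (nat (j' - 1) - k)"
      by (rule sorted_wrt_nth_less[OF zs]) (use that True len in auto)
    thus ?thesis using that True f2[of j] f2[of j'] by simp
  next
    case False
    show ?thesis
    proof (cases "j \<le> int ?m")
      case True
      have "zs ! (nat (j - 1) - k) \<in> set zs" by (rule nth_mem) (use that True len in auto)
      hence "zs ! (nat (j - 1) - k) \<le> int ?m" using le by blast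
      thus ?thesis using False f2[OF that(1) True] f3[of j'] by simp
    next
      case False thus ?thesis using that f3[of j] f3[of j'] by simp
    qed
  qed
  moreover have "\<bar>?f j\<bar> < ?f j'" if "1 \<le> j" "j < j'" "j' \<le> int k" for j j'
  proof -
    have "\<bar>ys ! nat (j - 1)\<bar> < ys ! nat (j' - 1)"
      by (rule sorted_wrt_nth_less[OF ys]) (use that len in auto)
    thus ?thesis using that f1[of j] f1[of j'] by simp
  qed
  ultimately show "grassmannian k ?f" by (simp add: grassmannian_def)
  show "?f ` tail k = set zs \<union> {int ?m<..}"
  proof (intro equalityI subsetI)
    fix v assume "v \<in> ?f ` tail k"
    then obtain j where j: "int k < j" "v = ?f j" by (auto simp: tail_def)
    show "v \<in> set zs \<union> {int ?m<..}"
    proof (cases "j \<le> int ?m")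
      case True
      have "zs ! (nat (j - 1) - k) \<in> set zs" by (rule nth_mem) (use j True len in auto)
      thus ?thesis using f2[OF j(1) True] j by simp
    qed (use j f3[of j] in auto)
  next
    fix v assume "v \<in> set zs \<union> {int ?m<..}"
    thus "v \<in> ?f ` tail k"
    proof
      assume "v \<in> set zs"
      then obtain l where l: "l < length zs" "zs ! l = v" by (auto simp: in_set_conv_nth)
      have "?f (int (k + l + 1)) = v" using f2[of "int (k + l + 1)"] l len
        by (simp add: nat_add_distrib)
      moreover have "int (k + l + 1) \<in> tail k" by (simp add: tail_def)
      ultimately show ?thesis by blast
    next
      assume "v \<in> {int ?m<..}"
      thus ?thesis using f3[of v] len by (intro image_eqI[of _ _ v]) (auto simp: tail_def)
    qed
  qed
qed

text \<open>
A box of the diagonal \<open>d\<close> in column \<open>k + y + 1\<close> is outside the diagram if and only if it is below the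
bottom box of its column.
\<close>

lemma diag_len_eq:
  assumes "is_partition lam" shows "diag_len k lam d = card {y. bdiag k (col_len lam) y < d}"
proof -
  let ?box = "\<lambda>y. (d - y, k + y + 1)"
  have "{(a, c). 1 \<le> a \<and> k < c \<and> a + c = k + d + 1 \<and> (a, c) \<notin> diagram lam}
      = ?box ` {y. bdiag k (col_len lam) y < d}" (is "?L = ?R")
  proof (intro equalityI subsetI)
    fix b assume "b \<in> ?L"
    then obtain a c where ac: "b = (a, c)" "1 \<le> a" "k < c" "a + c = k + d + 1" "(a, c) \<notin> diagram lam"
      by auto
    have "b = ?box (c - k - 1)" using ac by auto
    moreover have "col_len lam c < a" using ac by (simp add: in_diagram_iff[OF assms])
    hence "bdiag k (col_len lam) (c - k - 1) < d" using ac by (simp add: bdiag_def)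
    ultimately show "b \<in> ?R" by blast
  next
    fix b assume "b \<in> ?R"
    thus "b \<in> ?L" by (auto simp: in_diagram_iff[OF assms] bdiag_def)
  qed
  moreover have "inj_on ?box {y. bdiag k (col_len lam) y < d}" by (auto simp: inj_on_def)
  ultimately show ?thesis by (simp add: diag_len_def card_image)
qed

lemma diag_len_bdiag:
  assumes "k_strict k lam" "x \<notin> long_parts k (col_len lam)"
  shows "diag_len k lam (bdiag k (col_len lam) x) = x"
proof -
  note sC = strict_cols_col_len[OF assms(1)]
  have "bdiag k (col_len lam) y < bdiag k (col_len lam) x \<longleftrightarrow> y < x" for y
    using bdiag_less[OF sC _ assms(2), of y] bdiag_mono[OF sC, of x y] by (meson not_le)
  thus ?thesis using assms(1) by (simp add: diag_len_eq k_strict_def)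
qed

lemma diag_len_0:
  assumes "k_strict k lam" "d \<le> bdiag k (col_len lam) 0" shows "diag_len k lam d = 0"
proof -
  note sC = strict_cols_col_len[OF assms(1)]
  have "\<not> bdiag k (col_len lam) y < d" for y using bdiag_mono[OF sC, of 0 y] assms(2) by simp
  thus ?thesis using assms(1) by (simp add: diag_len_eq k_strict_def)
qed

text \<open>
Diagonals up to \<open>n\<close> exhaust the related ones because the first column has at most \<open>n + 1 - k\<close> boxes.  All
numbers above \<open>n\<close> are lengths of non-related diagonals because no part exceeds \<open>n + k\<close>; this makes the
result independent of \<open>n\<close>.
\<close>

lemma w_elt_lists:
  assumes k: "1 \<le> k" "k \<le> n" and L: "L \<in> typed_partitions k n"
  defines "C \<equiv> cols L" and "lam \<equiv> shape L"
  shows "u_list k n lam = sorted_list_of_set (Us k C)"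
    and "v_list k n lam = sorted_list_of_set (Vs k C \<inter> {1..n})"
    and "finite (Us k C)" and "card (Us k C) = k"
    and "card (long_parts k C) + card (Vs k C \<inter> {0..n}) + k = n + 1"
    and "\<And>x. n < x \<Longrightarrow> x \<in> Vs k C"
    and "set (map (\<lambda>x. - (int (x - k) + 1)) (filter (\<lambda>x. k < x) lam)) = (\<lambda>p. - (int p + 1)) ` long_parts k C"
    and "length (filter (\<lambda>x. k < x) lam) = card (long_parts k C)"
    and "sorted_wrt (<) (map (\<lambda>x. - (int (x - k) + 1)) (filter (\<lambda>x. k < x) lam))"
proof -
  have tL: "typed_k_strict k L" and len: "length lam \<le> n + 1 - k" and parts: "\<forall>x\<in>set lam. x \<le> n + k"
    using L by (auto simp: typed_partitions_def lam_def)
  have kl: "k_strict k lam" using tL by (simp add: typed_k_strict_def lam_def)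
  have C: "C = col_len lam" by (simp add: C_def cols_def lam_def)
  have sC: "strict_cols k C" unfolding C by (rule strict_cols_col_len[OF kl])
  have part: "is_partition lam" using kl by (simp add: k_strict_def)
  have rel_le: "d \<le> n" if d: "d \<in> related k C" for d
  proof -
    obtain i where "1 \<le> i" "i \<le> k" "d = col_len lam i + k - i"
      using d by (auto simp: related_def C)
    thus ?thesis using col_len_le_length[OF part, of i] len k by linarith
  qed
  have big: "C i = 0" if "n + k < i" for i
  proof (rule ccontr)
    assume "C i \<noteq> 0"
    hence "(1, i) \<in> diagram lam" using that by (simp add: in_diagram_iff[OF part] C)
    hence "lam ! 0 \<in> set lam" "i \<le> lam ! 0" by (auto simp: diagram_def intro: nth_mem)
    thus False using parts that by fastforce
  qed
  have rel: "diag_related k lam d \<longleftrightarrow> d \<in> related k C" for d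
    by (auto simp: diag_related_def related_def C)
  have dl: "diag_len k lam (bdiag k C x) = x" if "x \<notin> long_parts k C" for x
    using diag_len_bdiag[OF kl] that by (simp add: C)
  have Us_le: "x \<le> n" if "x \<in> Us k C" for x
    using that rel_le[of "bdiag k C x"] by (simp add: Us_def bdiag_def)
  have P_le: "x \<in> {1..n}" if "x \<in> long_parts k C" for x
    using that big[of "k + x"] by (cases "x \<le> n") (auto simp: long_parts_def)
  show V_big: "x \<in> Vs k C" if "n < x" for x
    using that P_le[of x] Us_le[of x] by (auto simp: Us_def Vs_def)
  have "{d \<in> {0..n}. diag_related k lam d} = related k C" using rel rel_le by auto
  also have "\<dots> = bdiag k C ` Us k C" by (rule related_eq_bdiag_image[OF sC k(1)])
  finally have "diag_len k lam ` {d \<in> {0..n}. diag_related k lam d} = (\<lambda>x. diag_len k lam (bdiag k C x)) ` Us k C"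
    by (simp add: image_comp comp_def)
  also have "\<dots> = Us k C" using dl by (force simp: Us_def)
  finally show "u_list k n lam = sorted_list_of_set (Us k C)" by (simp add: u_list_def)
  have "diag_len k lam ` {d \<in> {0..n}. \<not> diag_related k lam d} - {0} = Vs k C \<inter> {1..n}"
  proof (intro equalityI subsetI)
    fix x assume x: "x \<in> diag_len k lam ` {d \<in> {0..n}. \<not> diag_related k lam d} - {0}"
    then obtain d where d: "d \<le> n" "d \<notin> related k C" "x = diag_len k lam d" "x \<noteq> 0"
      using rel by auto
    have "bdiag k C 0 \<le> d" using diag_len_0[OF kl, of d] d C by (metis nat_le_linear)
    then obtain y where y: "y \<notin> long_parts k C" "bdiag k C y = d" using bdiag_surj[OF sC] by blast
    have "x = y" using dl[OF y(1)] y(2) d(3) by simp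
    moreover have "y \<le> d" using y by (simp add: bdiag_def)
    ultimately show "x \<in> Vs k C \<inter> {1..n}" using y d by (auto simp: Vs_def)
  next
    fix x assume x: "x \<in> Vs k C \<inter> {1..n}"
    have "bdiag k C x \<le> bdiag k C n" using x by (intro bdiag_mono[OF sC]) auto
    also have "bdiag k C n = n" using big[of "k + n + 1"] by (simp add: bdiag_def)
    finally have "bdiag k C x \<le> n" .
    moreover have "\<not> diag_related k lam (bdiag k C x)" using x by (simp add: rel Vs_def)
    moreover have "x = diag_len k lam (bdiag k C x)" using dl x by (simp add: Vs_def)
    ultimately show "x \<in> diag_len k lam ` {d \<in> {0..n}. \<not> diag_related k lam d} - {0}"
      using x by auto
  qed
  thus "v_list k n lam = sorted_list_of_set (Vs k C \<inter> {1..n})" by (simp add: v_list_def)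
  show finU: "finite (Us k C)" using Us_le by (meson finite_nat_set_iff_bounded_le)
  have "card (related k C) = k"
    unfolding related_def by (subst card_image) (auto intro!: inj_onI related_inj[OF sC])
  moreover have "inj_on (bdiag k C) (Us k C)"
    using bdiag_inj[OF sC] by (auto simp: inj_on_def Us_def)
  ultimately show cU: "card (Us k C) = k"
    by (simp add: related_eq_bdiag_image[OF sC k(1)] card_image)
  have "{0..n} = long_parts k C \<union> (Vs k C \<inter> {0..n}) \<union> Us k C"
  proof (rule set_eqI)
    fix x show "x \<in> {0..n} \<longleftrightarrow> x \<in> long_parts k C \<union> (Vs k C \<inter> {0..n}) \<union> Us k C"
      using P_le[of x] Us_le[of x] by (auto simp: Us_def Vs_def)
  qed
  moreover have "card (long_parts k C \<union> (Vs k C \<inter> {0..n}) \<union> Us k C) =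
      card (long_parts k C) + card (Vs k C \<inter> {0..n}) + card (Us k C)"
    using finite_long_parts[OF sC] finU
    by (subst card_Un_disjoint, auto simp: Us_def Vs_def)+
  ultimately show "card (long_parts k C) + card (Vs k C \<inter> {0..n}) + k = n + 1"
    using cU by (metis card_atLeastAtMost diff_zero Suc_eq_plus1)
  let ?F = "filter (\<lambda>x. k < x) lam"
  have memF: "x \<in> set ?F \<longleftrightarrow> k < x \<and> x - k \<in> long_parts k C" for x
    using mem_partition_iff[OF part, of x] by (auto simp: long_parts_def C)
  have setF: "set ?F = (\<lambda>p. k + p) ` long_parts k C"
  proof (intro equalityI subsetI)
    fix x assume "x \<in> set ?F"
    hence "k < x" "x - k \<in> long_parts k C" using memF by auto
    thus "x \<in> (\<lambda>p. k + p) ` long_parts k C" by (intro image_eqI[of _ _ "x - k"]) auto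
  next
    fix x assume "x \<in> (\<lambda>p. k + p) ` long_parts k C"
    then obtain p where p: "p \<in> long_parts k C" "x = k + p" by blast
    hence "1 \<le> p" by (simp add: long_parts_def)
    thus "x \<in> set ?F" unfolding memF using p by simp
  qed
  show "set (map (\<lambda>x. - (int (x - k) + 1)) ?F) = (\<lambda>p. - (int p + 1)) ` long_parts k C"
    unfolding set_map setF image_image by simp
  have dF: "distinct ?F" using kl by (simp add: k_strict_def)
  show "length ?F = card (long_parts k C)"
    using distinct_card[OF dF] setF by (simp add: card_image)
  have "sorted_wrt (\<ge>) ?F" using part by (simp add: is_partition_def sorted_wrt_filter)
  hence "?F ! j < ?F ! i" if "i < j" "j < length ?F" for i j
    using sorted_wrt_nth_less[of "(\<ge>)" ?F i j] nth_eq_iff_index_eq[OF dF, of i j] that by simp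
  hence "sorted_wrt (>) ?F" unfolding sorted_wrt_iff_nth_less by blast
  thus "sorted_wrt (<) (map (\<lambda>x. - (int (x - k) + 1)) ?F)"
    unfolding sorted_wrt_map by (rule sorted_wrt_mono_rel[rotated]) auto
qed

lemma sorted_wrt_abs_less:
  assumes "sorted_wrt (<) (xs :: nat list)"
  shows "sorted_wrt (\<lambda>a b. \<bar>a\<bar> < b) (map (\<lambda>x. int x + 1) xs)"
  unfolding sorted_wrt_map by (rule sorted_wrt_mono_rel[OF _ assms]) auto

text \<open>
For type 0 the entry \<open>\<plusminus>1\<close> opens the first block, since the number 0 belongs to a related diagonal;
otherwise it separates the barred from the unbarred entries of the second block.
\<close>

lemma w_elt_grassmannian:
  assumes k: "1 \<le> k" "k \<le> n" and L: "L \<in> typed_partitions k n"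
  shows "grassmannian k (w_elt k n L)" "w_elt k n L ` tail k = tail_entries k (cols L) (ptype L)"
proof -
  define C where "C = cols L"
  define t where "t = ptype L"
  note W = w_elt_lists[OF k L, folded C_def]
  have tL: "typed_k_strict k L" using L by (simp add: typed_partitions_def)
  hence tC: "typed_cols k C t" using typed_k_strict_cols[OF k(1)] by (simp add: C_def t_def)
  hence sC: "strict_cols k C" by (simp add: typed_cols_def)
  define us where "us = map (\<lambda>x. int x + 1) (sorted_list_of_set (Us k C))"
  define vs where "vs = map (\<lambda>x. int x + 1) (sorted_list_of_set (Vs k C \<inter> {1..n}))"
  define bs where "bs = map (\<lambda>x. - (int (x - k) + 1)) (filter (\<lambda>x. k < x) (shape L))"
  define sg where "sg = (\<lambda>xs :: int list. if even (length (filter (\<lambda>x. x < 0) xs)) then 1 else - 1 :: int)"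
  have wl: "w_one_line k n L = (if t = 0 then sg (tl us @ bs @ vs) # tl us @ bs @ vs
      else (if t = 2 then - hd us # tl us else us) @ bs @
        [sg ((if t = 2 then - hd us # tl us else us) @ bs @ vs)] @ vs)"
    unfolding w_one_line_def Let_def W(1,2) us_def[symmetric] vs_def[symmetric] bs_def[symmetric]
      t_def[symmetric] sg_def by simp
  have zero: "0 \<in> Us k C \<longleftrightarrow> t = 0" using zero_in_Us_iff[OF sC k(1)] tC by (auto simp: typed_cols_def)
  have lus: "length us = k" using W(4) by (simp add: us_def)
  then obtain u0 ur where us: "us = u0 # ur" using k by (cases us) auto
  have us_abs: "sorted_wrt (\<lambda>a b. \<bar>a\<bar> < b) us"
    unfolding us_def by (rule sorted_wrt_abs_less) (rule strict_sorted_list_of_set)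
  have us_set: "set us = (\<lambda>x. int x + 1) ` Us k C" using W(3) by (simp add: us_def)
  have us_pos: "0 < x" if "x \<in> set us" for x using that us_set by auto
  have bs_set: "set bs = (\<lambda>p. - (int p + 1)) ` long_parts k C" unfolding bs_def by (rule W(7))
  have bs_neg: "x < - 1" if "x \<in> set bs" for x using that bs_set by (auto simp: long_parts_def)
  have lbs: "length bs = card (long_parts k C)" unfolding bs_def length_map by (rule W(8))
  have bs_sorted: "sorted_wrt (<) bs" unfolding bs_def by (rule W(9))
  have vs_set: "set vs = (\<lambda>x. int x + 1) ` (Vs k C \<inter> {1..n})" by (simp add: vs_def)
  have vs_gt: "1 < x \<and> x \<le> int n + 1" if "x \<in> set vs" for x using that vs_set by auto
  have vs_sorted: "sorted_wrt (<) vs"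
    unfolding vs_def sorted_wrt_map by (rule sorted_wrt_mono_rel[OF _ strict_sorted_list_of_set]) auto
  have lvs: "length vs = card (Vs k C \<inter> {1..n})" by (simp add: vs_def)
  have count: "length bs + length vs + of_bool (t \<noteq> 0) + k = n + 1"
  proof -
    have "Vs k C \<inter> {0..n} = (Vs k C \<inter> {1..n}) \<union> (if t = 0 then {} else {0})"
    proof (rule set_eqI)
      fix x show "x \<in> Vs k C \<inter> {0..n} \<longleftrightarrow> x \<in> (Vs k C \<inter> {1..n}) \<union> (if t = 0 then {} else {0})"
        using zero by (cases x) (auto simp: Us_def Vs_def)
    qed
    hence "card (Vs k C \<inter> {0..n}) = length vs + of_bool (t \<noteq> 0)"
      by (auto simp: lvs card_insert_if)
    thus ?thesis using W(5) lbs by simp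
  qed
  have neg_bs: "filter (\<lambda>x. x < 0) bs = bs" using bs_neg by (fastforce intro: filter_True)
  have neg_vs: "filter (\<lambda>x. x < 0) vs = []" using vs_gt by (fastforce intro: filter_False)
  have neg_us: "filter (\<lambda>x. x < 0) us = []" using us_pos by (fastforce intro: filter_False)
  have tail_entries_eq: "set bs \<union> set vs \<union> (if t = 0 then {} else {unit_sign k C t}) \<union> {int n + 1<..} = tail_entries k C t"
    (is "?S = _")
  proof (rule set_eqI)
    fix v show "v \<in> ?S \<longleftrightarrow> v \<in> tail_entries k C t"
    proof (cases v rule: int_cases_unit)
      case (4 x)
      thus ?thesis using in_tail_entries(1)[OF 4(1), of k C t] bs_neg[of v] vs_set W(6)[of x] unit_sign_cases[of k C t]
        by (cases "x \<le> n") (auto simp: image_iff)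
    next
      case (5 x)
      thus ?thesis using in_tail_entries(2)[OF 5(1), of k C t] vs_gt[of v] bs_set unit_sign_cases[of k C t]
        by (auto simp: image_iff)
    qed (use in_tail_entries(3-5)[of k C t] bs_neg[of v] vs_gt[of v] unit_sign_cases[of k C t] in auto)
  qed
  have "\<exists>ys zs. w_one_line k n L = ys @ zs \<and> length ys = k \<and> sorted_wrt (\<lambda>a b. \<bar>a\<bar> < b) ys \<and>
      sorted_wrt (<) zs \<and> (\<forall>z\<in>set zs. z \<le> int n + 1) \<and> length (ys @ zs) = n + 1 \<and>
      set zs = set bs \<union> set vs \<union> (if t = 0 then {} else {unit_sign k C t})"
  proof (cases "t = 0")
    case True
    let ?ys = "sg (tl us @ bs @ vs) # tl us" and ?zs = "bs @ vs"
    have one: "1 < x" if "x \<in> set (tl us)" for x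
    proof -
      have "\<bar>u0\<bar> < x" "0 < u0" using us_abs us_pos that by (auto simp: us)
      thus ?thesis by simp
    qed
    have "sorted_wrt (\<lambda>a b. \<bar>a\<bar> < b) ?ys" using one us_abs by (auto simp: us sg_def)
    moreover have "sorted_wrt (<) ?zs" using bs_sorted vs_sorted bs_neg vs_gt
      by (fastforce simp: sorted_wrt_append)
    moreover have "length (?ys @ ?zs) = n + 1" using count True lus k by (simp add: us)
    moreover have "\<forall>z\<in>set ?zs. z \<le> int n + 1" using bs_neg vs_gt by fastforce
    moreover have "w_one_line k n L = ?ys @ ?zs" using wl True by simp
    moreover have "length ?ys = k" using lus by (simp add: us)
    moreover have "set ?zs = set bs \<union> set vs \<union> (if t = 0 then {} else {unit_sign k C t})"
      using True by simp
    ultimately show ?thesis by blast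
  next
    case False
    let ?ys = "if t = 2 then - hd us # tl us else us"
    have sg: "sg (?ys @ bs @ vs) = unit_sign k C t"
    proof -
      have "length (filter (\<lambda>x. x < 0) ?ys) = of_bool (t = 2)"
        using neg_us us_pos[of u0] by (auto simp: us split: if_splits)
      thus ?thesis by (simp add: sg_def neg_bs neg_vs lbs unit_sign_def add.commute)
    qed
    let ?zs = "bs @ [unit_sign k C t] @ vs"
    have "sorted_wrt (\<lambda>a b. \<bar>a\<bar> < b) ?ys" using us_abs by (auto simp: us)
    moreover have "sorted_wrt (<) ?zs"
      using bs_sorted vs_sorted bs_neg vs_gt unit_sign_cases[of k C t]
      by (fastforce simp: sorted_wrt_append)
    moreover have "length (?ys @ ?zs) = n + 1" using count False lus by (auto simp: us)
    moreover have "\<forall>z\<in>set ?zs. z \<le> int n + 1" using bs_neg vs_gt unit_sign_cases[of k C t] by fastforce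
    moreover have "w_one_line k n L = ?ys @ ?zs" using wl False sg by simp
    moreover have "length ?ys = k" using lus by (simp add: us)
    moreover have "set ?zs = set bs \<union> set vs \<union> (if t = 0 then {} else {unit_sign k C t})"
      using False by auto
    ultimately show ?thesis by blast
  qed
  then obtain ys zs where yz: "w_one_line k n L = ys @ zs" "length ys = k"
    "sorted_wrt (\<lambda>a b. \<bar>a\<bar> < b) ys" "sorted_wrt (<) zs" "\<forall>z\<in>set zs. z \<le> int n + 1"
    "length (ys @ zs) = n + 1" "set zs = set bs \<union> set vs \<union> (if t = 0 then {} else {unit_sign k C t})"
    by blast
  have "\<forall>z\<in>set zs. z \<le> int (length (ys @ zs))" using yz(5) unfolding yz(6) by (simp add: add.commute)
  note G = one_line_grassmannian[OF yz(2-4) this]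
  show "grassmannian k (w_elt k n L)" unfolding w_elt_def yz(1) by (rule G(1))
  show "w_elt k n L ` tail k = tail_entries k (cols L) (ptype L)"
    unfolding w_elt_def yz(1) G(2) yz(6,7) C_def[symmetric] t_def[symmetric] tail_entries_eq[symmetric]
    by (simp add: add.commute)
qed

lemma word_step:
  "word_prod (i # a) ` A = gen i ` (word_prod a ` A)"
  unfolding word_prod_Cons image_comp ..

section \<open>Words and chains of partitions\<close>

text \<open>
Growth at the largest possible rate.  By \<open>ascending_Cons\<close> this says that every letter, applied from the
right, is an ascent.
\<close>

definition ascending :: "int set \<Rightarrow> nat list \<Rightarrow> bool" where
  "ascending A a \<longleftrightarrow> card (inversions (word_prod a ` A)) = card (inversions A) + 2 * length a"

lemma ascending_Nil [simp]: "ascending A []"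
  by (simp add: ascending_def)

lemma ascending_Cons:
  assumes A: "tail_set A"
  shows "ascending A (i # a) \<longleftrightarrow> ascending A a \<and> ascent (word_prod a ` A) i"
proof -
  let ?B = "word_prod a ` A"
  have B: "tail_set ?B" by (rule tail_set_word[OF A])
  have le: "card (inversions ?B) \<le> card (inversions A) + 2 * length a"
    by (rule card_inversions_word[OF A])
  show ?thesis
  proof
    assume "ascending A (i # a)"
    hence eq: "card (inversions (gen i ` ?B)) = card (inversions A) + 2 * length a + 2"
      unfolding ascending_def word_step by simp
    hence "card (inversions ?B) = card (inversions A) + 2 * length a"
      using le card_inversions_gen(1)[OF B, of i] by linarith
    thus "ascending A a \<and> ascent ?B i"
      using eq card_inversions_gen(2)[OF B, of i] by (simp add: ascending_def)
  next
    assume a: "ascending A a \<and> ascent ?B i"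
    thus "ascending A (i # a)"
      using card_inversions_ascent[OF B, of i] unfolding ascending_def word_step by simp
  qed
qed

lemma grassmannian_ascending:
  assumes "grassmannian k (word_prod c)" "ascending (word_prod c ` tail k) a"
  shows "grassmannian k (word_prod (a @ c))"
  using assms(2)
proof (induction a)
  case (Cons i a)
  have ts: "tail_set (word_prod c ` tail k)" by (intro tail_set_word tail_set_tail)
  have up: "ascending (word_prod c ` tail k) a" "ascent (word_prod a ` word_prod c ` tail k) i"
    using Cons.prems ascending_Cons[OF ts] by auto
  have "grassmannian k (word_prod (a @ c))" by (rule Cons.IH[OF up(1)])
  moreover have "word_prod a ` word_prod c ` tail k = word_prod (a @ c) ` tail k"
    by (simp only: word_prod_append image_comp)
  moreover have "tail_set (word_prod (a @ c) ` tail k)" by (intro tail_set_word tail_set_tail)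
  ultimately have "grassmannian k (gen i \<circ> word_prod (a @ c))"
    using up(2) ascent_changes by (metis grassmannian_gen)
  thus ?case unfolding append_Cons word_prod_Cons .
qed (use assms(1) in simp)

definition typed_tail :: "nat \<Rightarrow> typed_partition \<Rightarrow> int set" where
  "typed_tail k L = tail_entries k (cols L) (ptype L)"

definition box_step :: "nat \<Rightarrow> typed_partition \<Rightarrow> typed_partition \<Rightarrow> bool" where
  "box_step k L M \<longleftrightarrow> typed_horiz_strip k L M \<and> psize L = Suc (psize M)"

lemma box_step_typed: "box_step k L M \<Longrightarrow> typed_k_strict k L \<and> typed_k_strict k M"
  by (simp add: box_step_def typed_horiz_strip_def)

lemma tail_set_typed_tail: "1 \<le> k \<Longrightarrow> typed_k_strict k L \<Longrightarrow> tail_set (typed_tail k L)"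
  by (auto simp: typed_tail_def typed_k_strict_cols typed_cols_def intro: tail_set_tail_entries)

lemma typed_tail_inject:
  assumes "1 \<le> k" "typed_k_strict k L" "typed_k_strict k M" "typed_tail k L = typed_tail k M"
  shows "L = M"
proof -
  have "cols L = cols M \<and> ptype L = ptype M"
    using tail_entries_inject[OF assms(1)] assms by (auto simp: typed_k_strict_cols typed_tail_def)
  moreover have "is_partition (shape L)" "is_partition (shape M)"
    using assms by (auto simp: typed_k_strict_def k_strict_def)
  ultimately show ?thesis using partition_eqI by (auto simp: cols_def prod_eq_iff)
qed

lemma card_inversions_typed_tail:
  assumes "1 \<le> k" "typed_k_strict k L" shows "card (inversions (typed_tail k L)) = 2 * psize L"
proof -
  have L: "k_strict k (shape L)" "typed_cols k (cols L) (ptype L)"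
    using assms by (auto simp: typed_k_strict_cols)
  show ?thesis using typed_cols_reachable[OF assms(1) L(2)] sum_list_eq_cols_size[OF L(1)]
    by (auto simp: typed_tail_def cols_def)
qed

lemma box_step_ascent:
  assumes k: "1 \<le> k" and step: "box_step k L M"
  shows "\<exists>i. ascent (typed_tail k M) i \<and> typed_tail k L = gen i ` typed_tail k M"
proof -
  have typed: "typed_k_strict k L" "typed_k_strict k M" using box_step_typed[OF step] by auto
  obtain c where c: "1 \<le> c" "cols L = (cols M)(c := Suc (cols M c))" "strip_ok k (cols M) c"
    "ptype L + ptype M \<noteq> 3"
    using typed_horiz_strip_one_box_iff[OF k typed] step unfolding box_step_def by blast
  have "typed_cols k (cols M) (ptype M)" "typed_cols k ((cols M)(c := Suc (cols M c))) (ptype L)"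
    using typed typed_k_strict_cols[OF k] c(2) by auto
  from strip_ok_ascent[OF k this _ c(1,3)] c(4) show ?thesis
    unfolding typed_tail_def c(2) by (simp add: add.commute)
qed

lemma ascent_box_step:
  assumes k: "1 \<le> k" and M: "typed_k_strict k M" and up: "ascent (typed_tail k M) i"
  shows "\<exists>L. box_step k L M \<and> typed_tail k L = gen i ` typed_tail k M"
proof -
  have tM: "typed_cols k (cols M) (ptype M)" using M typed_k_strict_cols[OF k] by simp
  obtain c t' where c: "1 \<le> c" "typed_cols k ((cols M)(c := Suc (cols M c))) t'" "ptype M + t' \<noteq> 3"
    "strip_ok k (cols M) c" "tail_entries k ((cols M)(c := Suc (cols M c))) t' = gen i ` tail_entries k (cols M) (ptype M)"
    using ascent_strip_ok[OF k tM] up unfolding typed_tail_def by metis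
  obtain lam where lam: "k_strict k lam" "col_len lam = (cols M)(c := Suc (cols M c))"
    using partition_of_cols c(2) by (metis typed_cols_def)
  define L where "L = (lam, t')"
  have cL: "cols L = (cols M)(c := Suc (cols M c))" by (simp add: cols_def L_def lam)
  have L: "typed_k_strict k L" using lam(1) c(2) cL by (simp add: typed_k_strict_cols[OF k] L_def)
  have "box_step k L M"
    using typed_horiz_strip_one_box_iff[OF k L M] c cL unfolding box_step_def
    by (auto simp: L_def add.commute)
  moreover have "typed_tail k L = gen i ` typed_tail k M" using c(5) cL by (simp add: typed_tail_def L_def)
  ultimately show ?thesis by blast
qed

text \<open>
The word \<open>a\<close> leads through the chain \<open>Ls\<close>.  As the first letter of a word acts last, the chain is listed
from its largest member to its smallest.
\<close>

fun spells :: "nat \<Rightarrow> nat list \<Rightarrow> typed_partition list \<Rightarrow> bool" where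
  "spells k [] Ls \<longleftrightarrow> (\<exists>L. Ls = [L])"
| "spells k (i # a) Ls \<longleftrightarrow> (\<exists>L Ls'. Ls = L # Ls' \<and> spells k a Ls' \<and> box_step k L (hd Ls') \<and>
     typed_tail k L = gen i ` typed_tail k (hd Ls'))"

lemma spells_length: "spells k a Ls \<Longrightarrow> length Ls = Suc (length a)"
  by (induction a arbitrary: Ls) auto

lemma spells_facts:
  assumes k: "1 \<le> k"
  shows "spells k a Ls \<Longrightarrow> typed_k_strict k (last Ls) \<Longrightarrow>
    typed_k_strict k (hd Ls) \<and> typed_tail k (hd Ls) = word_prod a ` typed_tail k (last Ls) \<and>
    ascending (typed_tail k (last Ls)) a \<and> successively (box_step k) Ls"
proof (induction a arbitrary: Ls)
  case (Cons i a)
  obtain L Ls' where Ls: "Ls = L # Ls'" "spells k a Ls'" "box_step k L (hd Ls')"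
    "typed_tail k L = gen i ` typed_tail k (hd Ls')" using Cons.prems(1) by auto
  have ne: "Ls' \<noteq> []" using spells_length[OF Ls(2)] by auto
  hence last: "last Ls = last Ls'" by (simp add: Ls(1))
  have IH: "typed_k_strict k (hd Ls')" "typed_tail k (hd Ls') = word_prod a ` typed_tail k (last Ls')"
    "ascending (typed_tail k (last Ls')) a" "successively (box_step k) Ls'"
    using Cons.IH[OF Ls(2)] Cons.prems(2) last by auto
  have "typed_tail k L = word_prod (i # a) ` typed_tail k (last Ls')" unfolding word_step Ls(4) IH(2) ..
  moreover have "ascent (word_prod a ` typed_tail k (last Ls')) i"
  proof -
    have typed: "typed_k_strict k L" "typed_k_strict k (hd Ls')" using box_step_typed[OF Ls(3)] by auto
    have "card (inversions (gen i ` typed_tail k (hd Ls'))) = card (inversions (typed_tail k (hd Ls'))) + 2"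
      using Ls(3) card_inversions_typed_tail[OF k typed(1)] card_inversions_typed_tail[OF k typed(2)]
      by (simp add: box_step_def Ls(4)[symmetric])
    thus ?thesis using card_inversions_gen(2)[OF tail_set_typed_tail[OF k typed(2)]] IH(2) by simp
  qed
  ultimately show ?case
    using IH Ls box_step_typed[OF Ls(3)] ne last tail_set_typed_tail[OF k] Cons.prems(2)
    by (simp add: ascending_Cons successively_Cons)
qed auto

lemma spells_unique_chain:
  assumes k: "1 \<le> k"
  shows "spells k a Ls \<Longrightarrow> spells k a Ls' \<Longrightarrow> last Ls = last Ls' \<Longrightarrow>
    typed_k_strict k (last Ls) \<Longrightarrow> Ls = Ls'"
proof (induction a arbitrary: Ls Ls')
  case (Cons i a)
  obtain L Ms where L: "Ls = L # Ms" "spells k a Ms" "box_step k L (hd Ms)" "typed_tail k L = gen i ` typed_tail k (hd Ms)"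
    using Cons.prems(1) by auto
  obtain L' Ms' where L': "Ls' = L' # Ms'" "spells k a Ms'" "box_step k L' (hd Ms')" "typed_tail k L' = gen i ` typed_tail k (hd Ms')"
    using Cons.prems(2) by auto
  have "Ms \<noteq> []" "Ms' \<noteq> []" using spells_length[OF L(2)] spells_length[OF L'(2)] by auto
  hence "Ms = Ms'" using Cons.IH[OF L(2) L'(2)] Cons.prems(3,4) L(1) L'(1) by simp
  moreover have "L = L'"
    using typed_tail_inject[OF k] box_step_typed[OF L(3)] box_step_typed[OF L'(3)] L(4) L'(4) \<open>Ms = Ms'\<close>
    by simp
  ultimately show ?case by (simp add: L L')
qed auto

lemma ascending_spells:
  assumes k: "1 \<le> k" and M: "typed_k_strict k M"
  shows "ascending (typed_tail k M) a \<Longrightarrow> \<exists>Ls. spells k a Ls \<and> last Ls = M"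
proof (induction a)
  case (Cons i a)
  have up: "ascending (typed_tail k M) a" "ascent (word_prod a ` typed_tail k M) i"
    using Cons.prems ascending_Cons[OF tail_set_typed_tail[OF k M]] by auto
  obtain Ls where Ls: "spells k a Ls" "last Ls = M" using Cons.IH[OF up(1)] by blast
  have f: "typed_k_strict k (hd Ls)" "typed_tail k (hd Ls) = word_prod a ` typed_tail k M"
    using spells_facts[OF k Ls(1)] M Ls(2) by auto
  obtain L where "box_step k L (hd Ls)" "typed_tail k L = gen i ` typed_tail k (hd Ls)"
    using ascent_box_step[OF k f(1)] up(2) unfolding f(2) by blast
  hence "spells k (i # a) (L # Ls)" using Ls(1) by auto
  moreover have "last (L # Ls) = M" using Ls spells_length[OF Ls(1)] by auto
  ultimately show ?case by blast
next
  case Nil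
  have "spells k [] [M] \<and> last [M] = M" by simp
  thus ?case by blast
qed

lemma chain_spelled:
  assumes k: "1 \<le> k"
  shows "Ls \<noteq> [] \<Longrightarrow> successively (box_step k) Ls \<Longrightarrow> \<exists>a. spells k a Ls"
proof (induction Ls)
  case (Cons L Ls)
  show ?case
  proof (cases "Ls = []")
    case True
    hence "spells k [] (L # Ls)" by simp
    thus ?thesis by blast
  next
    case False
    have step: "box_step k L (hd Ls)" and "successively (box_step k) Ls"
      using Cons.prems(2) False by (auto simp: successively_Cons)
    then obtain a where "spells k a Ls" using Cons.IH[OF False] by blast
    moreover obtain i where "typed_tail k L = gen i ` typed_tail k (hd Ls)"
      using box_step_ascent[OF k step] by blast
    ultimately have "spells k (i # a) (L # Ls)" using step by auto
    thus ?thesis by blast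
  qed
qed simp

lemma spells_unique_word:
  assumes k: "1 \<le> k"
  shows "spells k a Ls \<Longrightarrow> spells k a' Ls \<Longrightarrow> typed_k_strict k (last Ls) \<Longrightarrow> a = a'"
proof (induction a arbitrary: a' Ls)
  case Nil thus ?case using spells_length[OF Nil(1)] spells_length[OF Nil(2)] by simp
next
  case (Cons i a)
  have "length a' = Suc (length a)" using spells_length[OF Cons.prems(1)] spells_length[OF Cons.prems(2)] by simp
  then obtain i' b where a': "a' = i' # b" by (cases a') auto
  obtain L Ms where L: "Ls = L # Ms" "spells k a Ms" "typed_tail k L = gen i ` typed_tail k (hd Ms)"
    using Cons.prems(1) by auto
  have L': "spells k b Ms" "typed_tail k L = gen i' ` typed_tail k (hd Ms)"
    using Cons.prems(2) L(1) a' by auto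
  have ne: "Ms \<noteq> []" using spells_length[OF L(2)] by auto
  hence typed: "typed_k_strict k (last Ms)" using Cons.prems(3) L(1) by simp
  note ts = tail_set_typed_tail[OF k typed]
  have "typed_tail k (hd Ms) = word_prod a ` typed_tail k (last Ms)" "typed_tail k (hd Ms) = word_prod b ` typed_tail k (last Ms)"
    using spells_facts[OF k L(2) typed] spells_facts[OF k L'(1) typed] by auto
  moreover have "ascent (word_prod a ` typed_tail k (last Ms)) i" "ascent (word_prod b ` typed_tail k (last Ms)) i'"
    using spells_facts[OF k Cons.prems(1,3)] spells_facts[OF k Cons.prems(2,3)] L(1) ne a' ascending_Cons[OF ts]
    by auto
  moreover have "tail_set (typed_tail k (hd Ms))" using spells_facts[OF k L(2) typed] tail_set_typed_tail[OF k] by blast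
  ultimately have "i = i'" using ascent_unique L(3) L'(2) by metis
  moreover have "a = b" by (rule Cons.IH[OF L(2) L'(1) typed])
  ultimately show ?case by (simp add: a')
qed

lemma card_eq_by_relation:
  assumes "\<And>x. x \<in> X \<Longrightarrow> \<exists>!y. y \<in> Y \<and> R x y" "\<And>y. y \<in> Y \<Longrightarrow> \<exists>!x. x \<in> X \<and> R x y"
  shows "card X = card Y"
proof -
  define f where "f = (\<lambda>x. THE y. y \<in> Y \<and> R x y)"
  have f: "f x \<in> Y \<and> R x (f x)" if "x \<in> X" for x
    unfolding f_def by (rule theI'[OF assms(1)[OF that]])
  have "inj_on f X"
    by (rule inj_onI) (metis f assms(2))
  moreover have "f ` X = Y"
  proof (intro equalityI subsetI)
    fix y assume y: "y \<in> Y"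
    then obtain x where "x \<in> X" "R x y" using assms(2) by blast
    hence "f x = y" using f[of x] assms(1)[of x] y by blast
    thus "y \<in> f ` X" using \<open>x \<in> X\<close> by blast
  qed (use f in auto)
  ultimately show ?thesis by (metis card_image)
qed

lemma card_ascending_words:
  assumes k: "1 \<le> k" and L: "typed_k_strict k L" and M: "typed_k_strict k M"
    and size: "psize L = psize M + r"
  shows "card {a. length a = r \<and> word_prod a ` typed_tail k M = typed_tail k L} =
    card {Ls. length Ls = Suc r \<and> hd Ls = L \<and> last Ls = M \<and> successively (box_step k) Ls}"
proof (rule card_eq_by_relation[where R = "spells k"])
  fix a assume a: "a \<in> {a. length a = r \<and> word_prod a ` typed_tail k M = typed_tail k L}"
  hence "ascending (typed_tail k M) a"
    using size by (simp add: ascending_def card_inversions_typed_tail[OF k] L M)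
  then obtain Ls where Ls: "spells k a Ls" "last Ls = M" using ascending_spells[OF k M] by blast
  have f: "typed_k_strict k (hd Ls)" "typed_tail k (hd Ls) = typed_tail k L" "successively (box_step k) Ls"
    using spells_facts[OF k Ls(1)] M Ls(2) a by auto
  have "hd Ls = L" by (rule typed_tail_inject[OF k f(1) L f(2)])
  thus "\<exists>!Ls. Ls \<in> {Ls. length Ls = Suc r \<and> hd Ls = L \<and> last Ls = M \<and> successively (box_step k) Ls}
      \<and> spells k a Ls"
    using Ls f spells_length[OF Ls(1)] a spells_unique_chain[OF k] M
    by (intro ex1I[of _ Ls]) auto
next
  fix Ls assume Ls: "Ls \<in> {Ls. length Ls = Suc r \<and> hd Ls = L \<and> last Ls = M \<and> successively (box_step k) Ls}"
  hence "Ls \<noteq> []" by auto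
  then obtain a where a: "spells k a Ls" using chain_spelled[OF k] Ls by blast
  have "typed_tail k L = word_prod a ` typed_tail k M" using spells_facts[OF k a] Ls M by auto
  thus "\<exists>!a. a \<in> {a. length a = r \<and> word_prod a ` typed_tail k M = typed_tail k L} \<and> spells k a Ls"
    using a spells_length[OF a] Ls spells_unique_word[OF k] M
    by (intro ex1I[of _ a]) auto
qed

section \<open>Standard tableaux as chains\<close>

lemma typed_horiz_strip_subset: "typed_horiz_strip k L M \<Longrightarrow> diagram (shape M) \<subseteq> diagram (shape L)"
  by (simp add: typed_horiz_strip_def horiz_strip_k_def)

lemma typed_horiz_strip_size: "typed_horiz_strip k L M \<Longrightarrow>
    psize L = psize M + card (diagram (shape L) - diagram (shape M))"
  using typed_horiz_strip_subset[of k L M] card_mono[OF finite_diagram, of "diagram (shape M)" "shape L"]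
    finite_diagram
  by (simp add: sum_list_eq_card_diagram card_Diff_subset)

text \<open>
Equal shapes have types that are both zero or both positive, and two different positive types have sum
3.
\<close>

lemma typed_horiz_strip_same_size:
  assumes "typed_horiz_strip k L M" "psize L = psize M" shows "L = M"
proof -
  have typed: "typed_k_strict k L" "typed_k_strict k M" "ptype L + ptype M \<noteq> 3"
    using assms(1) by (auto simp: typed_horiz_strip_def)
  have "diagram (shape L) = diagram (shape M)"
    using typed_horiz_strip_size[OF assms(1)] assms(2) finite_diagram typed_horiz_strip_subset[OF assms(1)]
    by auto
  hence "shape L = shape M"
    using typed by (intro partition_eqI) (auto simp: typed_k_strict_def k_strict_def col_len_def)
  thus ?thesis using typed by (auto simp: typed_k_strict_def prod_eq_iff)
qed

lemma filling_entry_iff: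
  "(b, Plain j) \<in> filling Ts \<or> (b, Circled j) \<in> filling Ts \<longleftrightarrow>
    1 \<le> j \<and> j < length Ts \<and> b \<in> diagram (shape (Ts ! j)) - diagram (shape (Ts ! (j - 1)))"
  by (auto simp: filling_def split: if_splits)

text \<open>
Each of the entries \<open>1, \<dots>, r\<close> occurs once, so the first \<open>r\<close> steps add one box each and reach the size of
\<open>L\<close>.  Any later step would be a repetition of \<open>L\<close>.
\<close>

lemma standard_typed_tableaux_eq:
  assumes L: "typed_k_strict k L" and M: "typed_k_strict k M" and size: "psize L = psize M + r"
  shows "standard_typed_tableaux k L M =
    {Ts. length Ts = Suc r \<and> hd Ts = M \<and> last Ts = L \<and> successively (\<lambda>M L. box_step k L M) Ts}"
proof (intro equalityI subsetI)
  fix Ts assume "Ts \<in> standard_typed_tableaux k L M"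
  hence ne: "Ts \<noteq> []" and hl: "hd Ts = M" "last Ts = L"
    and strip: "\<And>i. Suc i < length Ts \<Longrightarrow> typed_horiz_strip k (Ts ! Suc i) (Ts ! i)"
    and norep: "2 \<le> length Ts \<Longrightarrow> Ts ! (length Ts - 2) \<noteq> last Ts"
    and ent: "\<And>j. j \<in> {1..r} \<Longrightarrow> \<exists>!b. (b, Plain j) \<in> filling Ts \<or> (b, Circled j) \<in> filling Ts"
    by (auto simp: standard_typed_tableaux_def typed_tableau_def size)
  have one: "j < length Ts \<and> card (diagram (shape (Ts ! j)) - diagram (shape (Ts ! (j - 1)))) = 1"
    if "j \<in> {1..r}" for j
  proof -
    have ex1: "\<exists>!b. 1 \<le> j \<and> j < length Ts \<and> b \<in> diagram (shape (Ts ! j)) - diagram (shape (Ts ! (j - 1)))"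
      using ent[OF that] unfolding filling_entry_iff .
    hence "j < length Ts" by blast
    moreover have "\<exists>!b. b \<in> diagram (shape (Ts ! j)) - diagram (shape (Ts ! (j - 1)))" using ex1 by blast
    hence "card {b. b \<in> diagram (shape (Ts ! j)) - diagram (shape (Ts ! (j - 1)))} = 1"
      unfolding card_Collect_eq_1_iff .
    ultimately show ?thesis unfolding Collect_mem_eq by blast
  qed
  have psize: "j \<le> r \<Longrightarrow> psize (Ts ! j) = psize M + j" for j
  proof (induction j)
    case 0 thus ?case using hl ne by (simp add: hd_conv_nth)
  next
    case (Suc j)
    thus ?case using one[of "Suc j"] typed_horiz_strip_size[OF strip[of j]] by simp
  qed
  have len: "Suc r \<le> length Ts" using one[of r] ne by (cases r) (auto simp: Suc_le_eq)
  have mono: "psize (Ts ! i) \<le> psize (Ts ! j)" if "i \<le> j" "j < length Ts" for i j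
    using that
  proof (induction j rule: dec_induct)
    case (step j)
    thus ?case using typed_horiz_strip_size[OF strip[of j]] by simp
  qed simp
  have "length Ts = Suc r"
  proof (rule ccontr)
    assume "length Ts \<noteq> Suc r"
    hence l: "Suc (Suc r) \<le> length Ts" using len by simp
    define p where "p = length Ts - 2"
    have "length Ts = Suc (Suc p)" using l by (simp add: p_def)
    hence p: "r \<le> p" "Suc p < length Ts" "last Ts = Ts ! Suc p"
      using l ne by (auto simp: last_conv_nth)
    have "psize (Ts ! r) \<le> psize (Ts ! p)" "psize (Ts ! p) \<le> psize (Ts ! Suc p)"
      using mono[of r p] mono[of p "Suc p"] p by auto
    hence "psize (Ts ! Suc p) = psize (Ts ! p)" using psize[of r] p(3) hl(2) size by simp
    hence "Ts ! Suc p = Ts ! p" by (rule typed_horiz_strip_same_size[OF strip[OF p(2)]])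
    thus False using norep p l by (simp add: p_def)
  qed
  moreover have "box_step k (Ts ! Suc i) (Ts ! i)" if "Suc i < length Ts" for i
    using strip[OF that] psize[of i] psize[of "Suc i"] that \<open>length Ts = Suc r\<close> by (simp add: box_step_def)
  ultimately show "Ts \<in> {Ts. length Ts = Suc r \<and> hd Ts = M \<and> last Ts = L \<and>
      successively (\<lambda>M L. box_step k L M) Ts}"
    using hl by (simp add: successively_conv_nth)
next
  fix Ts assume "Ts \<in> {Ts. length Ts = Suc r \<and> hd Ts = M \<and> last Ts = L \<and>
      successively (\<lambda>M L. box_step k L M) Ts}"
  hence len: "length Ts = Suc r" and hl: "hd Ts = M" "last Ts = L"
    and step: "\<And>i. Suc i < length Ts \<Longrightarrow> box_step k (Ts ! Suc i) (Ts ! i)"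
    by (auto simp: successively_conv_nth)
  have ne: "Ts \<noteq> []" using len by auto
  have typed: "typed_k_strict k T" if "T \<in> set Ts" for T
  proof -
    obtain j where j: "j < length Ts" "T = Ts ! j" using \<open>T \<in> set Ts\<close> by (metis in_set_conv_nth)
    show ?thesis
    proof (cases j)
      case 0 thus ?thesis using j hl(1) M ne by (simp add: hd_conv_nth)
    next
      case (Suc i) thus ?thesis using step[of i] j box_step_typed by blast
    qed
  qed
  have "Ts ! (length Ts - 2) \<noteq> last Ts" if "2 \<le> length Ts"
  proof -
    define p where "p = length Ts - 2"
    have "length Ts = Suc (Suc p)" using that by (simp add: p_def)
    hence "Suc p < length Ts" "last Ts = Ts ! Suc p" using ne by (auto simp: last_conv_nth)
    thus ?thesis using step[of p] by (auto simp: box_step_def p_def[symmetric])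
  qed
  moreover have "\<exists>!b. (b, Plain j) \<in> filling Ts \<or> (b, Circled j) \<in> filling Ts" if "j \<in> {1..r}" for j
  proof -
    have j: "1 \<le> j" "j < length Ts" "Suc (j - 1) = j" using that len by auto
    hence s: "box_step k (Ts ! j) (Ts ! (j - 1))" using step[of "j - 1"] by simp
    hence "typed_horiz_strip k (Ts ! j) (Ts ! (j - 1))" "psize (Ts ! j) = psize (Ts ! (j - 1)) + 1"
      by (simp_all add: box_step_def)
    hence "card (diagram (shape (Ts ! j)) - diagram (shape (Ts ! (j - 1)))) = 1"
      using typed_horiz_strip_size by (metis add_left_cancel)
    hence "card {b. b \<in> diagram (shape (Ts ! j)) - diagram (shape (Ts ! (j - 1)))} = 1"
      unfolding Collect_mem_eq .
    hence "\<exists>!b. b \<in> diagram (shape (Ts ! j)) - diagram (shape (Ts ! (j - 1)))"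
      unfolding card_Collect_eq_1_iff .
    thus ?thesis unfolding filling_entry_iff using j by blast
  qed
  ultimately show "Ts \<in> standard_typed_tableaux k L M"
    using ne hl typed step
    by (auto simp: standard_typed_tableaux_def typed_tableau_def size box_step_def)
qed

section \<open>Counting\<close>

text \<open>
Each letter adds at most 2 to the number of inversions, which bounds the length from below.  The word
from \<open>typed_cols_reachable\<close> attains the bound; that its product is \<open>w_lam\<close> follows from uniqueness.
\<close>

lemma cox_length_w_elt:
  assumes k: "1 \<le> k" "k \<le> n" and L: "L \<in> typed_partitions k n" and c: "w_elt k n L = word_prod c"
  shows "cox_length (w_elt k n L) = psize L"
  unfolding cox_length_def
proof (rule Least_equality)
  have tL: "typed_k_strict k L" using L by (simp add: typed_partitions_def)
  hence L': "k_strict k (shape L)" "typed_cols k (cols L) (ptype L)"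
    using typed_k_strict_cols[OF k(1)] by auto
  obtain a where a: "length a = cols_size (cols L)" "grassmannian k (word_prod a)"
    "word_prod a ` tail k = tail_entries k (cols L) (ptype L)"
    using typed_cols_reachable[OF k(1) L'(2)] by blast
  have "word_prod a = word_prod c"
    by (rule grassmannian_unique[OF a(2) _ k(1)])
      (use w_elt_grassmannian[OF k L] c a(3) in auto)
  moreover have "length a = psize L" using a(1) sum_list_eq_cols_size[OF L'(1)] by (simp add: cols_def)
  ultimately show "\<exists>a. length a = psize L \<and> word_prod a = w_elt k n L" using c by auto
  fix l assume "\<exists>a. length a = l \<and> word_prod a = w_elt k n L"
  then obtain a where "length a = l" "word_prod a = w_elt k n L" by blast
  thus "psize L \<le> l"
    using card_inversions_word[OF tail_set_tail, of a k] w_elt_grassmannian(2)[OF k L]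
      card_inversions_typed_tail[OF k(1) tL] by (simp add: typed_tail_def inversions_tail)
qed

theorem corollary3:
  fixes w :: "int \<Rightarrow> int" and k n :: nat and lam mu :: typed_partition
  assumes "1 \<le> k" and "k \<le> n"
    and "w \<in> weyl_D_inf" and "skew_elt w"
    and "compatible_pair k n lam mu"
    and "w_elt k n lam = w \<circ> w_elt k n mu"
  shows "card (reduced_words w) = card (standard_typed_tableaux k lam mu)"
proof -
  note k = assms(1,2) and fac = assms(6)
  have lam: "lam \<in> typed_partitions k n" and mu: "mu \<in> typed_partitions k n"
    using assms(5) by (auto simp: compatible_pair_def)
  obtain b c where bc: "b @ c \<in> reduced_words (w_elt k n lam)" "c \<in> reduced_words (w_elt k n mu)"
    using assms(5) by (auto simp: compatible_pair_def)
  have typed: "typed_k_strict k lam" "typed_k_strict k mu"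
    using lam mu by (auto simp: typed_partitions_def)
  have wc: "w_elt k n mu = word_prod c" and wbc: "w_elt k n lam = word_prod (b @ c)"
    using bc by (auto simp: reduced_words_def)
  have lc: "length c = psize mu" and lbc: "length b + length c = psize lam"
    using bc cox_length_w_elt[OF k mu wc] cox_length_w_elt[OF k lam wbc]
    by (auto simp: reduced_words_def)
  define r where "r = length b"
  have size: "psize lam = psize mu + r" using lc lbc by (simp add: r_def)
  have cancel: "f = w" if "f \<circ> word_prod c = w_elt k n lam" for f
  proof
    fix v
    obtain u where u: "word_prod c u = v" using bij_word_prod[of c] by (metis bij_pointE)
    have "(f \<circ> word_prod c) u = (w \<circ> word_prod c) u" using that fac wc by simp
    thus "f v = w v" using u by simp
  qed
  have wb: "word_prod b = w" by (rule cancel) (simp only: wbc word_prod_append)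
  have cox: "cox_length w = r"
    unfolding cox_length_def
  proof (rule Least_equality)
    show "\<exists>a. length a = r \<and> word_prod a = w" using wb by (auto simp: r_def)
    fix l assume "\<exists>a. length a = l \<and> word_prod a = w"
    then obtain a where a: "length a = l" "word_prod a = w" by blast
    have "word_prod (a @ c) = w_elt k n lam" using a(2) fac wc by simp
    hence "psize lam \<le> length (a @ c)"
      using cox_length_w_elt[OF k lam wbc] unfolding cox_length_def by (metis (mono_tags, lifting) Least_le)
    thus "r \<le> l" using a(1) lc size by simp
  qed
  have tv: "typed_tail k mu = word_prod c ` tail k" "typed_tail k lam = word_prod (b @ c) ` tail k"
    using w_elt_grassmannian(2)[OF k mu] w_elt_grassmannian(2)[OF k lam] wc wbc
    by (simp_all only: typed_tail_def)
  have gr: "grassmannian k (word_prod c)" "grassmannian k (word_prod (b @ c))"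
    using w_elt_grassmannian(1)[OF k mu] w_elt_grassmannian(1)[OF k lam] wc wbc by simp_all
  have words: "reduced_words w = {a. length a = r \<and> word_prod a ` typed_tail k mu = typed_tail k lam}"
  proof (intro equalityI subsetI)
    fix a assume "a \<in> reduced_words w"
    hence "length a = r" "word_prod a = word_prod b" using cox wb by (auto simp: reduced_words_def)
    thus "a \<in> {a. length a = r \<and> word_prod a ` typed_tail k mu = typed_tail k lam}"
      by (simp add: tv image_comp)
  next
    fix a assume a: "a \<in> {a. length a = r \<and> word_prod a ` typed_tail k mu = typed_tail k lam}"
    hence "ascending (word_prod c ` tail k) a"
      using size by (simp add: ascending_def tv(1)[symmetric] card_inversions_typed_tail[OF k(1)] typed)
    hence "grassmannian k (word_prod (a @ c))" by (rule grassmannian_ascending[OF gr(1)])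
    moreover have "word_prod (a @ c) ` tail k = word_prod (b @ c) ` tail k"
      using a tv by (simp add: image_comp)
    ultimately have "word_prod (a @ c) = word_prod (b @ c)"
      using grassmannian_unique gr(2) k(1) by blast
    hence "word_prod a = w" by (intro cancel) (simp add: wbc)
    thus "a \<in> reduced_words w" using a cox by (simp add: reduced_words_def)
  qed
  let ?Y = "{Ls. length Ls = Suc r \<and> hd Ls = lam \<and> last Ls = mu \<and> successively (box_step k) Ls}"
  have "standard_typed_tableaux k lam mu = rev ` ?Y"
    unfolding standard_typed_tableaux_eq[OF typed size]
  proof (intro equalityI subsetI)
    fix Ts assume Ts: "Ts \<in> {Ts. length Ts = Suc r \<and> hd Ts = mu \<and> last Ts = lam \<and>
      successively (\<lambda>M L. box_step k L M) Ts}"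
    hence "rev Ts \<in> ?Y" by (auto simp: hd_rev last_rev)
    thus "Ts \<in> rev ` ?Y" by (rule rev_image_eqI) simp
  next
    fix Ts assume "Ts \<in> rev ` ?Y"
    then obtain Ls where "Ls \<in> ?Y" "Ts = rev Ls" by blast
    thus "Ts \<in> {Ts. length Ts = Suc r \<and> hd Ts = mu \<and> last Ts = lam \<and>
      successively (\<lambda>M L. box_step k L M) Ts}" by (auto simp: hd_rev last_rev)
  qed
  hence "card (standard_typed_tableaux k lam mu) = card ?Y" by (simp add: card_image)
  thus ?thesis unfolding words using card_ascending_words[OF k(1) typed size] by simp
qed

end
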